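(* Let $\Omega$ be a semigroup and let $A$ and $M$ be two vector spaces over a field ${\bf k}$ of characteristic $0$. Then the graded vector space $s^{-1}\mathfrak{h}'\oplus\mathfrak{a}$ (defined in the context) carries an $L_\infty$-algebra structure with the operations $\{l_k\}_{k\geq1}$ given by \begin{align*} l_2(s^{-1}q,s^{-1}q')=~&(-1)^{|q|}s^{-1}[\widetilde{q},\widetilde{q'}]_\Omega,\\ l_k(s^{-1}q,p_1,\ldots,p_{k-1})=~&P[\cdots[[\widetilde{q},p_1]_\Omega,p_2]_\Omega,\ldots,p_{k-1}]_\Omega,\quad\text{for }k\geq2, \end{align*} for homogeneous $q,q'\in\mathfrak{h}'$ and homogeneous $p_1,\ldots,p_{k-1}\in\mathfrak{a}$; up to permutations of the inputs $(s^{-1}q,s^{-1}q')$ and $(s^{-1}q,p_1,\ldots,p_{k-1})$ with $k\geq2$, all other maps vanish (that is, $l_1=0$, $l_k$ vanishes when all its inputs are from $\mathfrak{a}$, and for $k\geq3$ $l_k$ vanishes when two or more of its inputs are from $s^{-1}\mathfrak{h}'$).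
   Context: All vector spaces and linear maps are over a field ${\bf k}$ of characteristic $0$; $\Omega$ is a semigroup. $L_\infty$-algebra (shifted convention): a graded vector space $\mathfrak{L}=\oplus_{i\in\mathbb{Z}}\mathfrak{L}_i$ with degree $1$ linear maps $l_k:\mathfrak{L}^{\otimes k}\to\mathfrak{L}$, $k\geq1$, that are graded symmetric, $l_k(x_{\sigma(1)},\ldots,x_{\sigma(k)})=\epsilon(\sigma)\,l_k(x_1,\ldots,x_k)$ for $\sigma\in\mathbb{S}_k$, and satisfy for all $n\geq1$ and homogeneous $x_1,\ldots,x_n$ $$\sum_{i+j=n+1}\ \sum_{\sigma\in\mathbb{S}_{(i,n-i)}}\epsilon(\sigma)\,l_j\big(l_i(x_{\sigma(1)},\ldots,x_{\sigma(i)}),x_{\sigma(i+1)},\ldots,x_{\sigma(n)}\big)=0,$$ where $\mathbb{S}_{(i,n-i)}$ is the set of $(i,n-i)$-shuffles and $\epsilon(\sigma)=\epsilon(\sigma;x_1,\ldots,x_n)$ is the Koszul sign. $\Omega$-Gerstenhaber bracket. For a vector space $V$ and $n\geq1$, $\mathrm{Hom}_\Omega(V^{\otimes n},V)$ is the vector space of collections $f=\{f_{\alpha_1,\ldots,\alpha_n}:V^{\otimes n}\to V\}_{\alpha_1,\ldots,\alpha_n\in\Omega}$ of linear maps (and similarly $\mathrm{Hom}_\Omega(W,W')$ for $W$ a summand of $V^{\otimes n}$, $W'$ a summand of $V$). For $f\in\mathrm{Hom}_\Omega(V^{\otimes m},V)$, $g\in\mathrm{Hom}_\Omega(V^{\otimes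 n},V)$ and $1\leq i\leq m$, $$(f\circ_i g)_{\alpha_1,\ldots,\alpha_{m+n-1}}(v_1,\ldots,v_{m+n-1})=f_{\alpha_1,\ldots,\alpha_{i-1},\alpha_i\cdots\alpha_{i+n-1},\alpha_{i+n},\ldots,\alpha_{m+n-1}}\big(v_1,\ldots,v_{i-1},g_{\alpha_i,\ldots,\alpha_{i+n-1}}(v_i,\ldots,v_{i+n-1}),v_{i+n},\ldots,v_{m+n-1}\big)$$ (here $\alpha_i\cdots\alpha_{i+n-1}$ is the product in $\Omega$), and $$[f,g]_\Omega=\sum_{i=1}^m(-1)^{(i-1)(n-1)}f\circ_i g-(-1)^{(m-1)(n-1)}\sum_{i=1}^n(-1)^{(i-1)(m-1)}g\circ_i f.$$ With $\mathrm{Hom}_\Omega(V^{\otimes n+1},V)$ in degree $n$ this is a graded Lie algebra. Put $\mathfrak{g}=\oplus_{n\geq0}\mathrm{Hom}_\Omega((A\oplus M)^{\otimes n+1},A\oplus M)$ with the bracket $[~,~]_\Omega$. The spaces. For $k,l\geq0$, $\mathcal{A}^{k,l}$ is the direct sum of all $(k+l)$-fold tensor products of copies of $A$ and $M$ in which $A$ appears $k$ times and $M$ appears $l$ times, so $(A\oplus M)^{\otimes n}=\oplus_{k+l=n}\mathcal{A}^{k,l}$. Let $\mathfrak{a}=\oplus_{n\geq0}\mathfrak{a}_n\subset\mathfrak{g}$ with $\mathfrak{a}_n=\mathrm{Hom}_\Omega(M^{\otimes n+1},A)$ in degree $n$, and let $P:\mathfrak{g}\to\mathfrak{g}$ be the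 projection onto $\mathfrak{a}$ that kills all the other components $\mathrm{Hom}_\Omega(\mathcal{A}^{k,l},A)$ with $k\geq1$ and $\mathrm{Hom}_\Omega(\mathcal{A}^{k,l},M)$. Let $\mathfrak{h}'=\oplus_{n\geq0}\mathfrak{h}'_n$ with $\mathfrak{h}'_n=\mathrm{Hom}(A^{\otimes n+1},A)\oplus\mathrm{Hom}(\mathcal{A}^{n,1},M)\subset\mathrm{Hom}((A\oplus M)^{\otimes n+1},A\oplus M)$ (ordinary, unlabelled, linear maps) in degree $n$, so $|q|=n$ for $q\in\mathfrak{h}'_n$. For an ordinary linear map $f:(A\oplus M)^{\otimes n+1}\to A\oplus M$, $\widetilde f\in\mathrm{Hom}_\Omega((A\oplus M)^{\otimes n+1},A\oplus M)$ is the constant collection $(\widetilde f)_{\alpha_1,\ldots,\alpha_{n+1}}=f$. The map $q\mapsto\widetilde q$ embeds $\mathfrak{h}'$ in $\mathfrak{g}$; for $q,q'\in\mathfrak{h}'$ the element $[\widetilde q,\widetilde{q'}]_\Omega$ lies in the image of $\mathfrak{h}'$ and is identified with the corresponding element of $\mathfrak{h}'$. $s^{-1}$ denotes desuspension: $(s^{-1}\mathfrak{h}')_n=\mathfrak{h}'_{n+1}$. Thus $(s^{-1}\mathfrak{h}'\oplus\mathfrak{a})_{-1}=\mathfrak{h}'_0$ and $(s^{-1}\mathfrak{h}'\oplus\mathfrak{a})_n=\mathfrak{h}'_{n+1}\oplus\mathfrak{a}_n$ for $n\geq0$. *)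

theory Defs
  imports
    "HOL-Analysis.Product_Vector"
    "HOL-Combinatorics.Permutations"
    "HOL-Library.Function_Algebras"
begin

text \<open>
  Tensor powers are replaced by their universal property: a linear map out of a \<open>n\<close>-fold tensor
  power is an \<open>n\<close>-linear map, represented as a function on lists of length \<open>n\<close>.
\<close>

definition multilinear_on ::
  "('k \<Rightarrow> 'u \<Rightarrow> 'u) \<Rightarrow> ('k \<Rightarrow> 'v \<Rightarrow> 'v) \<Rightarrow> 'u set \<Rightarrow> nat \<Rightarrow> ('u::ab_group_add list \<Rightarrow> 'v::ab_group_add) \<Rightarrow> bool"
  where "multilinear_on s1 s2 S n f \<longleftrightarrow>
    (\<forall>xs i x y. length xs = n \<and> set xs \<subseteq> S \<and> i < n \<and> x \<in> S \<and> y \<in> S \<longrightarrow>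
       f (xs[i := x + y]) = f (xs[i := x]) + f (xs[i := y])) \<and>
    (\<forall>xs i c x. length xs = n \<and> set xs \<subseteq> S \<and> i < n \<and> x \<in> S \<longrightarrow>
       f (xs[i := s1 c x]) = s2 c (f (xs[i := x])))"


section \<open>\<open>L\<^sub>\<infinity>\<close>-algebras\<close>

text \<open>
  A graded vector space is given by independent subspaces \<open>L i\<close> of an ambient vector space; the
  space itself is their internal direct sum \<open>total\<close>.
\<close>

locale graded_vector_space = vector_space scale
  for scale :: "'k::field \<Rightarrow> 'l::ab_group_add \<Rightarrow> 'l" +
  fixes L :: "int \<Rightarrow> 'l set"
  assumes subspace_L: "subspace (L i)"
    and independent_L: "finite I \<Longrightarrow> (\<And>i. i \<in> I \<Longrightarrow> x i \<in> L i) \<Longrightarrow> (\<Sum>i\<in>I. x i) = 0 \<Longrightarrow> i \<in> I \<Longrightarrow> x i = 0"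
begin

definition total :: "'l set"
  where "total = span (\<Union>i. L i)"

definition homogeneous :: "int list \<Rightarrow> 'l list \<Rightarrow> bool"
  where "homogeneous ds xs \<longleftrightarrow> list_all2 (\<lambda>d x. x \<in> L d) ds xs"

end

text \<open>
  Permutations of \<open>n\<close> letters act on the positions \<open>0, \<dots>, n - 1\<close> of a list, so that
  \<open>permute_range \<sigma> xs a b\<close> is \<open>x\<^bsub>\<sigma>(a)\<^esub>, \<dots>, x\<^bsub>\<sigma>(b-1)\<^esub>\<close>.
\<close>

definition permute_range :: "(nat \<Rightarrow> nat) \<Rightarrow> 'x list \<Rightarrow> nat \<Rightarrow> nat \<Rightarrow> 'x list"
  where "permute_range \<sigma> xs a b = map (\<lambda>r. xs ! \<sigma> r) [a..<b]"

definition shuffle_perms :: "nat \<Rightarrow> nat \<Rightarrow> (nat \<Rightarrow> nat) set"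
  where "shuffle_perms i j =
    {\<sigma>. \<sigma> permutes {..<i + j} \<and> strict_mono_on {..<i} \<sigma> \<and> strict_mono_on {i..<i + j} \<sigma>}"

text \<open>Koszul sign of \<open>\<sigma>\<close> on letters of degrees \<open>ds\<close>: one factor for each inversion.\<close>

definition koszul_sign :: "(nat \<Rightarrow> nat) \<Rightarrow> int list \<Rightarrow> 'k::field"
  where "koszul_sign \<sigma> ds =
    (\<Prod>(r, s) \<in> {(r, s). r < s \<and> s < length ds \<and> \<sigma> s < \<sigma> r}. (-1) powi (ds ! \<sigma> r * ds ! \<sigma> s))"

locale L_infinity_algebra = graded_vector_space scale L
  for scale :: "'k::field \<Rightarrow> 'l::ab_group_add \<Rightarrow> 'l" and L :: "int \<Rightarrow> 'l set" +
  fixes l :: "nat \<Rightarrow> 'l list \<Rightarrow> 'l"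
  assumes multilinear_l: "k \<ge> 1 \<Longrightarrow> multilinear_on scale scale total k (l k)"
    and degree_l: "k \<ge> 1 \<Longrightarrow> length xs = k \<Longrightarrow> homogeneous ds xs \<Longrightarrow> l k xs \<in> L (sum_list ds + 1)"
    and symmetric_l: "k \<ge> 1 \<Longrightarrow> length xs = k \<Longrightarrow> homogeneous ds xs \<Longrightarrow> \<sigma> permutes {..<k} \<Longrightarrow>
      l k (permute_range \<sigma> xs 0 k) = scale (koszul_sign \<sigma> ds) (l k xs)"
    and jacobi_l: "n \<ge> 1 \<Longrightarrow> length xs = n \<Longrightarrow> homogeneous ds xs \<Longrightarrow>
      (\<Sum>(i, j) \<in> {(i, j). i \<ge> 1 \<and> j \<ge> 1 \<and> i + j = n + 1}. \<Sum>\<sigma> \<in> shuffle_perms i (n - i).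
         scale (koszul_sign \<sigma> ds) (l j (l i (permute_range \<sigma> xs 0 i) # permute_range \<sigma> xs i n))) = 0"


section \<open>Labelled multilinear maps and the \<open>\<Omega>\<close>-Gerstenhaber bracket\<close>

definition scale_fun :: "('k \<Rightarrow> 'v \<Rightarrow> 'v) \<Rightarrow> 'k \<Rightarrow> ('x \<Rightarrow> 'v) \<Rightarrow> ('x \<Rightarrow> 'v)"
  where "scale_fun sc c f = (\<lambda>x. sc c (f x))"

text \<open>
  Maps of arity \<open>n\<close> are extended by \<open>0\<close> to lists of other lengths, and likewise collections of
  arity \<open>n\<close> to label lists of other lengths. Hence an element of a direct sum over the arities is
  a single function, the sum of its components, and its component of arity \<open>n\<close> is its restriction
  to lists of length \<open>n\<close>.
\<close>

definition Hom_pow :: "('k \<Rightarrow> 'v \<Rightarrow> 'v) \<Rightarrow> nat \<Rightarrow> ('v::ab_group_add list \<Rightarrow> 'v) set"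
  where "Hom_pow sc n = {f. multilinear_on sc sc UNIV n f \<and> (\<forall>vs. length vs \<noteq> n \<longrightarrow> f vs = 0)}"

definition labelled :: "nat \<Rightarrow> ('v list \<Rightarrow> 'v::ab_group_add) set \<Rightarrow> ('w list \<Rightarrow> 'v list \<Rightarrow> 'v) set"
  where "labelled n H = {f. \<forall>\<alpha>. if length \<alpha> = n then f \<alpha> \<in> H else f \<alpha> = 0}"

text \<open>Product of a nonempty list of labels; there need not be a unit.\<close>

definition label_prod :: "'w::semigroup_mult list \<Rightarrow> 'w"
  where "label_prod \<alpha> = foldl (*) (hd \<alpha>) (tl \<alpha>)"

text \<open>\<open>f \<circ>\<^sub>i g\<close> (with \<open>i \<ge> 1\<close>) for \<open>g\<close> of arity \<open>n\<close>.\<close>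

definition comp_at :: "nat \<Rightarrow> nat \<Rightarrow> ('w::semigroup_mult list \<Rightarrow> 'v list \<Rightarrow> 'v) \<Rightarrow>
    ('w list \<Rightarrow> 'v list \<Rightarrow> 'v) \<Rightarrow> 'w list \<Rightarrow> 'v list \<Rightarrow> 'v"
  where "comp_at n i f g \<alpha> vs =
    (let \<beta> = take n (drop (i - 1) \<alpha>); us = take n (drop (i - 1) vs) in
     f (take (i - 1) \<alpha> @ [label_prod \<beta>] @ drop (i - 1 + n) \<alpha>)
       (take (i - 1) vs @ [g \<beta> us] @ drop (i - 1 + n) vs))"

text \<open>The bracket of the component of \<open>f\<close> of arity \<open>m\<close> with the one of \<open>g\<close> of arity \<open>n\<close>.\<close>

definition bracket_arity :: "('k::field \<Rightarrow> 'v \<Rightarrow> 'v) \<Rightarrow> nat \<Rightarrow> nat \<Rightarrow>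
    ('w::semigroup_mult list \<Rightarrow> 'v list \<Rightarrow> 'v) \<Rightarrow> ('w list \<Rightarrow> 'v list \<Rightarrow> 'v) \<Rightarrow>
    'w list \<Rightarrow> 'v list \<Rightarrow> 'v::ab_group_add"
  where "bracket_arity sc m n f g \<alpha> vs =
    (if length \<alpha> = m + n - 1 \<and> length vs = m + n - 1
     then (\<Sum>i=1..m. sc ((-1) ^ ((i - 1) * (n - 1))) (comp_at n i f g \<alpha> vs))
        - sc ((-1) ^ ((m - 1) * (n - 1)))
            (\<Sum>i=1..n. sc ((-1) ^ ((i - 1) * (m - 1))) (comp_at m i g f \<alpha> vs))
     else 0)"

text \<open>
  The bilinear extension to the direct sum over all arities \<open>\<ge> 1\<close>: only the pairs of arities with
  \<open>m + n - 1 = length \<alpha>\<close> contribute to the value at \<open>\<alpha>\<close>.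
\<close>

definition bracket :: "('k::field \<Rightarrow> 'v \<Rightarrow> 'v) \<Rightarrow>
    ('w::semigroup_mult list \<Rightarrow> 'v list \<Rightarrow> 'v) \<Rightarrow> ('w list \<Rightarrow> 'v list \<Rightarrow> 'v) \<Rightarrow>
    'w list \<Rightarrow> 'v list \<Rightarrow> 'v::ab_group_add"
  where "bracket sc f g \<alpha> vs =
    (\<Sum>(m, n) \<in> {(m, n). m \<ge> 1 \<and> n \<ge> 1 \<and> m + n = length \<alpha> + 1}. bracket_arity sc m n f g \<alpha> vs)"

text \<open>The constant collection; the guard restricts to labels and arguments of the same arity.\<close>

definition const_coll :: "('v list \<Rightarrow> 'v::zero) \<Rightarrow> 'w list \<Rightarrow> 'v list \<Rightarrow> 'v"
  where "const_coll q \<alpha> vs = (if length vs = length \<alpha> then q vs else 0)"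


section \<open>The graded vector space \<open>s\<^sup>-\<^sup>1\<hh>' \<oplus> \<aa>\<close>\<close>

text \<open>
  \<open>pure k l\<close> is the set of tuples of elements of \<open>A\<close> and \<open>M\<close> with \<open>k\<close> entries in \<open>A\<close> and \<open>l\<close> in
  \<open>M\<close>; as tensors they span \<open>\<A>\<^bsup>k,l\<^esup>\<close>.
\<close>

definition embed :: "'a + 'm \<Rightarrow> 'a::zero \<times> 'm::zero"
  where "embed z = (case z of Inl a \<Rightarrow> (a, 0) | Inr x \<Rightarrow> (0, x))"

definition pure :: "nat \<Rightarrow> nat \<Rightarrow> ('a::zero \<times> 'm::zero) list set"
  where "pure k l = {map embed zs | zs.
    length (filter isl zs) = k \<and> length (filter (\<lambda>z. \<not> isl z) zs) = l}"

definition summand_A :: "('a::zero \<times> 'm::zero) set"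
  where "summand_A = {(a, 0) | a. True}"

definition summand_M :: "('a::zero \<times> 'm::zero) set"
  where "summand_M = {(0, x) | x. True}"

text \<open>
  \<open>Hom(\<A>\<^bsup>k,l\<^esup>, W)\<close> inside \<open>Hom((A \<oplus> M)\<^bsup>\<otimes>k+l\<^esup>, A \<oplus> M)\<close>: maps with values in \<open>W\<close> that vanish on
  the complementary summands of the tensor power.
\<close>

definition Hom_summand :: "('k \<Rightarrow> 'a \<times> 'm \<Rightarrow> 'a \<times> 'm) \<Rightarrow> nat \<Rightarrow> nat \<Rightarrow> ('a \<times> 'm) set \<Rightarrow>
    (('a::ab_group_add \<times> 'm::ab_group_add) list \<Rightarrow> 'a \<times> 'm) set"
  where "Hom_summand sc k l W = {f \<in> Hom_pow sc (k + l). range f \<subseteq> W \<and>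
    (\<forall>k' l' vs. (k', l') \<noteq> (k, l) \<and> vs \<in> pure k' l' \<longrightarrow> f vs = 0)}"

definition space_h' :: "('k \<Rightarrow> 'a \<times> 'm \<Rightarrow> 'a \<times> 'm) \<Rightarrow> nat \<Rightarrow>
    (('a::ab_group_add \<times> 'm::ab_group_add) list \<Rightarrow> 'a \<times> 'm) set"
  where "space_h' sc n =
    {f + g | f g. f \<in> Hom_summand sc (n + 1) 0 summand_A \<and> g \<in> Hom_summand sc n 1 summand_M}"

definition space_a :: "('k \<Rightarrow> 'a \<times> 'm \<Rightarrow> 'a \<times> 'm) \<Rightarrow> nat \<Rightarrow>
    ('w list \<Rightarrow> ('a::ab_group_add \<times> 'm::ab_group_add) list \<Rightarrow> 'a \<times> 'm) set"
  where "space_a sc n = labelled (n + 1) (Hom_summand sc 0 (n + 1) summand_A)"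

text \<open>
  \<open>P\<close> precomposes with the projection \<open>A \<oplus> M \<rightarrow> M\<close> in all arguments and postcomposes with the
  projection \<open>A \<oplus> M \<rightarrow> A\<close>.
\<close>

definition proj_a :: "('w list \<Rightarrow> ('a::zero \<times> 'm) list \<Rightarrow> 'a \<times> 'm::zero) \<Rightarrow>
    'w list \<Rightarrow> ('a \<times> 'm) list \<Rightarrow> 'a \<times> 'm"
  where "proj_a f \<alpha> vs = (fst (f \<alpha> (map (\<lambda>v. (0, snd v)) vs)), 0)"

text \<open>Hence \<open>P\<close> is the identity on \<open>\<aa>\<close> and kills the other components:\<close>

lemma pure_M: "map (\<lambda>v. (0, snd v)) vs \<in> pure 0 (length vs)"
proof -
  have "map (\<lambda>v. (0, snd v)) vs = map embed (map (\<lambda>v. Inr (snd v)) vs)"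
    by (simp add: embed_def)
  moreover have "filter isl (map (\<lambda>v. Inr (snd v)) vs) = []" by (auto simp: filter_empty_conv)
  moreover have "filter (\<lambda>z. \<not> isl z) (map (\<lambda>v. Inr (snd v)) vs) = map (\<lambda>v. Inr (snd v)) vs"
    by (auto simp: filter_id_conv)
  ultimately show ?thesis unfolding pure_def by fastforce
qed

lemma proj_a_eq_0:
  fixes f :: "'w list \<Rightarrow> ('a::ab_group_add \<times> 'm::ab_group_add) list \<Rightarrow> 'a \<times> 'm"
  assumes "f \<in> labelled (k + l) (Hom_summand sc k l W)" and "k \<ge> 1 \<and> W = summand_A \<or> W = summand_M"
  shows "proj_a f = 0"
proof (intro ext)
  fix \<alpha> :: "'w list" and vs :: "('a \<times> 'm) list"
  let ?us = "map (\<lambda>v. (0, snd v)) vs"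
  have "fst (f \<alpha> ?us) = 0"
  proof (cases "length \<alpha> = k + l")
    case True
    then have f: "f \<alpha> \<in> Hom_summand sc k l W"
      using assms(1) unfolding labelled_def by (metis (mono_tags, lifting) mem_Collect_eq)
    show ?thesis
      using assms(2)
    proof
      assume "k \<ge> 1 \<and> W = summand_A"
      then show ?thesis using f pure_M[of vs] unfolding Hom_summand_def by fastforce
    next
      assume "W = summand_M"
      then have "f \<alpha> ?us \<in> summand_M" using f unfolding Hom_summand_def by blast
      then show ?thesis by (auto simp: summand_M_def)
    qed
  next
    case False
    then have "f \<alpha> = 0"
      using assms(1) unfolding labelled_def by (metis (mono_tags, lifting) mem_Collect_eq)
    then show ?thesis by simp
  qed
  then show "proj_a f \<alpha> vs = 0 \<alpha> vs" by (simp add: proj_a_def zero_prod_def)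
qed


lemma Hom_summand_proj:
  assumes f: "f \<in> Hom_summand sc 0 n summand_A" and "length vs = n"
  shows "f (map (\<lambda>v. (0, snd v)) vs) = f vs"
proof -
  let ?p = "\<lambda>v. (0, snd v)"
  have ml: "f (xs[i := x + y]) = f (xs[i := x]) + f (xs[i := y])"
    if "length xs = n" "i < n" for xs i x y
    using f that unfolding Hom_summand_def Hom_pow_def multilinear_on_def by (simp del: split_paired_All)
  have zero: "f (xs[i := 0]) = 0" if "length xs = n" "i < n" for xs i
    using ml[OF that, of 0 0] by simp
  have "f (map ?p vs) = f vs"
    if "length vs = n" "j \<le> n" "\<forall>i. j \<le> i \<and> i < n \<longrightarrow> vs ! i \<in> range embed" for vs j
    using that
  proof (induction j arbitrary: vs)
    case 0
    then have "v \<in> range embed" if "v \<in> set vs" for v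
      using that by (metis in_set_conv_nth le0)
    then have "\<forall>v\<in>set vs. \<exists>z. v = embed z" by blast
    then obtain zs where zs: "vs = map embed zs" by (metis ex_map_conv)
    have len: "length zs = n" using 0 zs by simp
    show ?case
    proof (cases "filter isl zs = []")
      case True
      then have "\<forall>z\<in>set zs. \<not> isl z" by (auto simp: filter_empty_conv)
      then have "map ?p vs = vs" by (auto simp: zs embed_def split: sum.splits)
      then show ?thesis by simp
    next
      case False
      then obtain z where z: "z \<in> set zs" "isl z" by (auto simp: filter_empty_conv)
      then obtain i where i: "i < n" "isl (zs ! i)" using len by (metis in_set_conv_nth)
      have "vs \<in> pure (length (filter isl zs)) (length (filter (\<lambda>z. \<not> isl z) zs))"
        unfolding pure_def zs by blast
      moreover have "length (filter isl zs) \<noteq> 0" using False by simp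
      ultimately have "f vs = 0" using f unfolding Hom_summand_def by blast
      moreover have "map ?p vs ! i = 0"
        using i len by (auto simp: zs embed_def zero_prod_def isl_def)
      then have "map ?p vs = (map ?p vs)[i := 0]" by (metis list_update_id)
      then have "f (map ?p vs) = 0" using zero 0(1) i(1) by (metis length_map)
      ultimately show ?thesis by simp
    qed
  next
    case (Suc j)
    have j: "j < n" using Suc by simp
    let ?a = "vs[j := (fst (vs ! j), 0)]" and ?m = "vs[j := ?p (vs ! j)]"
    have "vs = vs[j := (fst (vs ! j), 0) + ?p (vs ! j)]" by simp
    then have split: "f vs = f ?a + f ?m" using ml Suc.prems(1) j by metis
    have pa: "(fst (vs ! j), 0) \<in> range embed"
      by (rule image_eqI[of _ _ "Inl (fst (vs ! j))"]) (auto simp: embed_def)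
    have pm: "?p (vs ! j) \<in> range embed"
      by (rule image_eqI[of _ _ "Inr (snd (vs ! j))"]) (auto simp: embed_def)
    have "f (map ?p ?a) = f ?a"
      by (rule Suc.IH) (use Suc.prems j pa in \<open>auto simp: nth_list_update\<close>)
    moreover have "f (map ?p ?m) = f ?m"
      by (rule Suc.IH) (use Suc.prems j pm in \<open>auto simp: nth_list_update\<close>)
    moreover have "map ?p ?a = (map ?p vs)[j := 0]" by (simp add: map_update zero_prod_def)
    then have "f (map ?p ?a) = 0" using zero Suc.prems(1) j by (metis length_map)
    moreover have "map ?p ?m = map ?p vs"
      using Suc.prems(1) j by (intro nth_equalityI) (auto simp: nth_list_update)
    ultimately show ?case using split by (metis add_0)
  qed
  from this[of vs n] show ?thesis using assms(2) order_refl by (meson leD)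
qed

lemma proj_a_id:
  fixes f :: "'w list \<Rightarrow> ('a::ab_group_add \<times> 'm::ab_group_add) list \<Rightarrow> 'a \<times> 'm"
  assumes "f \<in> space_a sc n"
  shows "proj_a f = f"
proof (intro ext)
  fix \<alpha> :: "'w list" and vs :: "('a \<times> 'm) list"
  let ?us = "map (\<lambda>v. (0, snd v)) vs"
  show "proj_a f \<alpha> vs = f \<alpha> vs"
  proof (cases "length \<alpha> = n + 1")
    case True
    then have f: "f \<alpha> \<in> Hom_summand sc 0 (n + 1) summand_A"
      using assms unfolding space_a_def labelled_def by (metis (mono_tags, lifting) mem_Collect_eq)
    have "f \<alpha> ?us = f \<alpha> vs"
    proof (cases "length vs = n + 1")
      case True
      then show ?thesis by (rule Hom_summand_proj[OF f])
    next
      case False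
      then show ?thesis using f unfolding Hom_summand_def Hom_pow_def by simp
    qed
    moreover have "f \<alpha> vs \<in> summand_A" using f unfolding Hom_summand_def by blast
    ultimately show ?thesis by (auto simp: proj_a_def summand_A_def)
  next
    case False
    then have "f \<alpha> = 0"
      using assms unfolding space_a_def labelled_def by (metis (mono_tags, lifting) mem_Collect_eq)
    then show ?thesis by (simp add: proj_a_def zero_prod_def)
  qed
qed

text \<open>Elements of \<open>s\<^sup>-\<^sup>1\<hh>' \<oplus> \<aa>\<close> are pairs \<open>(q, p)\<close>.\<close>

type_synonym ('w, 'a, 'm) sha =
  "(('a \<times> 'm) list \<Rightarrow> 'a \<times> 'm) \<times> ('w list \<Rightarrow> ('a \<times> 'm) list \<Rightarrow> 'a \<times> 'm)"

definition sha_scale :: "('k::field \<Rightarrow> 'a \<times> 'm \<Rightarrow> 'a \<times> 'm) \<Rightarrow> 'k \<Rightarrow>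
    ('w, 'a::ab_group_add, 'm::ab_group_add) sha \<Rightarrow> ('w, 'a, 'm) sha"
  where "sha_scale sc = module_prod.scale (scale_fun sc) (scale_fun (scale_fun sc))"

definition sha_space :: "('k \<Rightarrow> 'a \<times> 'm \<Rightarrow> 'a \<times> 'm) \<Rightarrow> int \<Rightarrow>
    ('w, 'a::ab_group_add, 'm::ab_group_add) sha set"
  where "sha_space sc i =
    (if i \<ge> -1 then space_h' sc (nat (i + 1)) else {0}) \<times> (if i \<ge> 0 then space_a sc (nat i) else {0})"

definition in_h :: "(('a \<times> 'm) list \<Rightarrow> 'a \<times> 'm) \<Rightarrow> ('w, 'a::zero, 'm::zero) sha"
  where "in_h q = (q, 0)"

definition in_a :: "('w list \<Rightarrow> ('a \<times> 'm) list \<Rightarrow> 'a \<times> 'm) \<Rightarrow> ('w, 'a::zero, 'm::zero) sha"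
  where "in_a p = (0, p)"

end

theory Submission
  imports Defs "HOL-Library.Multiset"
begin

text \<open>
  The theorem is an instance of Voronov's construction of derived brackets. The bracket is the
  graded commutator of a pre-Lie product (insertion of one map into the arguments of the other), so
  it is a graded Lie bracket; the labels are harmless because their product is associative. The subspace
  \<open>\<aa>\<close> is abelian, and the kernel of \<open>P\<close> is a subalgebra, which amounts to
  \<open>P[x, y] = P[Px, y] + P[x, Py]\<close>.

  The Jacobi identity of the operations is multilinear and graded symmetric, so its inputs may be taken
  from \<open>s\<^sup>-\<^sup>1\<hh>'\<close> or \<open>\<aa>\<close>, those from \<open>s\<^sup>-\<^sup>1\<hh>'\<close> first. All terms vanish unless there are exactly two or exactly three
  inputs from \<open>s\<^sup>-\<^sup>1\<hh>'\<close>, in the latter case with no others. Three inputs give the graded Jacobi identity of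
  \<open>\<hh>'\<close>. For \<open>s\<^sup>-\<^sup>1q, s\<^sup>-\<^sup>1q', p\<^sub>1, \<dots>, p\<^sub>k\<close>, expand \<open>P[\<dots>[[q, q'], p\<^sub>1], \<dots>, p\<^sub>k]\<close> by the Leibniz rule into a sum over unshuffles
  of terms \<open>P[[\<dots>[q, p\<^sub>S]], [\<dots>[q', p\<^sub>T]]]\<close>, and apply the identity for \<open>P\<close>.
\<close>

section \<open>Signs and unshuffles\<close>

definition flip :: "int \<Rightarrow> 'v \<Rightarrow> 'v::ab_group_add"
  where "flip k x = (if even k then x else - x)"

lemma flip_0 [simp]: "flip 0 x = x" "flip k 0 = 0"
  by (simp_all add: flip_def)

lemma flip_flip [simp]: "flip k (flip l x) = flip (k + l) x"
  by (simp add: flip_def)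

lemma flip_add: "flip k (x + y) = flip k x + flip k y"
  by (simp add: flip_def)

lemma flip_cong: "even (k - l) \<Longrightarrow> flip k x = flip l x"
  by (simp add: flip_def)

lemma flip_eq_0_iff [simp]: "flip k x = 0 \<longleftrightarrow> x = 0"
  by (simp add: flip_def)

lemma flip_Pair: "flip k (x, y) = (flip k x, flip k y)"
  by (simp add: flip_def)

definition deg :: "(int \<times> 'x) list \<Rightarrow> int"
  where "deg zs = sum_list (map fst zs)"

lemma deg_simps [simp]:
  "deg [] = 0" "deg (z # zs) = fst z + deg zs" "deg (xs @ ys) = deg xs + deg ys"
  by (simp_all add: deg_def)

fun unshuffle_sum ::
  "(int \<times> 'x) list \<Rightarrow> ((int \<times> 'x) list \<Rightarrow> (int \<times> 'x) list \<Rightarrow> 'v) \<Rightarrow> 'v::ab_group_add"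
where
  "unshuffle_sum [] F = F [] []"
| "unshuffle_sum (z # zs) F = unshuffle_sum zs (\<lambda>S T. F (z # S) T)
    + unshuffle_sum zs (\<lambda>S T. flip (fst z * deg S) (F S (z # T)))"

lemma unshuffle_sum_cong:
  assumes "\<And>S T. mset S + mset T = mset zs \<Longrightarrow> F S T = F' S T"
  shows "unshuffle_sum zs F = unshuffle_sum zs F'"
  using assms
proof (induction zs arbitrary: F F')
  case (Cons z zs)
  have "unshuffle_sum zs (\<lambda>S T. F (z # S) T) = unshuffle_sum zs (\<lambda>S T. F' (z # S) T)"
    by (rule Cons.IH) (simp add: Cons.prems)
  moreover have "unshuffle_sum zs (\<lambda>S T. flip (fst z * deg S) (F S (z # T)))
      = unshuffle_sum zs (\<lambda>S T. flip (fst z * deg S) (F' S (z # T)))"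
    by (rule Cons.IH) (simp add: Cons.prems)
  ultimately show ?case by simp
qed simp

lemma unshuffle_sum_0 [simp]: "unshuffle_sum zs (\<lambda>S T. 0) = 0"
  by (induction zs) auto

lemma unshuffle_sum_eq_0:
  assumes "\<And>S T. mset S + mset T = mset zs \<Longrightarrow> F S T = 0"
  shows "unshuffle_sum zs F = 0"
  using unshuffle_sum_cong[of zs F "\<lambda>S T. 0"] assms by simp

lemma unshuffle_sum_add:
  "unshuffle_sum zs (\<lambda>S T. F S T + F' S T) = unshuffle_sum zs F + unshuffle_sum zs F'"
  by (induction zs arbitrary: F F') (simp_all add: flip_add algebra_simps)

lemma unshuffle_sum_flip:
  "unshuffle_sum zs (\<lambda>S T. flip k (F S T)) = flip k (unshuffle_sum zs F)"
proof (induction zs arbitrary: F)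
  case (Cons z zs)
  have "unshuffle_sum zs (\<lambda>S T. flip (fst z * deg S) (flip k (F S (z # T))))
     = unshuffle_sum zs (\<lambda>S T. flip k (flip (fst z * deg S) (F S (z # T))))"
    by (simp add: add.commute)
  then show ?case using Cons.IH[of "\<lambda>S T. F (z # S) T"] Cons.IH[of "\<lambda>S T. flip (fst z * deg S) (F S (z # T))"]
    by (simp add: flip_add)
qed simp

lemma unshuffle_sum_Pair_0: "unshuffle_sum zs (\<lambda>S T. (0, F S T)) = (0, unshuffle_sum zs F)"
  by (induction zs arbitrary: F) (simp_all add: flip_Pair)

lemma unshuffle_sum_left_empty:
  "unshuffle_sum zs (\<lambda>S T. if S = [] then g T else 0) = g zs"
proof (induction zs arbitrary: g)
  case (Cons z zs)
  have "unshuffle_sum zs (\<lambda>S T. flip (fst z * deg S) (if S = [] then g (z # T) else 0))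
     = unshuffle_sum zs (\<lambda>S T. if S = [] then g (z # T) else 0)"
    by (rule unshuffle_sum_cong) auto
  then show ?case using Cons.IH[of "\<lambda>T. g (z # T)"] by (simp del: flip_eq_0_iff)
qed simp

lemma unshuffle_sum_commute:
  "unshuffle_sum zs (\<lambda>S T. flip (deg S * deg T) (F T S)) = unshuffle_sum zs F"
proof (induction zs arbitrary: F)
  case (Cons z zs)
  have "unshuffle_sum zs (\<lambda>S T. flip (deg (z # S) * deg T) (F T (z # S)))
      = unshuffle_sum zs (\<lambda>S T. flip (deg S * deg T) (flip (fst z * deg T) (F T (z # S))))"
    by (simp add: algebra_simps)
  also have "\<dots> = unshuffle_sum zs (\<lambda>S T. flip (fst z * deg S) (F S (z # T)))"
    by (rule Cons.IH[of "\<lambda>S T. flip (fst z * deg S) (F S (z # T))"])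
  finally have 1: "unshuffle_sum zs (\<lambda>S T. flip (deg (z # S) * deg T) (F T (z # S)))
      = unshuffle_sum zs (\<lambda>S T. flip (fst z * deg S) (F S (z # T)))" .
  have "unshuffle_sum zs (\<lambda>S T. flip (fst z * deg S) (flip (deg S * deg (z # T)) (F (z # T) S)))
      = unshuffle_sum zs (\<lambda>S T. flip (deg S * deg T) (F (z # T) S))"
    by (rule unshuffle_sum_cong) (simp only: flip_flip, rule flip_cong, simp add: algebra_simps)
  also have "\<dots> = unshuffle_sum zs (\<lambda>S T. F (z # S) T)"
    by (rule Cons.IH[of "\<lambda>S T. F (z # S) T"])
  finally show ?case using 1 by (simp only: unshuffle_sum.simps add.commute)
qed simp

lemma unshuffle_sum_Cons2:
  "unshuffle_sum (a # b # vs) F = unshuffle_sum vs (\<lambda>S T.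
      F (a # b # S) T + flip (fst b * deg S) (F (a # S) (b # T))
       + (flip (fst a * deg (b # S)) (F (b # S) (a # T))
       + flip (fst b * deg S) (flip (fst a * deg S) (F S (a # b # T)))))"
  by (simp only: unshuffle_sum.simps unshuffle_sum_add)

lemma unshuffle_sum_swap:
  assumes "set (us @ [a, b] @ vs) \<subseteq> X"
    and "\<And>S S' T x y. set (S @ [x, y] @ S' @ T) \<subseteq> X \<Longrightarrow>
      F (S @ [x, y] @ S') T = flip (fst x * fst y) (F (S @ [y, x] @ S') T)"
    and "\<And>S T T' x y. set (S @ T @ [x, y] @ T') \<subseteq> X \<Longrightarrow>
      F S (T @ [x, y] @ T') = flip (fst x * fst y) (F S (T @ [y, x] @ T'))"
  shows "unshuffle_sum (us @ [a, b] @ vs) F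
    = flip (fst a * fst b) (unshuffle_sum (us @ [b, a] @ vs) F)"
  using assms
proof (induction us arbitrary: F)
  case Nil
  let ?s = "\<lambda>x S. fst x * deg S"
  have ab: "F (a # b # S) T = flip (fst a * fst b) (F (b # a # S) T)"
    "F S (a # b # T) = flip (fst a * fst b) (F S (b # a # T))"
    if "mset S + mset T = mset vs" for S T
  proof -
    have "set S \<union> set T = set vs" using that by (metis set_mset_mset set_mset_union)
    then show "F (a # b # S) T = flip (fst a * fst b) (F (b # a # S) T)"
      "F S (a # b # T) = flip (fst a * fst b) (F S (b # a # T))"
      using Nil.prems(1) Nil.prems(2)[of "[]" a b S T] Nil.prems(3)[of S "[]" a b T] by auto
  qed
  have "unshuffle_sum (a # b # vs) F =
      unshuffle_sum vs (\<lambda>S T. F (a # b # S) T + flip (?s b S) (F (a # S) (b # T))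
       + (flip (?s a (b # S)) (F (b # S) (a # T)) + flip (?s b S) (flip (?s a S) (F S (a # b # T)))))"
    by (rule unshuffle_sum_Cons2)
  also have "\<dots> = unshuffle_sum vs (\<lambda>S T. flip (fst a * fst b)
      (F (b # a # S) T + flip (?s a S) (F (b # S) (a # T))
       + (flip (?s b (a # S)) (F (a # S) (b # T)) + flip (?s a S) (flip (?s b S) (F S (b # a # T))))))"
  proof (rule unshuffle_sum_cong)
    fix S T assume ST: "mset S + mset T = mset vs"
    have "flip (?s b S) (F (a # S) (b # T)) = flip (fst a * fst b) (flip (?s b (a # S)) (F (a # S) (b # T)))"
      "flip (?s a (b # S)) (F (b # S) (a # T)) = flip (fst a * fst b) (flip (?s a S) (F (b # S) (a # T)))"
      "flip (?s b S) (flip (?s a S) (F S (a # b # T))) =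
        flip (fst a * fst b) (flip (?s a S) (flip (?s b S) (F S (b # a # T))))"
      by (simp_all only: ab(2)[OF ST] flip_flip fst_conv deg_simps, (rule flip_cong, simp add: algebra_simps)+)
    then show "F (a # b # S) T + flip (?s b S) (F (a # S) (b # T))
       + (flip (?s a (b # S)) (F (b # S) (a # T)) + flip (?s b S) (flip (?s a S) (F S (a # b # T))))
       = flip (fst a * fst b)
      (F (b # a # S) T + flip (?s a S) (F (b # S) (a # T))
       + (flip (?s b (a # S)) (F (a # S) (b # T)) + flip (?s a S) (flip (?s b S) (F S (b # a # T)))))"
      by (simp only: ab(1)[OF ST] flip_add add.assoc add.left_commute)
  qed
  also have "\<dots> = flip (fst a * fst b) (unshuffle_sum (b # a # vs) F)"
    by (simp only: unshuffle_sum_flip unshuffle_sum_Cons2)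
  finally show ?case by simp
next
  case (Cons z us)
  have z: "z \<in> X" and sub: "set (us @ [a, b] @ vs) \<subseteq> X" using Cons.prems(1) by auto
  have 1: "unshuffle_sum (us @ [a, b] @ vs) (\<lambda>S T. F (z # S) T)
    = flip (fst a * fst b) (unshuffle_sum (us @ [b, a] @ vs) (\<lambda>S T. F (z # S) T))"
  proof (intro Cons.IH sub)
    fix S S' T and x y :: "int \<times> 'a"
    assume "set (S @ [x, y] @ S' @ T) \<subseteq> X"
    then show "F (z # S @ [x, y] @ S') T = flip (fst x * fst y) (F (z # S @ [y, x] @ S') T)"
      using Cons.prems(2)[of "z # S" x y S' T] z by simp
  next
    fix S T T' and x y :: "int \<times> 'a"
    assume "set (S @ T @ [x, y] @ T') \<subseteq> X"
    then show "F (z # S) (T @ [x, y] @ T') = flip (fst x * fst y) (F (z # S) (T @ [y, x] @ T'))"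
      using Cons.prems(3)[of "z # S" T x y T'] z by simp
  qed
  have 2: "unshuffle_sum (us @ [a, b] @ vs) (\<lambda>S T. flip (fst z * deg S) (F S (z # T)))
    = flip (fst a * fst b) (unshuffle_sum (us @ [b, a] @ vs) (\<lambda>S T. flip (fst z * deg S) (F S (z # T))))"
  proof (intro Cons.IH sub)
    fix S S' T and x y :: "int \<times> 'a"
    assume "set (S @ [x, y] @ S' @ T) \<subseteq> X"
    then show "flip (fst z * deg (S @ [x, y] @ S')) (F (S @ [x, y] @ S') (z # T)) =
          flip (fst x * fst y) (flip (fst z * deg (S @ [y, x] @ S')) (F (S @ [y, x] @ S') (z # T)))"
      using Cons.prems(2)[of S x y S' "z # T"] z by (simp add: algebra_simps)
  next
    fix S T T' and x y :: "int \<times> 'a"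
    assume "set (S @ T @ [x, y] @ T') \<subseteq> X"
    then show "flip (fst z * deg S) (F S (z # T @ [x, y] @ T')) =
          flip (fst x * fst y) (flip (fst z * deg S) (F S (z # T @ [y, x] @ T')))"
      using Cons.prems(3)[of S "z # T" x y T'] z by (simp add: algebra_simps)
  qed
  show ?case using 1 2 by (simp add: flip_add)
qed

lemma unshuffle_sum_add_slot:
  assumes "set (us @ vs) \<union> {(d, x), (d, y), (d, x + y)} \<subseteq> X"
    and "\<And>S S' T. set (S @ S' @ T) \<subseteq> X \<Longrightarrow>
      F (S @ [(d, x + y)] @ S') T = F (S @ [(d, x)] @ S') T + F (S @ [(d, y)] @ S') T"
    and "\<And>S T T'. set (S @ T @ T') \<subseteq> X \<Longrightarrow>
      F S (T @ [(d, x + y)] @ T') = F S (T @ [(d, x)] @ T') + F S (T @ [(d, y)] @ T')"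
  shows "unshuffle_sum (us @ [(d, x + y)] @ vs) F
    = unshuffle_sum (us @ [(d, x)] @ vs) F + unshuffle_sum (us @ [(d, y)] @ vs) F"
  using assms
proof (induction us arbitrary: F)
  case Nil
  have "F ((d, x + y) # S) T = F ((d, x) # S) T + F ((d, y) # S) T \<and>
    F S ((d, x + y) # T) = F S ((d, x) # T) + F S ((d, y) # T)"
    if "mset S + mset T = mset vs" for S T
  proof -
    have "set S \<union> set T = set vs" using that by (metis set_mset_mset set_mset_union)
    then show ?thesis
      using Nil.prems(1) Nil.prems(2)[of "[]" S T] Nil.prems(3)[of S "[]" T] by auto
  qed
  then have "unshuffle_sum vs (\<lambda>S T. F ((d, x + y) # S) T)
      = unshuffle_sum vs (\<lambda>S T. F ((d, x) # S) T + F ((d, y) # S) T)"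
    "unshuffle_sum vs (\<lambda>S T. flip (d * deg S) (F S ((d, x + y) # T)))
      = unshuffle_sum vs (\<lambda>S T. flip (d * deg S) (F S ((d, x) # T)) + flip (d * deg S) (F S ((d, y) # T)))"
    by (auto intro!: unshuffle_sum_cong simp: flip_add)
  then show ?case by (simp add: unshuffle_sum_add)
next
  case (Cons z us)
  have z: "z \<in> X" and sub: "set (us @ vs) \<union> {(d, x), (d, y), (d, x + y)} \<subseteq> X"
    using Cons.prems(1) by auto
  let ?G = "\<lambda>S T. F (z # S) T" and ?H = "\<lambda>S T. flip (fst z * deg S) (F S (z # T))"
  have 1: "unshuffle_sum (us @ [(d, x + y)] @ vs) ?G
    = unshuffle_sum (us @ [(d, x)] @ vs) ?G + unshuffle_sum (us @ [(d, y)] @ vs) ?G"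
    using Cons.prems(2)[of "z # _"] Cons.prems(3)[of "z # _"] z by (intro Cons.IH sub) auto
  have 2: "unshuffle_sum (us @ [(d, x + y)] @ vs) ?H
    = unshuffle_sum (us @ [(d, x)] @ vs) ?H + unshuffle_sum (us @ [(d, y)] @ vs) ?H"
    using Cons.prems(2)[of _ _ "z # _"] Cons.prems(3)[of _ "z # _"] z
    by (intro Cons.IH sub) (auto simp: flip_add)
  show ?case using 1 2 by (simp add: algebra_simps)
qed

lemma deg_mset_eq: "mset S + mset T = mset zs \<Longrightarrow> deg S + deg T = deg zs"
  unfolding deg_def by (metis mset_append mset_map sum_list.append map_append sum_mset_sum_list)

lemma set_mset_eq: "mset S + mset T = mset zs \<Longrightarrow> set S \<union> set T = set zs"
  by (metis set_mset_mset set_mset_union)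

lemma unshuffle_sum_closed:
  assumes "0 \<in> X" "\<And>x y. x \<in> X \<Longrightarrow> y \<in> X \<Longrightarrow> x + y \<in> X" "\<And>x. x \<in> X \<Longrightarrow> - x \<in> X"
    and "\<And>S T. mset S + mset T = mset zs \<Longrightarrow> F S T \<in> X"
  shows "unshuffle_sum zs F \<in> X"
  using assms(4)
proof (induction zs arbitrary: F)
  case (Cons z zs)
  show ?case unfolding unshuffle_sum.simps
    by (rule assms(2); rule Cons.IH) (use Cons.prems assms(3) in \<open>auto simp: flip_def\<close>)
qed simp

section \<open>Voronov's derived brackets\<close>

text \<open>
  In Voronov's construction \<open>c\<close> embeds a graded Lie algebra \<open>H\<close> into \<open>G\<close>, and \<open>P\<close> projects \<open>G\<close> onto an
  abelian subalgebra \<open>A\<close>. The axiom \<open>P_br\<close> is equivalent to the kernel of \<open>P\<close> being a subalgebra.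
\<close>

locale derived_brackets =
  fixes G :: "int \<Rightarrow> 'g::ab_group_add set" and br :: "'g \<Rightarrow> 'g \<Rightarrow> 'g"
    and A :: "int \<Rightarrow> 'g set" and P :: "'g \<Rightarrow> 'g"
    and H :: "int \<Rightarrow> 'h::ab_group_add set" and c :: "'h \<Rightarrow> 'g" and hb :: "'h \<Rightarrow> 'h \<Rightarrow> 'h"
  assumes G_0: "0 \<in> G n"
    and G_add: "x \<in> G n \<Longrightarrow> y \<in> G n \<Longrightarrow> x + y \<in> G n"
    and G_minus: "x \<in> G n \<Longrightarrow> - x \<in> G n"
    and br_closed: "x \<in> G m \<Longrightarrow> y \<in> G n \<Longrightarrow> br x y \<in> G (m + n)"
    and br_add_left: "x \<in> G m \<Longrightarrow> x' \<in> G m \<Longrightarrow> y \<in> G n \<Longrightarrow> br (x + x') y = br x y + br x' y"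
    and br_commute: "x \<in> G m \<Longrightarrow> y \<in> G n \<Longrightarrow> br x y = flip (m * n + 1) (br y x)"
    and br_jacobi: "x \<in> G m \<Longrightarrow> y \<in> G n \<Longrightarrow> z \<in> G k \<Longrightarrow>
      br (br x y) z = br x (br y z) + flip (n * k) (br (br x z) y)"
    and A_0: "0 \<in> A n"
    and A_add: "x \<in> A n \<Longrightarrow> y \<in> A n \<Longrightarrow> x + y \<in> A n"
    and A_minus: "x \<in> A n \<Longrightarrow> - x \<in> A n"
    and A_G: "x \<in> A n \<Longrightarrow> x \<in> G n"
    and A_abelian: "x \<in> A m \<Longrightarrow> y \<in> A n \<Longrightarrow> br x y = 0"
    and P_closed: "x \<in> G n \<Longrightarrow> P x \<in> A n"
    and P_add: "x \<in> G n \<Longrightarrow> y \<in> G n \<Longrightarrow> P (x + y) = P x + P y"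
    and P_br: "x \<in> G m \<Longrightarrow> y \<in> G n \<Longrightarrow> P (br x y) = P (br (P x) y) + P (br x (P y))"
    and H_0: "0 \<in> H n"
    and H_add: "q \<in> H n \<Longrightarrow> r \<in> H n \<Longrightarrow> q + r \<in> H n"
    and H_minus: "q \<in> H n \<Longrightarrow> - q \<in> H n"
    and hb_closed: "q \<in> H m \<Longrightarrow> r \<in> H n \<Longrightarrow> hb q r \<in> H (m + n)"
    and c_G: "q \<in> H n \<Longrightarrow> c q \<in> G n"
    and c_add: "c (q + r) = c q + c r"
    and c_eq_0: "c q = 0 \<Longrightarrow> q = 0"
    and c_hb: "q \<in> H m \<Longrightarrow> r \<in> H n \<Longrightarrow> c (hb q r) = br (c q) (c r)"
    and P_c: "q \<in> H n \<Longrightarrow> P (c q) = 0"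
begin

lemma c_0 [simp]: "c 0 = 0"
  using c_add[of 0 0] by simp

lemma c_minus: "c (- q) = - c q"
  using c_add[of q "- q"] by (simp add: minus_unique)

lemma c_flip: "c (flip k q) = flip k (c q)"
  by (simp add: flip_def c_minus)

lemma c_inject: "c q = c r \<longleftrightarrow> q = r"
  using c_add[of q "- r"] c_eq_0[of "q - r"] by (auto simp: c_minus)

lemma G_flip: "x \<in> G n \<Longrightarrow> flip k x \<in> G n"
  by (simp add: flip_def G_minus)

lemma A_flip: "x \<in> A n \<Longrightarrow> flip k x \<in> A n"
  by (simp add: flip_def A_minus)

lemma H_flip: "x \<in> H n \<Longrightarrow> flip k x \<in> H n"
  by (simp add: flip_def H_minus)

lemma br_add_right:
  assumes "x \<in> G m" "y \<in> G n" "y' \<in> G n"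
  shows "br x (y + y') = br x y + br x y'"
  using br_commute[of x m y n] br_commute[of x m y' n] br_commute[of x m "y + y'" n]
    br_add_left[of y n y' x m] G_add assms by (simp add: flip_add)

lemma br_0_left: "y \<in> G n \<Longrightarrow> br 0 y = 0"
  using br_add_left[OF G_0 G_0, of y n] by simp

lemma br_0_right: "x \<in> G m \<Longrightarrow> br x 0 = 0"
  using br_add_right[OF _ G_0 G_0, of x m] by simp

lemma P_0 [simp]: "P 0 = 0"
  using P_add[OF G_0 G_0] by simp

lemma P_minus: "x \<in> G n \<Longrightarrow> P (- x) = - P x"
  using P_add[of x n "- x"] by (simp add: G_minus minus_unique)

lemma P_flip: "x \<in> G n \<Longrightarrow> P (flip k x) = flip k (P x)"
  by (simp add: flip_def P_minus)

lemma br_swap: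
  assumes "x \<in> G m" "a \<in> A n" "b \<in> A k"
  shows "br (br x a) b = flip (n * k) (br (br x b) a)"
  using br_jacobi[of x m a n b k] assms by (simp add: A_G A_abelian br_0_right)

text \<open>
  An item \<open>(d, q, p)\<close> stands for the element \<open>s\<^sup>-\<^sup>1q + p\<close> of degree \<open>d\<close>; because of the desuspension,
  \<open>q\<close> has degree \<open>d + 1\<close>.
\<close>

definition good :: "(int \<times> 'h \<times> 'g) set"
  where "good = {(d, q, p). q \<in> H (d + 1) \<and> p \<in> A d}"

lemma good_iff [simp]: "(d, q, p) \<in> good \<longleftrightarrow> q \<in> H (d + 1) \<and> p \<in> A d"
  by (simp add: good_def)

definition iter :: "'g \<Rightarrow> (int \<times> 'h \<times> 'g) list \<Rightarrow> 'g"
  where "iter x zs = foldl br x (map (snd \<circ> snd) zs)"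

lemma iter_simps [simp]:
  "iter x [] = x" "iter x ((d, q, p) # zs) = iter (br x p) zs"
  "iter x (us @ vs) = iter (iter x us) vs"
  by (simp_all add: iter_def)

lemma iter_closed: "x \<in> G n \<Longrightarrow> set zs \<subseteq> good \<Longrightarrow> iter x zs \<in> G (n + deg zs)"
proof (induction zs arbitrary: x n)
  case (Cons z zs)
  obtain d q p where z: "z = (d, q, p)" by (metis prod.exhaust)
  have "br x p \<in> G (n + d)" using Cons.prems z by (auto intro: br_closed A_G)
  then show ?case using Cons z by (simp add: add.assoc[symmetric])
qed simp

lemma iter_add:
  "x \<in> G n \<Longrightarrow> y \<in> G n \<Longrightarrow> set zs \<subseteq> good \<Longrightarrow> iter (x + y) zs = iter x zs + iter y zs"
proof (induction zs arbitrary: x y n)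
  case (Cons z zs)
  obtain d q p where z: "z = (d, q, p)" by (metis prod.exhaust)
  have "p \<in> G d" using Cons.prems z by (auto intro: A_G)
  then show ?case
    using Cons.IH[OF br_closed[OF Cons.prems(1)] br_closed[OF Cons.prems(2)]] Cons.prems z
      br_add_left[OF Cons.prems(1,2)] by simp
qed simp

lemma iter_0: "set zs \<subseteq> good \<Longrightarrow> iter 0 zs = 0"
  using iter_add[OF G_0 G_0, of zs] by simp

lemma iter_minus: "x \<in> G n \<Longrightarrow> set zs \<subseteq> good \<Longrightarrow> iter (- x) zs = - iter x zs"
  using iter_add[of x n "- x" zs] by (simp add: G_minus iter_0 minus_unique)

lemma iter_flip: "x \<in> G n \<Longrightarrow> set zs \<subseteq> good \<Longrightarrow> iter (flip k x) zs = flip k (iter x zs)"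
  by (simp add: flip_def iter_minus)

lemma iter_swap:
  assumes "x \<in> G n" "set (us @ [a, b] @ vs) \<subseteq> good"
  shows "iter x (us @ [a, b] @ vs) = flip (fst a * fst b) (iter x (us @ [b, a] @ vs))"
proof -
  obtain d q p d' q' p' where ab: "a = (d, q, p)" "b = (d', q', p')" by (metis prod.exhaust)
  have x: "iter x us \<in> G (n + deg us)" using assms by (simp add: iter_closed)
  have p: "p \<in> A d" "p' \<in> A d'" using assms ab by auto
  have "br (br (iter x us) p') p \<in> G (n + deg us + d' + d)"
    by (rule br_closed[OF br_closed[OF x A_G[OF p(2)]] A_G[OF p(1)]])
  then show ?thesis using assms br_swap[OF x p] by (simp add: ab iter_flip)
qed

lemma iter_add_slot:
  assumes "x \<in> G n" "set (us @ vs) \<subseteq> good" "(d, q, p) \<in> good" "(d, q', p') \<in> good"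
  shows "iter x (us @ [(d, q + q', p + p')] @ vs) =
    iter x (us @ [(d, q, p)] @ vs) + iter x (us @ [(d, q', p')] @ vs)"
proof -
  have x: "iter x us \<in> G (n + deg us)" using assms by (simp add: iter_closed)
  have p: "p \<in> G d" "p' \<in> G d" using assms(3,4) by (auto intro: A_G)
  show ?thesis
    using assms iter_add[OF br_closed[OF x p(1)] br_closed[OF x p(2)]] br_add_right[OF x p] by simp
qed

lemma iter_flip_slot:
  assumes "x \<in> G n" "set (us @ ts) \<subseteq> good" "p \<in> A d"
  shows "iter x (us @ (d, q, flip k p) # ts) = flip k (iter x (us @ (d, q, p) # ts))"
proof -
  have us: "iter x us \<in> G (n + deg us)" using assms by (simp add: iter_closed)
  have "br (iter x us) (- p) = - br (iter x us) p"
    using br_add_right[OF us A_G[OF assms(3)] A_G[OF A_minus[OF assms(3)]]] br_0_right[OF us]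
    by (simp add: minus_unique)
  then have "br (iter x us) (flip k p) = flip k (br (iter x us) p)" by (simp add: flip_def)
  then show ?thesis using assms iter_flip[OF br_closed[OF us A_G[OF assms(3)]]] by simp
qed

lemma iter_zero_slot:
  assumes "x \<in> G n" "set zs \<subseteq> good" "z \<in> set zs" "snd (snd z) = 0"
  shows "iter x zs = 0"
proof -
  obtain us vs where zs: "zs = us @ z # vs" using assms(3) by (meson split_list)
  obtain d q where z: "z = (d, q, 0)" using assms(4) by (metis prod.exhaust snd_conv)
  have "iter x us \<in> G (n + deg us)" using assms zs by (simp add: iter_closed)
  then show ?thesis using assms zs z by (simp add: br_0_right iter_0)
qed

lemma iter_snoc_move:
  assumes "x \<in> G n" "set zs \<subseteq> good" "b \<in> A k"
  shows "br (iter x zs) b = flip (k * deg zs) (iter (br x b) zs)"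
  using assms(1,2)
proof (induction zs arbitrary: x n)
  case (Cons z zs)
  obtain d q p where z: "z = (d, q, p)" by (metis prod.exhaust)
  have p: "p \<in> A d" using Cons.prems z by auto
  have xp: "br x p \<in> G (n + d)" and xbp: "br (br x b) p \<in> G (n + k + d)"
    by (rule br_closed[OF Cons.prems(1) A_G[OF p]],
      rule br_closed[OF br_closed[OF Cons.prems(1) A_G[OF assms(3)]] A_G[OF p]])
  show ?case
    using Cons.IH[OF xp] br_swap[OF Cons.prems(1) p assms(3)] Cons.prems z xbp
    by (simp add: iter_flip algebra_simps)
qed simp

lemma P_iter_br:
  assumes "x \<in> G m" "y \<in> G n" "set zs \<subseteq> good"
  shows "P (iter (br x y) zs) =
    unshuffle_sum zs (\<lambda>S T. flip (n * deg S) (P (br (iter x S) (iter y T))))"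
  using assms
proof (induction zs arbitrary: x y m n)
  case (Cons z zs)
  obtain d q p where z: "z = (d, q, p)" by (metis prod.exhaust)
  have p: "p \<in> G d" and zs: "set zs \<subseteq> good" using Cons.prems z by (auto intro: A_G)
  note x = Cons.prems(1) and y = Cons.prems(2)
  have xp: "br x p \<in> G (m + d)" and yp: "br y p \<in> G (n + d)"
    using x y p by (auto intro: br_closed)
  have in1: "br x (br y p) \<in> G (m + n + d)" and in2: "br (br x p) y \<in> G (m + n + d)"
    using br_closed[OF x yp] br_closed[OF xp y] by (simp_all add: algebra_simps)
  have "P (iter (br x y) (z # zs)) = P (iter (br x (br y p)) zs) + flip (n * d) (P (iter (br (br x p) y) zs))"
    using z br_jacobi[OF x y p] in1 in2 zs
    by (simp add: iter_add[OF _ G_flip] iter_flip P_add[OF _ G_flip] P_flip iter_closed)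
      (metis G_flip P_add P_flip iter_closed)
  also have "P (iter (br x (br y p)) zs) =
      unshuffle_sum zs (\<lambda>S T. flip ((n + d) * deg S) (P (br (iter x S) (iter (br y p) T))))"
    by (rule Cons.IH[OF x yp zs])
  also have "P (iter (br (br x p) y) zs) =
      unshuffle_sum zs (\<lambda>S T. flip (n * deg S) (P (br (iter (br x p) S) (iter y T))))"
    by (rule Cons.IH[OF xp y zs])
  finally show ?case
    by (simp add: z unshuffle_sum_flip[symmetric] algebra_simps)
qed simp

lemma P_iter_br_derived:
  assumes x: "x \<in> G m" and y: "y \<in> G n" and zs: "set zs \<subseteq> good"
  shows "P (iter (br x y) zs) =
    unshuffle_sum zs (\<lambda>S T. flip (m * n + 1) (P (iter (br y (P (iter x S))) T))
      + P (iter (br x (P (iter y S))) T))"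
proof -
  let ?f = "\<lambda>S T. flip (m * n + 1) (P (iter (br y (P (iter x S))) T))"
    and ?g = "\<lambda>S T. P (iter (br x (P (iter y S))) T)"
  have "P (iter (br x y) zs) =
      unshuffle_sum zs (\<lambda>S T. flip (n * deg S) (P (br (iter x S) (iter y T))))"
    by (rule P_iter_br[OF assms])
  also have "\<dots> = unshuffle_sum zs (\<lambda>S T. ?f S T + flip (deg S * deg T) (?g T S))"
  proof (rule unshuffle_sum_cong)
    fix S T assume ST: "mset S + mset T = mset zs"
    have S: "set S \<subseteq> good" and T: "set T \<subseteq> good" using set_mset_eq[OF ST] zs by auto
    let ?X = "iter x S" and ?Y = "iter y T"
    have X: "?X \<in> G (m + deg S)" and Y: "?Y \<in> G (n + deg T)"
      using x y S T by (auto intro: iter_closed)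
    have PX: "P ?X \<in> A (m + deg S)" and PY: "P ?Y \<in> A (n + deg T)" using X Y by (auto intro: P_closed)
    have 1: "iter (br y (P ?X)) T \<in> G (n + (m + deg S) + deg T)"
      and 2: "iter (br x (P ?Y)) S \<in> G (m + (n + deg T) + deg S)"
      by (rule iter_closed[OF br_closed[OF y A_G[OF PX]] T],
      rule iter_closed[OF br_closed[OF x A_G[OF PY]] S])
    have "br (P ?X) ?Y = flip ((m + deg S) * (n + deg T) + 1) (br ?Y (P ?X))"
      by (rule br_commute[OF A_G[OF PX] Y])
    also have "br ?Y (P ?X) = flip ((m + deg S) * deg T) (iter (br y (P ?X)) T)"
      by (rule iter_snoc_move[OF y T PX])
    finally have 3: "P (br (P ?X) ?Y) =
        flip ((m + deg S) * (n + deg T) + 1 + (m + deg S) * deg T) (P (iter (br y (P ?X)) T))"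
      by (simp only: P_flip[OF 1] flip_flip)
    have 4: "P (br ?X (P ?Y)) = flip ((n + deg T) * deg S) (?g T S)"
      using iter_snoc_move[OF x S PY] P_flip[OF 2] by simp
    have "flip (n * deg S) (P (br ?X ?Y)) =
        flip (n * deg S + ((m + deg S) * (n + deg T) + 1 + (m + deg S) * deg T)) (P (iter (br y (P ?X)) T))
        + flip (n * deg S + (n + deg T) * deg S) (?g T S)"
      by (simp only: P_br[OF X Y] 3 4 flip_add flip_flip)
    also have "\<dots> = ?f S T + flip (deg S * deg T) (?g T S)"
      by (intro arg_cong2[where f = "(+)"] flip_cong) (simp_all add: algebra_simps)
    finally show "flip (n * deg S) (P (br ?X ?Y)) = ?f S T + flip (deg S * deg T) (?g T S)" .
  qed
  also have "\<dots> = unshuffle_sum zs (\<lambda>S T. ?f S T + ?g S T)"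
    using unshuffle_sum_commute[of zs ?g] by (simp only: unshuffle_sum_add)
  finally show ?thesis .
qed

definition summand :: "(int \<times> 'h \<times> 'g) list \<Rightarrow> (int \<times> 'h \<times> 'g) list \<Rightarrow> 'g"
  where "summand S T = (if length S = 1 then P (iter (c (fst (snd (hd S)))) T) else 0)"

definition l_a :: "(int \<times> 'h \<times> 'g) list \<Rightarrow> 'g"
  where "l_a zs = unshuffle_sum zs summand"

definition l_h :: "(int \<times> 'h \<times> 'g) list \<Rightarrow> 'h"
  where "l_h zs = (if length zs = 2
    then flip (fst (zs ! 0) + 1) (hb (fst (snd (zs ! 0))) (fst (snd (zs ! 1)))) else 0)"

definition lie_l :: "(int \<times> 'h \<times> 'g) list \<Rightarrow> 'h \<times> 'g"
  where "lie_l zs = (l_h zs, l_a zs)"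

lemma summand_eq_0:
  assumes "set S \<union> set T \<subseteq> good"
    and "length S \<noteq> 1 \<or> fst (snd (hd S)) = 0 \<or> (\<exists>z\<in>set T. snd (snd z) = 0)"
  shows "summand S T = 0"
proof (cases "length S = 1")
  case True
  then obtain z where S: "S = [z]" by (metis One_nat_def length_0_conv length_Suc_conv)
  obtain d q p where z: "z = (d, q, p)" by (metis prod.exhaust)
  have "c q \<in> G (d + 1)" using assms(1) S z by (auto intro: c_G)
  then have "iter (c q) T = 0"
    using assms S z iter_zero_slot[of "c q" "d + 1" T] iter_0[of T] by auto
  then show ?thesis by (simp add: summand_def S z)
qed (simp add: summand_def)

lemma summand_closed:
  assumes "set S \<union> set T \<subseteq> good"
  shows "summand S T \<in> A (deg S + deg T + 1)"
proof (cases "length S = 1")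
  case True
  then obtain z where S: "S = [z]" by (metis One_nat_def length_0_conv length_Suc_conv)
  obtain d q p where z: "z = (d, q, p)" by (metis prod.exhaust)
  have "c q \<in> G (d + 1)" using assms(1) S z by (auto intro: c_G)
  then have "P (iter (c q) T) \<in> A (d + 1 + deg T)"
    using assms by (intro P_closed iter_closed) auto
  then show ?thesis by (simp add: summand_def S z algebra_simps)
qed (simp add: summand_def A_0)

lemma summand_swap_left: "summand (S @ [x, y] @ S') T = 0"
  by (simp add: summand_def)

lemma summand_swap_right:
  assumes "set (S @ T @ [x, y] @ T') \<subseteq> good"
  shows "summand S (T @ [x, y] @ T') = flip (fst x * fst y) (summand S (T @ [y, x] @ T'))"
proof (cases "length S = 1")
  case True
  then obtain z where S: "S = [z]" by (metis One_nat_def length_0_conv length_Suc_conv)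
  obtain d q p where z: "z = (d, q, p)" by (metis prod.exhaust)
  have c: "c q \<in> G (d + 1)" using assms(1) S z by (auto intro: c_G)
  have T: "set (T @ [x, y] @ T') \<subseteq> good" "set (T @ [y, x] @ T') \<subseteq> good" using assms by auto
  show ?thesis
    using P_flip[OF iter_closed[OF c T(2)]] iter_swap[OF c T(1)] by (simp add: summand_def S z)
qed (simp add: summand_def)

lemma summand_add_right:
  assumes "set (S @ T @ T') \<subseteq> good" "(d, q, p) \<in> good" "(d, q', p') \<in> good"
  shows "summand S (T @ [(d, q + q', p + p')] @ T') =
    summand S (T @ [(d, q, p)] @ T') + summand S (T @ [(d, q', p')] @ T')"
proof (cases "length S = 1")
  case True
  then obtain z where S: "S = [z]" by (metis One_nat_def length_0_conv length_Suc_conv)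
  obtain e r s where z: "z = (e, r, s)" by (metis prod.exhaust)
  have c: "c r \<in> G (e + 1)" using assms(1) S z by (auto intro: c_G)
  have T: "set (T @ T') \<subseteq> good" "set (T @ [(d, q, p)] @ T') \<subseteq> good" "set (T @ [(d, q', p')] @ T') \<subseteq> good"
    using assms by auto
  have 1: "P (iter (c r) (T @ [(d, q, p)] @ T') + iter (c r) (T @ [(d, q', p')] @ T'))
     = P (iter (c r) (T @ [(d, q, p)] @ T')) + P (iter (c r) (T @ [(d, q', p')] @ T'))"
    using iter_closed[OF c T(2)] iter_closed[OF c T(3)] by (intro P_add) auto
  show ?thesis
    using iter_add_slot[OF c T(1) assms(2,3)] 1 by (simp add: summand_def S z)
qed (simp add: summand_def)

lemma summand_add_left:
  assumes "set (S @ S' @ T) \<subseteq> good" "(d, q, p) \<in> good" "(d, q', p') \<in> good"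
  shows "summand (S @ [(d, q + q', p + p')] @ S') T =
    summand (S @ [(d, q, p)] @ S') T + summand (S @ [(d, q', p')] @ S') T"
proof (cases "S = [] \<and> S' = []")
  case True
  have c: "c q \<in> G (d + 1)" "c q' \<in> G (d + 1)" and T: "set T \<subseteq> good" using assms by (auto intro: c_G)
  show ?thesis
    using True P_add[OF iter_closed[OF c(1) T] iter_closed[OF c(2) T]] iter_add[OF c T]
    by (simp add: summand_def c_add)
qed (auto simp: summand_def)

lemma hb_commute:
  assumes "q \<in> H m" "r \<in> H n"
  shows "hb q r = flip (m * n + 1) (hb r q)"
  using br_commute[OF c_G[OF assms(1)] c_G[OF assms(2)]] c_hb assms
  by (simp add: c_inject[symmetric] c_flip)

lemma hb_add_left:
  assumes "q \<in> H m" "q' \<in> H m" "r \<in> H n"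
  shows "hb (q + q') r = hb q r + hb q' r"
  using assms by (simp add: c_inject[symmetric] c_hb[OF H_add] c_hb c_add br_add_left[OF c_G c_G c_G])

lemma hb_add_right:
  assumes "q \<in> H m" "r \<in> H n" "r' \<in> H n"
  shows "hb q (r + r') = hb q r + hb q r'"
  using assms by (simp add: c_inject[symmetric] c_hb[OF _ H_add] c_hb c_add br_add_right[OF c_G c_G c_G])

lemma hb_0: "r \<in> H n \<Longrightarrow> hb 0 r = 0" "r \<in> H n \<Longrightarrow> hb r 0 = 0"
  using hb_add_left[OF H_0 H_0, of r n] hb_add_right[OF _ H_0 H_0, of r n] by simp_all

lemma hb_minus_left: "q \<in> H m \<Longrightarrow> r \<in> H n \<Longrightarrow> hb (- q) r = - hb q r"
  using hb_add_left[of q m "- q" r n] by (simp add: H_minus hb_0 minus_unique)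

lemma hb_flip_left: "q \<in> H m \<Longrightarrow> r \<in> H n \<Longrightarrow> hb (flip k q) r = flip k (hb q r)"
  by (simp add: flip_def hb_minus_left)

lemma lie_l_closed:
  assumes "set zs \<subseteq> good"
  shows "lie_l zs \<in> H (deg zs + 2) \<times> A (deg zs + 1)"
proof -
  have "l_a zs \<in> A (deg zs + 1)" unfolding l_a_def
  proof (rule unshuffle_sum_closed)
    fix S T :: "(int \<times> 'h \<times> 'g) list"
    assume ST: "mset S + mset T = mset zs"
    show "summand S T \<in> A (deg zs + 1)"
      using summand_closed[of S T] set_mset_eq[OF ST] deg_mset_eq[OF ST] assms by simp
  qed (auto intro: A_0 A_add A_minus)
  moreover have "l_h zs \<in> H (deg zs + 2)"
  proof (cases "length zs = 2")
    case True
    then obtain d q p d' q' p' where zs: "zs = [(d, q, p), (d', q', p')]"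
      by (cases zs; cases "tl zs") auto
    have "hb q q' \<in> H (d + 1 + (d' + 1))" using assms zs by (intro hb_closed) auto
    then show ?thesis by (auto simp: l_h_def zs algebra_simps intro!: H_flip)
  qed (simp add: l_h_def H_0)
  ultimately show ?thesis by (simp add: lie_l_def)
qed

lemma lie_l_swap:
  assumes zs: "set (us @ [a, b] @ vs) \<subseteq> good"
  shows "lie_l (us @ [a, b] @ vs) = flip (fst a * fst b) (lie_l (us @ [b, a] @ vs))"
proof -
  have "l_a (us @ [a, b] @ vs) = flip (fst a * fst b) (l_a (us @ [b, a] @ vs))"
    unfolding l_a_def
    by (rule unshuffle_sum_swap[OF zs]) (simp_all only: summand_swap_left summand_swap_right flip_0)
  moreover have "l_h (us @ [a, b] @ vs) = flip (fst a * fst b) (l_h (us @ [b, a] @ vs))"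
  proof (cases "us = [] \<and> vs = []")
    case True
    obtain d q p d' q' p' where ab: "a = (d, q, p)" "b = (d', q', p')" by (metis prod.exhaust)
    have "hb q q' = flip ((d + 1) * (d' + 1) + 1) (hb q' q)"
      using zs ab by (intro hb_commute) auto
    then have "flip (d + 1) (hb q q') = flip (d * d' + (d' + 1)) (hb q' q)"
      by (simp only: flip_flip) (rule flip_cong, simp add: algebra_simps)
    then show ?thesis by (simp add: l_h_def True ab)
  qed (auto simp: l_h_def)
  ultimately show ?thesis by (simp add: lie_l_def flip_Pair)
qed

lemma lie_l_add:
  assumes zs: "set (us @ vs) \<subseteq> good" and x: "(d, x) \<in> good" and y: "(d, y) \<in> good"
  shows "lie_l (us @ [(d, x + y)] @ vs) = lie_l (us @ [(d, x)] @ vs) + lie_l (us @ [(d, y)] @ vs)"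
proof -
  obtain q p q' p' where xy: "x = (q, p)" "y = (q', p')" by (metis prod.exhaust)
  have good: "set (us @ vs) \<union> {(d, x), (d, y), (d, x + y)} \<subseteq> good"
    using assms xy by (auto intro: H_add A_add)
  have "l_a (us @ [(d, x + y)] @ vs) = l_a (us @ [(d, x)] @ vs) + l_a (us @ [(d, y)] @ vs)"
    unfolding l_a_def
    by (rule unshuffle_sum_add_slot[OF good])
      (use x y in \<open>simp_all only: xy summand_add_left summand_add_right plus_prod_def fst_conv snd_conv\<close>)
  moreover have "l_h (us @ [(d, x + y)] @ vs) = l_h (us @ [(d, x)] @ vs) + l_h (us @ [(d, y)] @ vs)"
  proof -
    consider "us = []" "length vs = 1" | "vs = []" "length us = 1" | "length us + length vs \<noteq> 1"
      by (cases us; cases vs) auto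
    then show ?thesis
    proof cases
      case 1
      then obtain e r s where "vs = [(e, r, s)]" by (cases vs) auto
      then show ?thesis using 1 xy hb_add_left[of q "d + 1" q' r "e + 1"] x y zs
        by (simp add: l_h_def flip_add)
    next
      case 2
      then obtain e r s where "us = [(e, r, s)]" by (cases us) auto
      then show ?thesis using 2 xy hb_add_right[of r "e + 1" q "d + 1" q'] x y zs
        by (simp add: l_h_def flip_add)
    next
      case 3
      then show ?thesis by (auto simp: l_h_def)
    qed
  qed
  ultimately show ?thesis by (simp add: lie_l_def)
qed

lemma lie_l_zero_slot:
  assumes "set zs \<subseteq> good" "(d, 0) \<in> set zs"
  shows "lie_l zs = 0"
proof -
  obtain us vs where zs: "zs = us @ [(d, 0)] @ vs" using assms(2) by (auto dest: split_list)
  show ?thesis using lie_l_add[of us vs d 0 0] assms(1) zs by simp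
qed

lemma good_flip: "(d, x) \<in> good \<Longrightarrow> (d, flip k x) \<in> good"
  by (cases x) (simp add: flip_Pair H_flip A_flip)

lemma lie_l_flip:
  assumes "set (us @ vs) \<subseteq> good" "(d, x) \<in> good"
  shows "lie_l (us @ [(d, flip k x)] @ vs) = flip k (lie_l (us @ [(d, x)] @ vs))"
proof (cases "even k")
  case False
  have "(d, - x) \<in> good" using good_flip[OF assms(2), of 1] by (simp add: flip_def)
  moreover have "(d, 0) \<in> good" using H_0 A_0 by (simp add: zero_prod_def)
  ultimately have "lie_l (us @ [(d, x)] @ vs) + lie_l (us @ [(d, - x)] @ vs) = 0"
    using lie_l_add[OF assms(1,2), of "- x"] lie_l_zero_slot[of "us @ [(d, 0)] @ vs" d] assms by simp
  then show ?thesis using False by (simp add: flip_def eq_neg_iff_add_eq_0 add.commute)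
qed (simp add: flip_def)

definition jacobi_term :: "(int \<times> 'h \<times> 'g) list \<Rightarrow> (int \<times> 'h \<times> 'g) list \<Rightarrow> 'h \<times> 'g"
  where "jacobi_term S T = (if S = [] then 0 else lie_l ((deg S + 1, lie_l S) # T))"

definition jacobiator :: "(int \<times> 'h \<times> 'g) list \<Rightarrow> 'h \<times> 'g"
  where "jacobiator zs = unshuffle_sum zs jacobi_term"

lemma good_lie_l: "set S \<subseteq> good \<Longrightarrow> (deg S + 1, lie_l S) \<in> good"
  using lie_l_closed[of S] by (simp add: good_def mem_Times_iff split_beta algebra_simps)

lemma jacobi_term_zero:
  assumes "set S \<union> set T \<subseteq> good" "lie_l S = 0"
  shows "jacobi_term S T = 0"
  using assms good_lie_l[of S] lie_l_zero_slot[of "(deg S + 1, 0) # T" "deg S + 1"]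
  by (simp add: jacobi_term_def)

lemma jacobiator_swap:
  assumes "set (us @ [a, b] @ vs) \<subseteq> good"
  shows "jacobiator (us @ [a, b] @ vs) = flip (fst a * fst b) (jacobiator (us @ [b, a] @ vs))"
  unfolding jacobiator_def
proof (rule unshuffle_sum_swap[OF assms])
  fix S S' T x y assume good: "set (S @ [x, y] @ S' @ T) \<subseteq> good"
  then have "set (S @ [x, y] @ S') \<subseteq> good" "set (S @ [y, x] @ S') \<subseteq> good" by auto
  from lie_l_swap[OF this(1)] good_lie_l[OF this(2)]
  show "jacobi_term (S @ [x, y] @ S') T = flip (fst x * fst y) (jacobi_term (S @ [y, x] @ S') T)"
    using lie_l_flip[of "[]" T] good by (simp add: jacobi_term_def algebra_simps)
next
  fix S T T' x y assume good: "set (S @ T @ [x, y] @ T') \<subseteq> good"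
  then have "(deg S + 1, lie_l S) \<in> good" by (intro good_lie_l) auto
  then show "jacobi_term S (T @ [x, y] @ T') = flip (fst x * fst y) (jacobi_term S (T @ [y, x] @ T'))"
    using lie_l_swap[of "(deg S + 1, lie_l S) # T" x y T'] good by (simp add: jacobi_term_def)
qed

lemma jacobiator_add:
  assumes "set (us @ vs) \<subseteq> good" and x: "(d, x) \<in> good" and y: "(d, y) \<in> good"
  shows "jacobiator (us @ [(d, x + y)] @ vs) = jacobiator (us @ [(d, x)] @ vs) + jacobiator (us @ [(d, y)] @ vs)"
  unfolding jacobiator_def
proof (rule unshuffle_sum_add_slot)
  show "set (us @ vs) \<union> {(d, x), (d, y), (d, x + y)} \<subseteq> good"
    using assms by (cases x; cases y) (auto intro: H_add A_add)
next
  fix S S' T assume good: "set (S @ S' @ T) \<subseteq> good"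
  then have SS: "set (S @ S') \<subseteq> good" "set ([] @ T) \<subseteq> good" by auto
  then have "set (S @ [(d, x)] @ S') \<subseteq> good" "set (S @ [(d, y)] @ S') \<subseteq> good" using x y by auto
  note 1 = this[THEN good_lie_l]
  show "jacobi_term (S @ [(d, x + y)] @ S') T =
      jacobi_term (S @ [(d, x)] @ S') T + jacobi_term (S @ [(d, y)] @ S') T"
    using lie_l_add[OF SS(1) x y] lie_l_add[OF SS(2), of "deg S + (d + deg S') + 1"] 1
    by (simp add: jacobi_term_def)
next
  fix S T T' assume good: "set (S @ T @ T') \<subseteq> good"
  then have "(deg S + 1, lie_l S) \<in> good" by (intro good_lie_l) auto
  then show "jacobi_term S (T @ [(d, x + y)] @ T') =
      jacobi_term S (T @ [(d, x)] @ T') + jacobi_term S (T @ [(d, y)] @ T')"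
    using lie_l_add[of "(deg S + 1, lie_l S) # T" T' d x y] good x y by (simp add: jacobi_term_def)
qed

definition is_h :: "int \<times> 'h \<times> 'g \<Rightarrow> bool"
  where "is_h z \<longleftrightarrow> snd (snd z) = 0"

definition is_a :: "int \<times> 'h \<times> 'g \<Rightarrow> bool"
  where "is_a z \<longleftrightarrow> fst (snd z) = 0"

lemma l_h_eq_0:
  assumes "set zs \<subseteq> good" "length zs \<noteq> 2 \<or> (\<exists>z\<in>set zs. is_a z)"
  shows "l_h zs = 0"
proof (cases "length zs = 2")
  case True
  then obtain d q p d' q' p' where zs: "zs = [(d, q, p), (d', q', p')]"
    by (cases zs; cases "tl zs") auto
  have q: "q \<in> H (d + 1)" "q' \<in> H (d' + 1)" using assms zs by auto
  have "q = 0 \<or> q' = 0" using assms(2) zs by (auto simp: is_a_def)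
  then show ?thesis using hb_0[OF q(1)] hb_0[OF q(2)] zs by (auto simp: l_h_def)
qed (simp add: l_h_def)

lemma lie_l_all_a:
  assumes "set zs \<subseteq> good" "\<forall>z\<in>set zs. is_a z"
  shows "lie_l zs = 0"
proof -
  have "l_a zs = 0" unfolding l_a_def
  proof (rule unshuffle_sum_eq_0)
    fix S T assume ST: "mset S + mset T = mset zs"
    show "summand S T = 0"
      by (rule summand_eq_0) (use set_mset_eq[OF ST] assms in \<open>cases S; auto simp: is_a_def\<close>)+
  qed
  moreover have "l_h zs = 0"
    using assms by (cases zs) (auto intro!: l_h_eq_0 simp: l_h_def[of "[]"])
  ultimately show ?thesis by (simp add: lie_l_def zero_prod_def)
qed

definition h_count :: "(int \<times> 'h \<times> 'g) list \<Rightarrow> nat"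
  where "h_count zs = length (filter is_h zs)"

lemma h_count_simps [simp]:
  "h_count [] = 0" "h_count (z # zs) = (if is_h z then 1 else 0) + h_count zs"
  by (simp_all add: h_count_def)

lemma h_count_mset: "mset S + mset T = mset zs \<Longrightarrow> h_count S + h_count T = h_count zs"
  unfolding h_count_def by (metis filter_append length_append mset_append mset_filter size_mset)

lemma h_count_eq_0_iff: "h_count zs = 0 \<longleftrightarrow> (\<forall>z\<in>set zs. \<not> is_h z)"
  by (auto simp: h_count_def filter_empty_conv)

lemma h_count_le: "h_count zs \<le> length zs"
  by (simp add: h_count_def)

lemma l_a_two_h:
  assumes "set zs \<subseteq> good" "h_count zs \<ge> 2"
  shows "l_a zs = 0"
  unfolding l_a_def
proof (rule unshuffle_sum_eq_0)
  fix S T assume ST: "mset S + mset T = mset zs"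
  show "summand S T = 0"
  proof (cases "length S = 1")
    case True
    then have "h_count T \<noteq> 0" using h_count_mset[OF ST] h_count_le[of S] assms(2) by simp
    then show ?thesis
      by (intro summand_eq_0) (use set_mset_eq[OF ST] assms in \<open>auto simp: is_h_def h_count_eq_0_iff\<close>)
  qed (simp add: summand_def)
qed

lemma lie_l_h_Cons:
  assumes good: "set ((d, q, 0) # zs) \<subseteq> good" "\<forall>z\<in>set zs. is_a z"
  shows "lie_l ((d, q, 0) # zs) = (0, P (iter (c q) zs))"
proof -
  have "l_h ((d, q, 0) # zs) = 0"
    using assms by (cases zs) (auto intro!: l_h_eq_0 simp: l_h_def[of "[_]"])
  moreover have "unshuffle_sum zs (\<lambda>S T. summand ((d, q, 0) # S) T)
      = unshuffle_sum zs (\<lambda>S T. if S = [] then P (iter (c q) T) else 0)"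
    by (rule unshuffle_sum_cong) (auto simp: summand_def)
  moreover have "unshuffle_sum zs (\<lambda>S T. flip (d * deg S) (summand S ((d, q, 0) # T))) = 0"
  proof (rule unshuffle_sum_eq_0)
    fix S T assume ST: "mset S + mset T = mset zs"
    have "summand S ((d, q, 0) # T) = 0"
      by (rule summand_eq_0) (use set_mset_eq[OF ST] good in auto)
    then show "flip (d * deg S) (summand S ((d, q, 0) # T)) = 0" by simp
  qed
  ultimately show ?thesis by (simp add: lie_l_def l_a_def unshuffle_sum_left_empty)
qed

lemma lie_l_hh:
  assumes "q \<in> H (d + 1)" "q' \<in> H (d' + 1)"
  shows "lie_l [(d, q, 0), (d', q', 0)] = (flip (d + 1) (hb q q'), 0)"
  using l_a_two_h[of "[(d, q, 0), (d', q', 0)]"] assms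
  by (simp add: lie_l_def l_h_def is_h_def A_0)

lemma jacobi_term_eq_0:
  assumes zs: "set zs \<subseteq> good" "\<forall>z\<in>set zs. is_h z \<or> is_a z" and ST: "mset S + mset T = mset zs"
    and "h_count zs \<noteq> 2" "\<not> (h_count zs = 3 \<and> length zs = 3)"
  shows "jacobi_term S T = 0"
proof (cases "S = []")
  case False
  have good: "set S \<subseteq> good" "set T \<subseteq> good" and pure: "\<forall>z\<in>set S \<union> set T. is_h z \<or> is_a z"
    using zs set_mset_eq[OF ST] by auto
  let ?y = "(deg S + 1, lie_l S)"
  have y: "set (?y # T) \<subseteq> good" using good good_lie_l[of S] by simp
  have len: "length S + length T = length zs"
    using ST by (metis size_mset size_union)
  note count = h_count_mset[OF ST]
  have zero: ?thesis if "lie_l S = 0" using that good by (simp add: jacobi_term_zero)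
  consider "h_count S = 0" | "h_count S = 1" "h_count T = 0" | "h_count S = 1" "h_count T \<ge> 2"
    | "h_count S \<ge> 2" "length S \<noteq> 2" | "h_count S = 2" "length S = 2"
    using assms(4) count h_count_le[of S] by linarith
  then show ?thesis
  proof cases
    case 1
    then show ?thesis using zero lie_l_all_a[of S] good pure by (auto simp: h_count_eq_0_iff)
  next
    case 2
    have "l_h S = 0"
    proof (cases "length S = 2")
      case True
      then have "\<exists>z\<in>set S. \<not> is_h z" using 2(1) unfolding h_count_def
        by (metis filter_True numeral_eq_one_iff semiring_norm(85))
      then show ?thesis using good pure by (intro l_h_eq_0) auto
    qed (simp add: l_h_def)
    then have "\<forall>z\<in>set (?y # T). is_a z"
      using 2(2) pure by (auto simp: is_a_def lie_l_def h_count_eq_0_iff)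
    then show ?thesis using lie_l_all_a[OF y] by (simp add: jacobi_term_def False)
  next
    case 3
    then have "l_a (?y # T) = 0" by (intro l_a_two_h[OF y]) simp
    moreover have "l_h (?y # T) = 0" using 3 h_count_le[of T] by (simp add: l_h_def)
    ultimately show ?thesis by (simp add: jacobi_term_def False lie_l_def[of "?y # T"] zero_prod_def)
  next
    case 4
    then show ?thesis using zero l_a_two_h[OF good(1)] by (simp add: lie_l_def l_h_def zero_prod_def)
  next
    case 5
    then have "is_h ?y" using l_a_two_h[OF good(1)] by (simp add: is_h_def lie_l_def)
    moreover have "h_count T \<noteq> 0" "length T \<noteq> 1"
      using 5 assms(4,5) count len h_count_le[of T] by auto
    ultimately have "l_a (?y # T) = 0" "l_h (?y # T) = 0"
      using l_a_two_h[OF y] by (simp_all add: l_h_def)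
    then show ?thesis by (simp add: jacobi_term_def False lie_l_def[of "?y # T"] zero_prod_def)
  qed
qed (simp add: jacobi_term_def)

lemma hb_jacobi:
  assumes "x \<in> H m" "y \<in> H n" "z \<in> H k"
  shows "hb (hb x y) z = flip (m * (n + k) + 1) (hb (hb y z) x) + flip (n * k) (hb (hb x z) y)"
proof -
  have "br (c x) (br (c y) (c z)) = flip (m * (n + k) + 1) (br (br (c y) (c z)) (c x))"
    using assms by (intro br_commute br_closed c_G)
  then have "c (hb (hb x y) z) = c (flip (m * (n + k) + 1) (hb (hb y z) x) + flip (n * k) (hb (hb x z) y))"
    using br_jacobi[OF c_G[OF assms(1)] c_G[OF assms(2)] c_G[OF assms(3)]] assms
    by (simp add: c_add c_flip c_hb c_hb[OF hb_closed])
  then show ?thesis by (simp add: c_inject)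
qed

lemma jacobiator_hhh:
  assumes x: "x \<in> H (d + 1)" and y: "y \<in> H (e + 1)" and z: "z \<in> H (f + 1)"
  shows "jacobiator [(d, x, 0), (e, y, 0), (f, z, 0)] = 0"
proof -
  let ?x = "(d, x, 0)" and ?y = "(e, y, 0)" and ?z = "(f, z, 0)"
  have good: "set [?x, ?y, ?z] \<subseteq> good" using assms by (simp add: A_0)
  have one: "jacobi_term [(d, x, 0)] T = 0" if "x \<in> H (d + 1)" "set T \<subseteq> good" for d x T
    using that lie_l_h_Cons[of d x "[]"] A_0
    by (intro jacobi_term_zero) (auto simp: P_c zero_prod_def)
  have two: "jacobi_term [(d, x, 0), (e, y, 0)] [(f, z, 0)]
      = (flip (d + e + 2 + (d + 1)) (hb (hb x y) z), 0)"
    if "x \<in> H (d + 1)" "y \<in> H (e + 1)" "z \<in> H (f + 1)" for d e f x y z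
  proof -
    have xy: "hb x y \<in> H (d + e + 1 + 1)" using hb_closed[OF that(1,2)] by (simp add: algebra_simps)
    have "jacobi_term [(d, x, 0), (e, y, 0)] [(f, z, 0)]
        = lie_l [(d + e + 1, flip (d + 1) (hb x y), 0), (f, z, 0)]"
      by (simp add: jacobi_term_def lie_l_hh[OF that(1,2)] add.assoc)
    also have "\<dots> = (flip (d + e + 1 + 1) (hb (flip (d + 1) (hb x y)) z), 0)"
      by (rule lie_l_hh[OF H_flip[OF xy] that(3)])
    finally show ?thesis by (simp add: hb_flip_left[OF xy that(3)] algebra_simps)
  qed
  have three: "jacobi_term [?x, ?y, ?z] [] = 0"
    using good l_a_two_h[OF good] by (intro jacobi_term_zero) (auto simp: is_h_def lie_l_def l_h_def zero_prod_def)
  have empty: "jacobi_term [] T = 0" for T by (simp add: jacobi_term_def)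
  show ?thesis
    using assms good
    by (simp add: jacobiator_def one two three empty hb_jacobi[OF x y z] flip_Pair zero_prod_def)
      (cases "even d"; cases "even e"; cases "even f"; simp add: flip_def)
qed

lemma jacobiator_hh:
  assumes x: "x \<in> H (d + 1)" and y: "y \<in> H (e + 1)"
    and zs: "set zs \<subseteq> good" "\<forall>z\<in>set zs. is_a z"
  shows "jacobiator ((d, x, 0) # (e, y, 0) # zs) = 0"
proof -
  let ?x = "(d, x, 0)" and ?y = "(e, y, 0)"
  let ?B = "\<lambda>x y S T. P (iter (br (c y) (P (iter (c x) S))) T)"
  have sub: "set S \<subseteq> good \<and> set T \<subseteq> good \<and> (\<forall>z\<in>set S. is_a z) \<and> (\<forall>z\<in>set T. is_a z)"
    if "mset S + mset T = mset zs" for S T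
    using set_mset_eq[OF that] zs by auto
  have both: "jacobi_term (?x # ?y # S) T
      = (if S = [] then (0, flip (d + 1) (P (iter (br (c x) (c y)) T))) else 0)"
    if "mset S + mset T = mset zs" for S T
  proof (cases "S = []")
    case True
    have T: "set T \<subseteq> good" "\<forall>z\<in>set T. is_a z" using sub[OF that] by auto
    have xy: "hb x y \<in> H (d + e + 1 + 1)" using hb_closed[OF x y] by (simp add: algebra_simps)
    have br: "br (c x) (c y) \<in> G (d + e + 1 + 1)" using c_G[OF xy] c_hb[OF x y] by simp
    have "jacobi_term (?x # ?y # S) T = lie_l ((d + e + 1, flip (d + 1) (hb x y), 0) # T)"
      using True by (simp add: jacobi_term_def lie_l_hh[OF x y] add.assoc)
    also have "\<dots> = (0, P (iter (c (flip (d + 1) (hb x y))) T))"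
      using T H_flip[OF xy] A_0 by (intro lie_l_h_Cons) auto
    also have "\<dots> = (0, flip (d + 1) (P (iter (br (c x) (c y)) T)))"
      using T by (simp add: c_flip c_hb[OF x y] iter_flip[OF br] P_flip[OF iter_closed[OF br]])
    finally show ?thesis using True by simp
  next
    case False
    have good: "set (?x # ?y # S) \<subseteq> good" "set T \<subseteq> good" using sub[OF that] x y A_0 by auto
    have "lie_l (?x # ?y # S) = 0"
      using l_a_two_h[OF good(1)] False by (auto simp: is_h_def lie_l_def l_h_def zero_prod_def)
    then show ?thesis using False good jacobi_term_zero[of "?x # ?y # S" T] by simp
  qed
  have single: "jacobi_term ((d, x, 0) # S) ((e, y, 0) # T)
      = flip ((d + deg S + 1) * e) (0, ?B x y S T)"
    if "mset S + mset T = mset zs" "x \<in> H (d + 1)" "y \<in> H (e + 1)" for S T d e x y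
  proof -
    let ?b = "P (iter (c x) S)"
    have S: "set ((d, x, 0) # S) \<subseteq> good" "\<forall>z\<in>set S. is_a z"
      and T: "set T \<subseteq> good" "\<forall>z\<in>set T. is_a z" using sub[OF that(1)] that A_0 by auto
    have b: "?b \<in> A (d + deg S + 1)"
      using P_closed[OF iter_closed[OF c_G[OF that(2)], of S]] S by (simp add: algebra_simps)
    have "jacobi_term ((d, x, 0) # S) ((e, y, 0) # T)
        = lie_l ([] @ [(d + deg S + 1, 0, ?b), (e, y, 0)] @ T)"
      by (simp add: jacobi_term_def lie_l_h_Cons[OF S])
    also have "\<dots> = flip ((d + deg S + 1) * e) (lie_l ((e, y, 0) # (d + deg S + 1, 0, ?b) # T))"
      using T b that H_0 A_0 by (subst lie_l_swap) auto
    also have "lie_l ((e, y, 0) # (d + deg S + 1, 0, ?b) # T) = (0, P (iter (c y) ((d + deg S + 1, 0, ?b) # T)))"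
      using T b that H_0 A_0 by (intro lie_l_h_Cons) (auto simp: is_a_def)
    finally show ?thesis by simp
  qed
  have none: "jacobi_term S (?x # ?y # T) = 0" if "mset S + mset T = mset zs" for S T
    using sub[OF that] x y A_0 by (intro jacobi_term_zero lie_l_all_a) auto
  have "jacobiator (?x # ?y # zs) = unshuffle_sum zs (\<lambda>S T.
      (if S = [] then (0, flip (d + 1) (P (iter (br (c x) (c y)) T))) else 0)
      + (flip (e * deg S) (flip ((d + deg S + 1) * e) (0, ?B x y S T))
        + flip (d * (e + deg S)) (flip ((e + deg S + 1) * d) (0, ?B y x S T))))"
    unfolding jacobiator_def unshuffle_sum_Cons2
    by (rule unshuffle_sum_cong) (simp add: both none single x y add.assoc)
  also have "\<dots> = unshuffle_sum zs (\<lambda>S T. if S = [] then (0, flip (d + 1) (P (iter (br (c x) (c y)) T))) else 0)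
      + unshuffle_sum zs (\<lambda>S T. flip d (0, flip ((d + 1) * (e + 1) + 1) (?B x y S T) + ?B y x S T))"
    unfolding unshuffle_sum_add[symmetric]
  proof (intro unshuffle_sum_cong arg_cong2[where f = "(+)"] refl)
    fix S T
    have 1: "flip (d * (e + deg S)) (flip ((e + deg S + 1) * d) (0, ?B y x S T)) = flip d (0, ?B y x S T)"
      and 2: "flip (e * deg S) (flip ((d + deg S + 1) * e) (0, ?B x y S T)) =
        flip (d + ((d + 1) * (e + 1) + 1)) (0, ?B x y S T)"
      unfolding flip_flip by (rule flip_cong, simp add: algebra_simps)+
    show "flip (e * deg S) (flip ((d + deg S + 1) * e) (0, ?B x y S T))
        + flip (d * (e + deg S)) (flip ((e + deg S + 1) * d) (0, ?B y x S T))
      = flip d (0, flip ((d + 1) * (e + 1) + 1) (?B x y S T) + ?B y x S T)"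
      unfolding 1 2 by (simp only: flip_Pair flip_add flip_flip flip_0 add_Pair add_0)
  qed
  also have "unshuffle_sum zs (\<lambda>S T. flip d (0 :: 'h, flip ((d + 1) * (e + 1) + 1) (?B x y S T) + ?B y x S T))
      = flip d (0, P (iter (br (c x) (c y)) zs))"
    unfolding P_iter_br_derived[OF c_G[OF x] c_G[OF y] zs(1)] unshuffle_sum_flip unshuffle_sum_Pair_0 ..
  finally show ?thesis
    unfolding unshuffle_sum_left_empty by (simp add: flip_def zero_prod_def)
qed

lemma jacobiator_move:
  assumes "set (us @ h # vs @ ws) \<subseteq> good" "jacobiator (us @ h # vs @ ws) = 0"
  shows "jacobiator (us @ vs @ h # ws) = 0"
  using assms
proof (induction vs arbitrary: us)
  case (Cons v vs)
  have "jacobiator (us @ [v, h] @ vs @ ws) = 0"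
    using jacobiator_swap[of us h v "vs @ ws"] jacobiator_swap[of us v h "vs @ ws"] Cons.prems by simp
  then show ?case using Cons.IH[of "us @ [v]"] Cons.prems by simp
qed simp

lemma jacobiator_pure:
  assumes zs: "set zs \<subseteq> good" "\<forall>z\<in>set zs. is_h z \<or> is_a z"
  shows "jacobiator zs = 0"
proof -
  consider "h_count zs \<noteq> 2 \<and> \<not> (h_count zs = 3 \<and> length zs = 3)"
    | "h_count zs = 2" | "h_count zs = 3" "length zs = 3" by blast
  then show ?thesis
  proof cases
    case 1
    then show ?thesis 
      unfolding jacobiator_def by (intro unshuffle_sum_eq_0 jacobi_term_eq_0[OF assms]) auto
  next
    case 2
    then obtain h1 h2 where "filter is_h zs = [h1, h2]"
      by (auto simp: h_count_def numeral_2_eq_2 length_Suc_conv)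
    then obtain us vs where 1: "zs = us @ h1 # vs" "\<forall>u\<in>set us. \<not> is_h u" "is_h h1" "filter is_h vs = [h2]"
      using filter_eq_ConsD[of is_h zs h1 "[h2]"] by auto
    then obtain vs' ws where 2: "vs = vs' @ h2 # ws" "\<forall>u\<in>set vs'. \<not> is_h u" "is_h h2" "filter is_h ws = []"
      using filter_eq_ConsD[of is_h vs h2 "[]"] by auto
    have a: "\<forall>z\<in>set (us @ vs' @ ws). is_a z" using 1 2 zs by (auto simp: filter_empty_conv)
    obtain d x e y where h: "h1 = (d, x, 0)" "h2 = (e, y, 0)"
      using 1(3) 2(3) by (cases h1; cases h2) (auto simp: is_h_def)
    have "jacobiator (h1 # h2 # us @ vs' @ ws) = 0"
      unfolding h using zs 1(1) 2(1) h a by (intro jacobiator_hh) auto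
    then have "jacobiator ([h1] @ (us @ vs') @ h2 # ws) = 0"
      using zs 1(1) 2(1) by (intro jacobiator_move) auto
    then have "jacobiator ([] @ us @ h1 # vs' @ h2 # ws) = 0"
      using zs 1(1) 2(1) by (intro jacobiator_move) auto
    then show ?thesis using 1(1) 2(1) by simp
  next
    case 3
    then have "\<forall>z\<in>set zs. is_h z" unfolding h_count_def by (metis length_filter_less less_irrefl)
    moreover obtain z1 z2 z3 where z: "zs = [z1, z2, z3]"
      using 3(2) by (auto simp: numeral_3_eq_3 length_Suc_conv)
    ultimately show ?thesis
      using jacobiator_hhh zs(1) by (cases z1; cases z2; cases z3) (auto simp: is_h_def)
  qed
qed

theorem jacobiator_eq_0:
  assumes "set zs \<subseteq> good"
  shows "jacobiator zs = 0"
proof -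
  have "jacobiator (us @ zs) = 0"
    if "set (us @ zs) \<subseteq> good" "\<forall>z\<in>set us. is_h z \<or> is_a z" for us
    using that
  proof (induction zs arbitrary: us)
    case Nil
    then show ?case using jacobiator_pure by simp
  next
    case (Cons z zs)
    obtain d q p where z: "z = (d, q, p)" by (metis prod.exhaust)
    have good: "(d, q, 0) \<in> good" "(d, 0, p) \<in> good" "set (us @ zs) \<subseteq> good"
      using Cons.prems z by (auto simp: H_0 A_0)
    have "jacobiator (us @ [(d, (q, 0) + (0, p))] @ zs)
        = jacobiator (us @ [(d, q, 0)] @ zs) + jacobiator (us @ [(d, 0, p)] @ zs)"
      by (rule jacobiator_add[OF good(3,1,2)])
    moreover have "jacobiator ((us @ [(d, q, 0)]) @ zs) = 0" "jacobiator ((us @ [(d, 0, p)]) @ zs) = 0"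
      by (rule Cons.IH; use Cons.prems good in \<open>auto simp: is_h_def is_a_def simp del: good_iff\<close>)+
    ultimately show ?case using z by simp
  qed
  from this[of "[]"] assms show ?thesis by simp
qed

end

section \<open>Koszul signs of permutations and shuffles\<close>

text \<open>The exponent of the Koszul sign of the arrangement \<open>is\<close> of letters \<open>i\<close> of degree \<open>d i\<close>.\<close>

fun koszul_exp :: "(nat \<Rightarrow> int) \<Rightarrow> nat list \<Rightarrow> int" where
  "koszul_exp d [] = 0"
| "koszul_exp d (i # is) = (\<Sum>j \<leftarrow> filter (\<lambda>j. j < i) is. d i * d j) + koszul_exp d is"

lemma koszul_exp_map_Suc: "koszul_exp d (map Suc is) = koszul_exp (\<lambda>i. d (Suc i)) is"
  by (induction "is") (simp_all add: filter_map comp_def)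

lemma koszul_exp_insert_0:
  "koszul_exp d (map Suc is @ 0 # map Suc js)
    = d 0 * (\<Sum>i\<leftarrow>is. d (Suc i)) + koszul_exp (\<lambda>i. d (Suc i)) (is @ js)"
  by (induction "is") (simp_all add: filter_map comp_def koszul_exp_map_Suc algebra_simps)

lemma koszul_exp_cong:
  "(\<And>i. i \<in> set is \<Longrightarrow> d i = d' i) \<Longrightarrow> koszul_exp d is = koszul_exp d' is"
proof (induction "is")
  case (Cons i "is")
  have "(\<Sum>j \<leftarrow> filter (\<lambda>j. j < i) is. d i * d j) = (\<Sum>j \<leftarrow> filter (\<lambda>j. j < i) is. d' i * d' j)"
    using Cons.prems by (intro arg_cong[where f = sum_list] map_cong) auto
  then show ?case unfolding koszul_exp.simps
    using Cons.IH Cons.prems by (intro arg_cong2[where f = "(+)"]) auto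
qed simp

lemma koszul_exp_eq_sum:
  "koszul_exp d is = (\<Sum>(r, s) \<in> {(r, s). r < s \<and> s < length is \<and> is ! s < is ! r}. d (is ! r) * d (is ! s))"
proof (induction "is")
  case (Cons i "is")
  let ?I = "\<lambda>is. {(r, s). r < s \<and> s < length is \<and> is ! s < (is ! r :: nat)}"
  let ?A = "(\<lambda>s. (0, Suc s)) ` {s. s < length is \<and> is ! s < i}"
    and ?B = "(\<lambda>(r, s). (Suc r, Suc s)) ` ?I is"
  have split: "?I (i # is) = ?A \<union> ?B"
  proof (intro set_eqI iffI)
    fix x assume x: "x \<in> ?I (i # is)"
    then obtain r s where rs: "x = (r, Suc s)" "r < Suc s" "s < length is" "is ! s < (i # is) ! r"
      by (cases x; cases "snd x") auto
    show "x \<in> ?A \<union> ?B"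
    proof (cases r)
      case 0
      then show ?thesis using rs by auto
    next
      case (Suc r')
      then have "(r', s) \<in> ?I is" using rs by simp
      then show ?thesis using rs Suc by (auto intro!: image_eqI[of _ _ "(r', s)"])
    qed
  qed auto
  have fin: "finite (?I is)" by (rule finite_subset[of _ "{..<length is} \<times> {..<length is}"]) auto
  have "(\<Sum>(r, s)\<in>?A. d ((i # is) ! r) * d ((i # is) ! s)) = (\<Sum>s | s < length is \<and> is ! s < i. d i * d (is ! s))"
    by (subst sum.reindex) (auto simp: inj_on_def)
  also have "\<dots> = (\<Sum>s<length is. if is ! s < i then d i * d (is ! s) else 0)"
    using sum.inter_filter[of "{..<length is}" "\<lambda>s. d i * d (is ! s)" "\<lambda>s. is ! s < i"] by simp
  also have "\<dots> = (\<Sum>j \<leftarrow> is. if j < i then d i * d j else 0)"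
    by (simp add: sum_list_sum_nth atLeast0LessThan)
  also have "\<dots> = (\<Sum>j \<leftarrow> filter (\<lambda>j. j < i) is. d i * d j)"
    by (simp add: sum_list_map_filter')
  finally have A: "(\<Sum>(r, s)\<in>?A. d ((i # is) ! r) * d ((i # is) ! s)) = (\<Sum>j \<leftarrow> filter (\<lambda>j. j < i) is. d i * d j)" .
  have B: "(\<Sum>(r, s)\<in>?B. d ((i # is) ! r) * d ((i # is) ! s)) = koszul_exp d is"
    unfolding Cons.IH by (subst sum.reindex) (auto simp: inj_on_def case_prod_beta)
  show ?case unfolding split
    by (subst sum.union_disjoint) (use fin A B in auto)
qed simp

lemma koszul_sign_eq:
  assumes "length ds = n"
  shows "koszul_sign \<sigma> ds = (if even (koszul_exp ((!) ds) (map \<sigma> [0..<n])) then 1 else -1 :: 'k::field)"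
proof -
  let ?I = "{(r, s). r < s \<and> s < length ds \<and> \<sigma> s < \<sigma> r}"
  have fin: "finite ?I" by (rule finite_subset[of _ "{..<n} \<times> {..<n}"]) (use assms in auto)
  have "koszul_exp ((!) ds) (map \<sigma> [0..<n]) = (\<Sum>(r, s)\<in>?I. ds ! \<sigma> r * ds ! \<sigma> s)"
    unfolding koszul_exp_eq_sum by (rule sum.cong) (use assms in auto)
  moreover have "(\<Prod>(r, s)\<in>I. (-1 :: 'k) powi (ds ! \<sigma> r * ds ! \<sigma> s)) =
      (if even (\<Sum>(r, s)\<in>I. ds ! \<sigma> r * ds ! \<sigma> s) then 1 else -1)" if "finite I" for I
    using that by (induction I) (auto simp: power_int_minus_one_minus power_int_minus_left)
  ultimately show ?thesis using fin by (simp add: koszul_sign_def)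
qed

lemma koszul_exp_sort:
  assumes swap: "\<And>us a b vs. set (us @ [a, b] @ vs) \<subseteq> X \<Longrightarrow>
      F (us @ [a, b] @ vs) = flip (fst a * fst b) (F (us @ [b, a] @ vs))"
    and "set us \<union> z ` set is \<subseteq> X" "distinct is"
  shows "F (us @ map z is) = flip (koszul_exp (\<lambda>i. fst (z i)) is) (F (us @ map z (sort is)))"
  using assms(2,3)
proof (induction "is" arbitrary: us)
  case (Cons i "is")
  have insort: "F (us @ z i # map z js) =
      flip (\<Sum>j \<leftarrow> filter (\<lambda>j. j < i) js. fst (z i) * fst (z j)) (F (us @ map z (insort i js)))"
    if "set us \<union> z ` set (i # js) \<subseteq> X" "sorted js" for us js
    using that
  proof (induction js arbitrary: us)
    case (Cons j js)
    show ?case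
    proof (cases "i \<le> j")
      case True
      then have "filter (\<lambda>j. j < i) (j # js) = []" using Cons.prems(2) by (auto simp: filter_empty_conv)
      then show ?thesis using True by simp
    next
      case False
      have "F (us @ z i # map z (j # js)) = flip (fst (z i) * fst (z j)) (F ((us @ [z j]) @ z i # map z js))"
        using swap[of us "z i" "z j" "map z js"] Cons.prems by simp
      also have "F ((us @ [z j]) @ z i # map z js) =
          flip (\<Sum>j \<leftarrow> filter (\<lambda>j. j < i) js. fst (z i) * fst (z j)) (F ((us @ [z j]) @ map z (insort i js)))"
        using Cons.prems by (intro Cons.IH) auto
      finally show ?thesis using False by simp
    qed
  qed simp
  have "F (us @ map z (i # is)) = flip (koszul_exp (\<lambda>i. fst (z i)) is) (F ((us @ [z i]) @ map z (sort is)))"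
    using Cons.IH[of "us @ [z i]"] Cons.prems by simp
  also have "F ((us @ [z i]) @ map z (sort is)) =
      flip (\<Sum>j \<leftarrow> filter (\<lambda>j. j < i) (sort is). fst (z i) * fst (z j)) (F (us @ map z (insort i (sort is))))"
    using insort[of us "sort is"] Cons.prems by simp
  also have "(\<Sum>j \<leftarrow> filter (\<lambda>j. j < i) (sort is). fst (z i) * fst (z j))
      = (\<Sum>j \<leftarrow> filter (\<lambda>j. j < i) is. fst (z i) * fst (z j))"
    by (simp only: sum_mset_sum_list[symmetric] mset_map mset_filter mset_sort)
  finally show ?case by (simp add: add.commute)
qed simp

lemma permute_range_map:
  assumes "\<sigma> permutes {..<length xs}" "b \<le> length xs"
  shows "map f (permute_range \<sigma> xs a b) = permute_range \<sigma> (map f xs) a b"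
    and "set (permute_range \<sigma> xs a b) \<subseteq> set xs"
proof -
  have "\<sigma> r < length xs" if "r < b" for r
    using permutes_in_image[OF assms(1), of r] that assms(2) by simp
  then show "map f (permute_range \<sigma> xs a b) = permute_range \<sigma> (map f xs) a b"
    and "set (permute_range \<sigma> xs a b) \<subseteq> set xs"
    by (auto simp: permute_range_def)
qed

lemma permute_signed:
  assumes swap: "\<And>us a b vs. set (us @ [a, b] @ vs) \<subseteq> X \<Longrightarrow>
      F (us @ [a, b] @ vs) = flip (fst a * fst b) (F (us @ [b, a] @ vs))"
    and zs: "set zs \<subseteq> X" "length zs = n" and \<sigma>: "\<sigma> permutes {..<n}"
  shows "F (permute_range \<sigma> zs 0 n) = flip (koszul_exp ((!) (map fst zs)) (map \<sigma> [0..<n])) (F zs)"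
proof -
  have set: "set (map \<sigma> [0..<n]) = {..<n}"
    using permutes_image[OF \<sigma>] by (simp add: atLeast0LessThan)
  have distinct: "distinct (map \<sigma> [0..<n])"
    using permutes_inj_on[OF \<sigma>] by (simp add: distinct_map)
  have sort: "sort (map \<sigma> [0..<n]) = [0..<n]"
    by (rule sorted_distinct_set_unique) (use set distinct in \<open>auto simp: atLeast0LessThan\<close>)
  have "F ([] @ map ((!) zs) (map \<sigma> [0..<n])) =
      flip (koszul_exp (\<lambda>i. fst (zs ! i)) (map \<sigma> [0..<n])) (F ([] @ map ((!) zs) (sort (map \<sigma> [0..<n]))))"
    by (rule koszul_exp_sort[OF swap]) (use set distinct zs in auto)
  moreover have "koszul_exp (\<lambda>i. fst (zs ! i)) (map \<sigma> [0..<n]) = koszul_exp ((!) (map fst zs)) (map \<sigma> [0..<n])"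
    by (rule koszul_exp_cong) (use set zs in auto)
  moreover have "map ((!) zs) [0..<n] = zs" using zs(2) by (metis map_nth)
  ultimately show ?thesis unfolding sort by (simp add: permute_range_def comp_def)
qed

definition chosen :: "nat \<Rightarrow> nat set \<Rightarrow> nat list"
  where "chosen n S = filter (\<lambda>i. i \<in> S) [0..<n]"

lemma chosen_props:
  "sorted (chosen n S)" "distinct (chosen n S)" "set (chosen n S) = {..<n} \<inter> S"
  "length (chosen n S) = card ({..<n} \<inter> S)"
proof -
  show "sorted (chosen n S)" "distinct (chosen n S)" and set: "set (chosen n S) = {..<n} \<inter> S"
    by (auto simp: chosen_def sorted_wrt_filter)
  then show "length (chosen n S) = card ({..<n} \<inter> S)" by (metis distinct_card)
qed

lemma chosen_Suc:
  "chosen (Suc n) (insert 0 (Suc ` S)) = 0 # map Suc (chosen n S)"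
  "chosen (Suc n) (Suc ` S) = map Suc (chosen n S)"
  "chosen (Suc n) (- insert 0 (Suc ` S)) = map Suc (chosen n (- S))"
  "chosen (Suc n) (- Suc ` S) = 0 # map Suc (chosen n (- S))"
  by (auto simp: chosen_def upt_conv_Cons map_Suc_upt[symmetric] filter_map comp_def inj_image_mem_iff simp del: upt_Suc)

lemma sum_Pow_Suc:
  "sum f (Pow {..<Suc n}) = (\<Sum>S\<in>Pow {..<n}. f (insert 0 (Suc ` S))) + (\<Sum>S\<in>Pow {..<n}. f (Suc ` S))"
proof -
  have inj: "inj_on ((`) Suc) (Pow {..<n})" "inj_on (\<lambda>S. insert 0 (Suc ` S)) (Pow {..<n})"
    by (auto simp: inj_on_def)
  have "Pow {..<Suc n} = (\<lambda>S. insert 0 (Suc ` S)) ` Pow {..<n} \<union> (`) Suc ` Pow {..<n}"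
    unfolding lessThan_Suc_eq_insert_0 Pow_insert image_Pow_surj[OF refl, symmetric] image_image by blast
  moreover have "(\<lambda>S. insert 0 (Suc ` S)) ` Pow {..<n} \<inter> (`) Suc ` Pow {..<n} = {}" by auto
  ultimately show ?thesis by (simp add: sum.union_disjoint sum.reindex inj)
qed

lemma unshuffle_sum_eq_sum_Pow:
  "unshuffle_sum zs F = (\<Sum>S \<in> Pow {..<length zs}.
     flip (koszul_exp ((!) (map fst zs)) (chosen (length zs) S @ chosen (length zs) (- S)))
       (F (map ((!) zs) (chosen (length zs) S)) (map ((!) zs) (chosen (length zs) (- S)))))"
proof (induction zs arbitrary: F)
  case Nil
  then show ?case by (simp add: chosen_def)
next
  case (Cons z zs)
  let ?n = "length zs"
  have deg: "(\<Sum>i\<leftarrow>chosen ?n S. map fst zs ! i) = deg (map ((!) zs) (chosen ?n S))" for S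
    unfolding deg_def map_map comp_def
    by (intro arg_cong[where f = sum_list] map_cong) (auto simp: chosen_def)
  show ?case
    by (simp add: sum_Pow_Suc chosen_Suc Cons.IH comp_def koszul_exp_insert_0 koszul_exp_map_Suc deg
        map_append[symmetric] filter_map add.commute del: map_append)
qed

lemma shuffle_perms_eq_chosen:
  assumes "\<sigma> \<in> shuffle_perms i j"
  shows "map \<sigma> [0..<i] = chosen (i + j) (\<sigma> ` {..<i})"
    and "map \<sigma> [i..<i + j] = chosen (i + j) (- \<sigma> ` {..<i})"
proof -
  have \<sigma>: "\<sigma> permutes {..<i + j}" and mono: "strict_mono_on {..<i} \<sigma>" "strict_mono_on {i..<i + j} \<sigma>"
    using assms by (auto simp: shuffle_perms_def)
  note inj = permutes_inj[OF \<sigma>]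
  have *: "map \<sigma> [a..<b] = chosen (i + j) X"
    if "strict_mono_on {a..<b} \<sigma>" "{..<i + j} \<inter> X = \<sigma> ` {a..<b}" for a b X
  proof (rule sorted_distinct_set_unique)
    show "sorted (map \<sigma> [a..<b])"
      using strict_mono_onD[OF that(1)] by (auto simp: sorted_wrt_map intro!: sorted_wrt_mono_rel[OF _ sorted_wrt_upt] less_imp_le)
    show "distinct (map \<sigma> [a..<b])" using inj by (auto simp: distinct_map inj_on_def)
  qed (use chosen_props that(2) in auto)
  show "map \<sigma> [0..<i] = chosen (i + j) (\<sigma> ` {..<i})"
  proof (rule *)
    have "\<sigma> ` {..<i} \<subseteq> \<sigma> ` {..<i + j}" by (rule image_mono) auto
    then show "{..<i + j} \<inter> \<sigma> ` {..<i} = \<sigma> ` {0..<i}"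
      unfolding permutes_image[OF \<sigma>] by (auto simp: atLeast0LessThan)
  qed (use mono(1) in \<open>simp add: atLeast0LessThan\<close>)
  have "{..<i + j} = \<sigma> ` {..<i} \<union> \<sigma> ` {i..<i + j}"
    unfolding image_Un[symmetric] using permutes_image[OF \<sigma>] by (simp add: ivl_disj_un)
  moreover have "\<sigma> ` {..<i} \<inter> \<sigma> ` {i..<i + j} = {}"
    unfolding image_Int[OF inj, symmetric] by auto
  ultimately show "map \<sigma> [i..<i + j] = chosen (i + j) (- \<sigma> ` {..<i})"
    by (intro *[OF mono(2)]) auto
qed

lemma sum_shuffle_perms:
  "(\<Sum>\<sigma>\<in>shuffle_perms i j. f (map \<sigma> [0..<i]) (map \<sigma> [i..<i + j])) =
    (\<Sum>S | S \<subseteq> {..<i + j} \<and> card S = i. f (chosen (i + j) S) (chosen (i + j) (- S)))"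
proof (rule sum.reindex_bij_witness[where
      i = "\<lambda>S r. if r < i + j then (chosen (i + j) S @ chosen (i + j) (- S)) ! r else r"
      and j = "\<lambda>\<sigma>. \<sigma> ` {..<i}"])
  fix \<sigma> assume sh: "\<sigma> \<in> shuffle_perms i j"
  then have \<sigma>: "\<sigma> permutes {..<i + j}" by (simp add: shuffle_perms_def)
  note map = shuffle_perms_eq_chosen[OF sh]
  have "map \<sigma> [0..<i] @ map \<sigma> [i..<i + j] = map \<sigma> [0..<i + j]"
    unfolding upt_add_eq_append[of 0 i j, OF le0] by simp
  then show "(\<lambda>r. if r < i + j then (chosen (i + j) (\<sigma> ` {..<i}) @ chosen (i + j) (- \<sigma> ` {..<i})) ! r else r) = \<sigma>"
    using permutes_not_in[OF \<sigma>] by (auto simp: map[symmetric])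
  show "\<sigma> ` {..<i} \<in> {S. S \<subseteq> {..<i + j} \<and> card S = i}"
  proof (intro CollectI conjI)
    have "\<sigma> ` {..<i} \<subseteq> \<sigma> ` {..<i + j}" by (rule image_mono) auto
    then show "\<sigma> ` {..<i} \<subseteq> {..<i + j}" unfolding permutes_image[OF \<sigma>] .
    show "card (\<sigma> ` {..<i}) = i" using card_image[OF permutes_inj_on[OF \<sigma>, of "{..<i}"]] by simp
  qed
  show "f (chosen (i + j) (\<sigma> ` {..<i})) (chosen (i + j) (- \<sigma> ` {..<i})) =
      f (map \<sigma> [0..<i]) (map \<sigma> [i..<i + j])"
    unfolding map ..
next
  fix S assume "S \<in> {S. S \<subseteq> {..<i + j} \<and> card S = i}"
  then have S: "S \<subseteq> {..<i + j}" "card S = i" by auto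
  let ?L = "chosen (i + j) S" and ?R = "chosen (i + j) (- S)"
  let ?\<sigma> = "\<lambda>r. if r < i + j then (?L @ ?R) ! r else r"
  have L: "length ?L = i" "set ?L = S" using S chosen_props[of "i + j" S] by (auto simp: Int_absorb1)
  have R: "length ?R = j" using S chosen_props(4)[of "i + j" "- S"]
    by (simp add: card_Diff_subset finite_subset[OF S(1)] Diff_eq[symmetric])
  have "distinct (?L @ ?R)" using chosen_props[of "i + j"] by auto
  then have "bij_betw ((!) (?L @ ?R)) {..<i + j} (set (?L @ ?R))" by (intro bij_betw_nth) (auto simp: L R)
  moreover have "set (?L @ ?R) = {..<i + j}" using chosen_props(3)[of "i + j"] by auto
  ultimately have "bij_betw ((!) (?L @ ?R)) {..<i + j} {..<i + j}" by (simp only:)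
  then have "bij_betw ?\<sigma> {..<i + j} {..<i + j}" by (rule iffD1[OF bij_betw_cong, rotated]) auto
  then have \<sigma>: "?\<sigma> permutes {..<i + j}" by (rule bij_imp_permutes) auto
  show image: "?\<sigma> ` {..<i} = S" using L by (auto simp: nth_append set_conv_nth)
  have less: "xs ! r < xs ! s" if "sorted xs" "distinct xs" "r < s" "s < length xs" for xs :: "nat list" and r s
    using that by (metis le_neq_implies_less less_le_trans nat_less_le nth_eq_iff_index_eq sorted_wrt_nth_less)
  show "?\<sigma> \<in> shuffle_perms i j"
    unfolding shuffle_perms_def mem_Collect_eq
  proof (intro conjI \<sigma> strict_mono_onI)
    fix r s assume "r \<in> {..<i}" "s \<in> {..<i}" "r < s"
    then show "?\<sigma> r < ?\<sigma> s"
      using less[OF chosen_props(1,2), of r s "i + j" S] by (simp add: nth_append L)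
  next
    fix r s assume "r \<in> {i..<i + j}" "s \<in> {i..<i + j}" "r < s"
    then show "?\<sigma> r < ?\<sigma> s"
      using less[OF chosen_props(1,2), of "r - i" "s - i" "i + j" "- S"] by (simp add: nth_append L R)
  qed
qed

lemma sum_shuffles_eq_unshuffle_sum:
  assumes "length zs = n"
  shows "(\<Sum>i\<le>n. \<Sum>\<sigma>\<in>shuffle_perms i (n - i).
      flip (koszul_exp ((!) (map fst zs)) (map \<sigma> [0..<n])) (F (permute_range \<sigma> zs 0 i) (permute_range \<sigma> zs i n)))
    = unshuffle_sum zs F"
proof -
  let ?f = "\<lambda>is js. flip (koszul_exp ((!) (map fst zs)) (is @ js)) (F (map ((!) zs) is) (map ((!) zs) js))"
  have "(\<Sum>\<sigma>\<in>shuffle_perms i (n - i).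
      flip (koszul_exp ((!) (map fst zs)) (map \<sigma> [0..<n])) (F (permute_range \<sigma> zs 0 i) (permute_range \<sigma> zs i n)))
    = (\<Sum>S\<in>{S\<in>Pow {..<n}. card S = i}. ?f (chosen n S) (chosen n (- S)))" if "i \<le> n" for i
  proof -
    have upt: "[0..<n] = [0..<i] @ [i..<n]" using that by (metis le_add_diff_inverse upt_add_eq_append zero_le)
    show ?thesis
      using sum_shuffle_perms[of ?f i "n - i"] that
      by (simp add: permute_range_def upt comp_def Pow_def)
  qed
  then have "(\<Sum>i\<le>n. \<Sum>\<sigma>\<in>shuffle_perms i (n - i).
      flip (koszul_exp ((!) (map fst zs)) (map \<sigma> [0..<n])) (F (permute_range \<sigma> zs 0 i) (permute_range \<sigma> zs i n)))
    = (\<Sum>i\<le>n. \<Sum>S\<in>{S\<in>Pow {..<n}. card S = i}. ?f (chosen n S) (chosen n (- S)))" by simp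
  also have "\<dots> = (\<Sum>S\<in>Pow {..<n}. ?f (chosen n S) (chosen n (- S)))"
    by (rule sum.group) (auto intro: order_trans[OF card_mono[of "{..<n}"]])
  finally show ?thesis using assms by (simp add: unshuffle_sum_eq_sum_Pow)
qed

section \<open>The pre-Lie product behind the bracket\<close>

fun split_sum :: "('x list \<Rightarrow> 'x list \<Rightarrow> 'v) \<Rightarrow> 'x list \<Rightarrow> 'v::ab_group_add" where
  "split_sum f [] = f [] []"
| "split_sum f (z # zs) = f [] (z # zs) + split_sum (\<lambda>u t. f (z # u) t) zs"

lemma split_sum_cong:
  "(\<And>u t. u @ t = zs \<Longrightarrow> f u t = f' u t) \<Longrightarrow> split_sum f zs = split_sum f' zs"
proof (induction zs arbitrary: f f')
  case (Cons z zs)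
  have "split_sum (\<lambda>u t. f (z # u) t) zs = split_sum (\<lambda>u t. f' (z # u) t) zs"
    by (rule Cons.IH) (simp add: Cons.prems)
  then show ?case by (simp add: Cons.prems)
qed simp

lemma split_sum_hom:
  assumes "\<And>x y. h (x + y) = h x + h y"
  shows "h (split_sum f zs) = split_sum (\<lambda>u t. h (f u t)) zs"
  by (induction zs arbitrary: f) (simp_all add: assms)

lemma split_sum_add: "split_sum (\<lambda>u t. f u t + f' u t) zs = split_sum f zs + split_sum f' zs"
  by (induction zs arbitrary: f f') (simp_all add: algebra_simps)

lemma split_sum_0 [simp]: "split_sum (\<lambda>u t. 0) zs = 0"
  by (induction zs) simp_all

lemma split_sum_middle:
  "split_sum f (us @ [z] @ ts)
    = split_sum (\<lambda>a b. f a (b @ [z] @ ts)) us + split_sum (\<lambda>a b. f (us @ [z] @ a) b) ts"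
  by (induction us arbitrary: f) (simp_all add: add.assoc)

lemma split_sum_assoc:
  "split_sum (\<lambda>r c. split_sum (\<lambda>a b. f a b c) r) zs = split_sum (\<lambda>a r. split_sum (\<lambda>b c. f a b c) r) zs"
  by (induction zs arbitrary: f) (simp_all add: split_sum_add add.assoc)

lemma split_sum_swap:
  "split_sum (\<lambda>a b. split_sum (\<lambda>c d. f a b c d) ys) zs = split_sum (\<lambda>c d. split_sum (\<lambda>a b. f a b c d) zs) ys"
  by (induction zs arbitrary: f) (simp_all add: split_sum_add)

lemma split_sum_map: "split_sum f (map g zs) = split_sum (\<lambda>a b. f (map g a) (map g b)) zs"
  by (induction zs arbitrary: f) simp_all

lemma split_sum_eq_sum: "split_sum f zs = (\<Sum>i\<le>length zs. f (take i zs) (drop i zs))"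
proof (induction zs arbitrary: f)
  case (Cons z zs)
  show ?case unfolding list.size(4) add_Suc_right add_0_right by (simp add: sum.atMost_Suc_shift Cons del: sum.atMost_Suc)
qed simp

definition block_sum :: "('x list \<Rightarrow> 'x list \<Rightarrow> 'x list \<Rightarrow> 'v) \<Rightarrow> 'x list \<Rightarrow> 'v::ab_group_add"
  where "block_sum f zs = split_sum (\<lambda>u r. split_sum (\<lambda>w t. if w = [] then 0 else f u w t) r) zs"

lemma block_sum_cong:
  assumes "\<And>u w t. u @ w @ t = zs \<Longrightarrow> w \<noteq> [] \<Longrightarrow> f u w t = f' u w t"
  shows "block_sum f zs = block_sum f' zs"
  unfolding block_sum_def by (intro split_sum_cong) (use assms in auto)

lemma block_sum_hom:
  fixes h :: "'v::ab_group_add \<Rightarrow> 'u::ab_group_add"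
  assumes "\<And>x y. h (x + y) = h x + h y"
  shows "h (block_sum f zs) = block_sum (\<lambda>u w t. h (f u w t)) zs"
proof -
  have "h 0 = 0" using assms[of 0 0] by simp
  then show ?thesis unfolding block_sum_def
    by (simp add: split_sum_hom[of h, OF assms] if_distrib[of h] cong: if_cong)
qed

lemma block_sum_add:
  "block_sum (\<lambda>u w t. f u w t + f' u w t) zs = block_sum f zs + block_sum f' zs"
  unfolding block_sum_def split_sum_add[symmetric] by (intro split_sum_cong) auto

lemma block_sum_flip: "block_sum (\<lambda>u w t. flip k (f u w t)) zs = flip k (block_sum f zs)"
  by (rule block_sum_hom[symmetric]) (rule flip_add)

lemma block_sum_minus: "block_sum (\<lambda>u w t. - f u w t) zs = - block_sum f zs"
  using block_sum_flip[of 1 f zs] by (simp add: flip_def)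

lemma block_sum_diff:
  "block_sum (\<lambda>u w t. f u w t - f' u w t) zs = block_sum f zs - block_sum f' zs"
  using block_sum_add[of f "\<lambda>u w t. - f' u w t"] by (simp add: block_sum_minus)

lemma block_sum_0 [simp]: "block_sum (\<lambda>u w t. 0) zs = 0"
  by (simp add: block_sum_def cong: if_cong)

lemma block_sum_Nil [simp]: "block_sum f [] = 0"
  by (simp add: block_sum_def)

lemma block_sum_map:
  "block_sum f (map g zs) = block_sum (\<lambda>u w t. f (map g u) (map g w) (map g t)) zs"
  unfolding block_sum_def split_sum_map by simp

lemma block_sum_middle:
  "block_sum f (us @ [z] @ ts) =
    block_sum (\<lambda>a b c. f a b (c @ [z] @ ts)) us
    + split_sum (\<lambda>a b. split_sum (\<lambda>c d. f a (b @ [z] @ c) d) ts) us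
    + block_sum (\<lambda>a b c. f (us @ [z] @ a) b c) ts"
  unfolding block_sum_def split_sum_middle split_sum_add by simp

lemma block_sum_nested:
  "block_sum (\<lambda>u w t. split_sum (\<lambda>a b. split_sum (\<lambda>c d. f a b w c d) t) u) zs
    = block_sum (\<lambda>a m d. block_sum (\<lambda>b w c. f a b w c d) m) zs"
proof -
  let ?f = "\<lambda>a b w c d. if w = [] then 0 else f a b w c d"
  have "block_sum (\<lambda>u w t. split_sum (\<lambda>a b. split_sum (\<lambda>c d. f a b w c d) t) u) zs
      = split_sum (\<lambda>u r. split_sum (\<lambda>w t. split_sum (\<lambda>a b. split_sum (\<lambda>c d. ?f a b w c d) t) u) r) zs"
    unfolding block_sum_def by (intro split_sum_cong) simp
  also have "\<dots> = split_sum (\<lambda>u r. split_sum (\<lambda>a b. split_sum (\<lambda>w t. split_sum (\<lambda>c d. ?f a b w c d) t) r) u) zs"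
    by (subst split_sum_swap) simp
  also have "\<dots> = split_sum (\<lambda>a r. split_sum (\<lambda>b r. split_sum (\<lambda>w t. split_sum (\<lambda>c d. ?f a b w c d) t) r) r) zs"
    by (rule split_sum_assoc)
  also have "\<dots> = split_sum (\<lambda>a r. split_sum (\<lambda>b r. split_sum (\<lambda>r d. split_sum (\<lambda>w c. ?f a b w c d) r) r) r) zs"
    by (subst split_sum_assoc) simp
  also have "\<dots> = split_sum (\<lambda>a r. split_sum (\<lambda>m d. split_sum (\<lambda>b r. split_sum (\<lambda>w c. ?f a b w c d) r) m) r) zs"
    by (subst split_sum_assoc[symmetric]) simp
  also have "\<dots> = block_sum (\<lambda>a m d. block_sum (\<lambda>b w c. f a b w c d) m) zs"
    unfolding block_sum_def by (intro split_sum_cong) simp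
  finally show ?thesis .
qed

lemma block_sum_two:
  "block_sum (\<lambda>u w t. block_sum (\<lambda>a b c. f a b c w t) u) zs
    = block_sum (\<lambda>a b t. block_sum (\<lambda>c w t. f a b c w t) t) zs"
proof -
  let ?f = "\<lambda>a b c w t. if w = [] then 0 else if b = [] then 0 else f a b c w t"
  have "block_sum (\<lambda>u w t. block_sum (\<lambda>a b c. f a b c w t) u) zs
      = split_sum (\<lambda>u r. split_sum (\<lambda>w t. split_sum (\<lambda>a s. split_sum (\<lambda>b c. ?f a b c w t) s) u) r) zs"
    unfolding block_sum_def by (intro split_sum_cong) (simp cong: if_cong)
  also have "\<dots> = split_sum (\<lambda>u r. split_sum (\<lambda>a s. split_sum (\<lambda>w t. split_sum (\<lambda>b c. ?f a b c w t) s) r) u) zs"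
    by (subst split_sum_swap) simp
  also have "\<dots> = split_sum (\<lambda>u r. split_sum (\<lambda>a s. split_sum (\<lambda>b c. split_sum (\<lambda>w t. ?f a b c w t) r) s) u) zs"
    by (subst (2) split_sum_swap) simp
  also have "\<dots> = split_sum (\<lambda>a r. split_sum (\<lambda>s r. split_sum (\<lambda>b c. split_sum (\<lambda>w t. ?f a b c w t) r) s) r) zs"
    by (rule split_sum_assoc)
  also have "\<dots> = split_sum (\<lambda>a r. split_sum (\<lambda>b r. split_sum (\<lambda>c r. split_sum (\<lambda>w t. ?f a b c w t) r) r) r) zs"
    by (subst split_sum_assoc) simp
  also have "\<dots> = block_sum (\<lambda>a b t. block_sum (\<lambda>c w t. f a b c w t) t) zs"
    unfolding block_sum_def by (intro split_sum_cong) (simp cong: if_cong)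
  finally show ?thesis .
qed

lemma label_prod_append:
  assumes "\<alpha> \<noteq> []" "\<beta> \<noteq> []"
  shows "label_prod (\<alpha> @ \<beta>) = label_prod \<alpha> * label_prod \<beta>"
proof -
  have foldl: "foldl (*) (x * y) zs = x * foldl (*) y zs" for x y :: 'a and zs
    by (induction zs arbitrary: y) (simp_all add: mult.assoc)
  show ?thesis using assms by (cases \<alpha>; cases \<beta>) (simp_all add: label_prod_def foldl)
qed

lemma label_prod_single [simp]: "label_prod [a] = a"
  by (simp add: label_prod_def)

lemma label_prod_nested:
  "\<beta> \<noteq> [] \<Longrightarrow> label_prod (\<alpha> @ [label_prod \<beta>] @ \<gamma>) = label_prod (\<alpha> @ \<beta> @ \<gamma>)"
  by (cases "\<alpha> = []"; cases "\<gamma> = []") (simp_all add: label_prod_append del: append_Cons)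

text \<open>
  A labelled map is turned into a function of the list of pairs of a label and an argument; a
  partial composition then replaces a block of the list by the single pair \<open>merged\<close>.
\<close>

definition merged :: "(('w::semigroup_mult \<times> 'v) list \<Rightarrow> 'v) \<Rightarrow> ('w \<times> 'v) list \<Rightarrow> 'w \<times> 'v"
  where "merged g w = (label_prod (map fst w), g w)"

definition slot_additive :: "(('w \<times> 'v::ab_group_add) list \<Rightarrow> 'v) \<Rightarrow> bool"
  where "slot_additive f \<longleftrightarrow>
    (\<forall>us a x y ts. f (us @ [(a, x + y)] @ ts) = f (us @ [(a, x)] @ ts) + f (us @ [(a, y)] @ ts))"

lemma slot_additiveD:
  "slot_additive f \<Longrightarrow> f (us @ [(a, x + y)] @ ts) = f (us @ [(a, x)] @ ts) + f (us @ [(a, y)] @ ts)"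
  unfolding slot_additive_def by blast

lemma slot_additive_0: "slot_additive f \<Longrightarrow> f (us @ [(a, 0)] @ ts) = 0"
  using slot_additiveD[of f us a 0 0 ts] by simp

definition concentrated :: "nat \<Rightarrow> ('x list \<Rightarrow> 'v::zero) \<Rightarrow> bool"
  where "concentrated n f \<longleftrightarrow> (\<forall>zs. length zs \<noteq> n \<longrightarrow> f zs = 0)"

definition pre_lie :: "(('w::semigroup_mult \<times> 'v) list \<Rightarrow> 'v) \<Rightarrow> (('w \<times> 'v) list \<Rightarrow> 'v) \<Rightarrow>
    ('w \<times> 'v) list \<Rightarrow> 'v::ab_group_add"
  where "pre_lie f g zs = block_sum (\<lambda>u w t.
    flip (int (length u) * (int (length w) - 1)) (f (u @ [merged g w] @ t))) zs"

text \<open>The part of \<open>(f \<circ> g) \<circ> h\<close> in which \<open>g\<close> and \<open>h\<close> are inserted into different arguments of \<open>f\<close>.\<close>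

definition insert_two :: "(('w::semigroup_mult \<times> 'v) list \<Rightarrow> 'v) \<Rightarrow> (('w \<times> 'v) list \<Rightarrow> 'v) \<Rightarrow>
    (('w \<times> 'v) list \<Rightarrow> 'v) \<Rightarrow> ('w \<times> 'v) list \<Rightarrow> 'v::ab_group_add"
  where "insert_two f g h zs = block_sum (\<lambda>a b t. block_sum (\<lambda>c w t.
      flip ((int (length a) + int (length b) + int (length c)) * (int (length w) - 1)
          + int (length a) * (int (length b) - 1))
        (f (a @ [merged g b] @ c @ [merged h w] @ t))) t) zs"

lemma pre_lie_assoc:
  assumes f: "slot_additive f"
  shows "pre_lie (pre_lie f g) h zs = pre_lie f (pre_lie g h) zs
    + (insert_two f g h zs + block_sum (\<lambda>u w t. block_sum (\<lambda>a b c.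
        flip (int (length u) * (int (length w) - 1) + (int (length u) + 1 + int (length a)) * (int (length b) - 1))
          (f (u @ [merged h w] @ a @ [merged g b] @ c))) t) zs)"
proof -
  let ?l = "\<lambda>u. int (length u)"
  let ?in = "\<lambda>a b w c d. flip ((?l a + ?l b) * (?l w - 1) + ?l a * (?l b + ?l c))
          (f (a @ [merged g (b @ [merged h w] @ c)] @ d))"
  have "pre_lie (pre_lie f g) h zs = block_sum (\<lambda>u w t.
      block_sum (\<lambda>a b c. flip ((?l a + ?l b + ?l c) * (?l w - 1) + ?l a * (?l b - 1))
          (f (a @ [merged g b] @ c @ [merged h w] @ t))) u
      + split_sum (\<lambda>a b. split_sum (\<lambda>c d. ?in a b w c d) t) u
      + block_sum (\<lambda>a b c. flip (?l u * (?l w - 1) + (?l u + 1 + ?l a) * (?l b - 1))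
          (f (u @ [merged h w] @ a @ [merged g b] @ c))) t) zs"
    unfolding pre_lie_def[of "pre_lie f g"]
  proof (rule block_sum_cong)
    fix u w t :: "('a \<times> 'b) list"
    assume "u @ w @ t = zs"
    let ?k = "?l u * (?l w - 1)"
    have 1: "flip ?k (block_sum (\<lambda>a b c. flip (?l a * (?l b - 1)) (f (a @ [merged g b] @ c @ [merged h w] @ t))) u)
      = block_sum (\<lambda>a b c. flip ((?l a + ?l b + ?l c) * (?l w - 1) + ?l a * (?l b - 1))
          (f (a @ [merged g b] @ c @ [merged h w] @ t))) u"
      unfolding block_sum_flip[symmetric] by (rule block_sum_cong) (auto simp: algebra_simps)
    have 2: "flip ?k (split_sum (\<lambda>a b. split_sum (\<lambda>c d. flip (?l a * (?l (b @ [merged h w] @ c) - 1))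
          (f (a @ [merged g (b @ [merged h w] @ c)] @ d))) t) u)
      = split_sum (\<lambda>a b. split_sum (\<lambda>c d. ?in a b w c d) t) u"
      unfolding split_sum_hom[of "flip ?k", OF flip_add] by (intro split_sum_cong) (auto simp: algebra_simps)
    have 3: "flip ?k (block_sum (\<lambda>a b c. flip (?l (u @ [merged h w] @ a) * (?l b - 1))
          (f ((u @ [merged h w] @ a) @ [merged g b] @ c))) t)
      = block_sum (\<lambda>a b c. flip (?k + (?l u + 1 + ?l a) * (?l b - 1))
          (f (u @ [merged h w] @ a @ [merged g b] @ c))) t"
      unfolding block_sum_flip[symmetric] by (rule block_sum_cong) (simp add: algebra_simps)
    show "flip ?k (pre_lie f g (u @ [merged h w] @ t)) =
      block_sum (\<lambda>a b c. flip ((?l a + ?l b + ?l c) * (?l w - 1) + ?l a * (?l b - 1))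
          (f (a @ [merged g b] @ c @ [merged h w] @ t))) u
      + split_sum (\<lambda>a b. split_sum (\<lambda>c d. ?in a b w c d) t) u
      + block_sum (\<lambda>a b c. flip (?k + (?l u + 1 + ?l a) * (?l b - 1))
          (f (u @ [merged h w] @ a @ [merged g b] @ c))) t"
      unfolding pre_lie_def block_sum_middle flip_add 1 2 3 ..
  qed
  also have "\<dots> = insert_two f g h zs
      + block_sum (\<lambda>a m d. block_sum (\<lambda>b w c. ?in a b w c d) m) zs
      + block_sum (\<lambda>u w t. block_sum (\<lambda>a b c.
        flip (int (length u) * (int (length w) - 1) + (int (length u) + 1 + int (length a)) * (int (length b) - 1))
          (f (u @ [merged h w] @ a @ [merged g b] @ c))) t) zs"
    unfolding block_sum_add block_sum_nested insert_two_def block_sum_two ..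
  also have "block_sum (\<lambda>a m d. block_sum (\<lambda>b w c. ?in a b w c d) m) zs = pre_lie f (pre_lie g h) zs"
    unfolding pre_lie_def[of f]
  proof (rule block_sum_cong)
    fix a m d :: "('a \<times> 'b) list"
    let ?h = "\<lambda>x. flip (?l a * (?l m - 1)) (f (a @ [(label_prod (map fst m), x)] @ d))"
    have "?h (pre_lie g h m) = block_sum (\<lambda>b w c. ?h (flip (?l b * (?l w - 1)) (g (b @ [merged h w] @ c)))) m"
      unfolding pre_lie_def
      by (rule block_sum_hom[where h = ?h]) (simp only: slot_additiveD[OF f] flip_add)
    also have "\<dots> = block_sum (\<lambda>b w c. ?in a b w c d) m"
    proof (rule block_sum_cong)
      fix b w c assume m: "b @ w @ c = m" "w \<noteq> []"
      have lp: "label_prod (map fst m) = label_prod (map fst (b @ [merged h w] @ c))"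
        using label_prod_nested[of "map fst w" "map fst b" "map fst c"] m by (auto simp: merged_def)
      have flip: "f (a @ [(x, flip k y)] @ d) = flip k (f (a @ [(x, y)] @ d))" for k x y
        using slot_additiveD[OF f, of a x y "- y" d] slot_additive_0[OF f, of a x d]
        by (auto simp: flip_def minus_unique)
      have "?h (flip (?l b * (?l w - 1)) (g (b @ [merged h w] @ c)))
          = flip (?l a * (?l m - 1) + ?l b * (?l w - 1)) (f (a @ [merged g (b @ [merged h w] @ c)] @ d))"
        unfolding flip flip_flip merged_def[of g] lp ..
      also have "\<dots> = ?in a b w c d"
        using m(1) by (intro flip_cong) (auto simp: algebra_simps)
      finally show "?h (flip (?l b * (?l w - 1)) (g (b @ [merged h w] @ c))) = ?in a b w c d" .
    qed
    finally show "block_sum (\<lambda>b w c. ?in a b w c d) m = flip (?l a * (?l m - 1)) (f (a @ [merged (pre_lie g h) m] @ d))"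
      by (simp add: merged_def)
  qed
  finally show ?thesis by (simp add: add_ac)
qed

lemma insert_two_swap:
  assumes f: "slot_additive f" and g: "concentrated (Suc m) g" and h: "concentrated (Suc n) h"
  shows "block_sum (\<lambda>u w t. block_sum (\<lambda>a b c.
        flip (int (length u) * (int (length w) - 1) + (int (length u) + 1 + int (length a)) * (int (length b) - 1))
          (f (u @ [merged h w] @ a @ [merged g b] @ c))) t) zs
    = flip (int m * int n) (insert_two f h g zs)"
  unfolding insert_two_def block_sum_flip[symmetric]
proof (intro block_sum_cong)
  fix u w t a b c :: "('a \<times> 'b) list"
  consider "length w = Suc n" "length b = Suc m" | "length w \<noteq> Suc n" | "length b \<noteq> Suc m" by blast
  then show "flip (int (length u) * (int (length w) - 1) + (int (length u) + 1 + int (length a)) * (int (length b) - 1))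
          (f (u @ [merged h w] @ a @ [merged g b] @ c))
      = flip (int m * int n) (flip ((int (length u) + int (length w) + int (length a)) * (int (length b) - 1)
          + int (length u) * (int (length w) - 1)) (f (u @ [merged h w] @ a @ [merged g b] @ c)))"
  proof cases
    case 1
    then show ?thesis by (simp only: flip_flip, intro flip_cong) (simp add: algebra_simps)
  next
    case 2
    then have "merged h w = (label_prod (map fst w), 0)" using h by (simp add: merged_def concentrated_def)
    then show ?thesis using slot_additive_0[OF f, of u _ "a @ [merged g b] @ c"] by simp
  next
    case 3
    then have "merged g b = (label_prod (map fst b), 0)" using g by (simp add: merged_def concentrated_def)
    then show ?thesis using slot_additive_0[OF f, of "u @ [merged h w] @ a" _ c] by simp
  qed
qed

definition gerst :: "nat \<Rightarrow> nat \<Rightarrow> (('w::semigroup_mult \<times> 'v) list \<Rightarrow> 'v) \<Rightarrow> (('w \<times> 'v) list \<Rightarrow> 'v) \<Rightarrow>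
    ('w \<times> 'v) list \<Rightarrow> 'v::ab_group_add"
  where "gerst m n f g zs = pre_lie f g zs - flip (int m * int n) (pre_lie g f zs)"

lemma slot_additive_flip:
  assumes "slot_additive f"
  shows "f (us @ [(a, flip k x)] @ ts) = flip k (f (us @ [(a, x)] @ ts))"
  using slot_additiveD[OF assms, of us a x "- x" ts] slot_additive_0[OF assms, of us a ts]
  by (auto simp: flip_def minus_unique)

lemma pre_lie_diff_flip_left:
  "pre_lie (\<lambda>zs. f zs - flip k (f' zs)) g zs = pre_lie f g zs - flip k (pre_lie f' g zs)"
  unfolding pre_lie_def block_sum_flip[symmetric] block_sum_diff[symmetric]
  by (intro block_sum_cong) (simp add: flip_def)

lemma pre_lie_diff_flip_right:
  assumes "slot_additive f"
  shows "pre_lie f (\<lambda>zs. g zs - flip k (g' zs)) zs = pre_lie f g zs - flip k (pre_lie f g' zs)"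
  unfolding pre_lie_def block_sum_flip[symmetric] block_sum_diff[symmetric]
proof (intro block_sum_cong)
  fix u w t :: "('a \<times> 'b) list"
  have "f (u @ [merged (\<lambda>zs. g zs - flip k (g' zs)) w] @ t)
      = f (u @ [merged g w] @ t) - flip k (f (u @ [merged g' w] @ t))"
    using slot_additiveD[OF assms, of u "label_prod (map fst w)" "g w" "flip (k + 1) (g' w)" t]
      slot_additive_flip[OF assms, of u "label_prod (map fst w)" "k + 1" "g' w" t]
    by (simp add: merged_def flip_def split: if_splits)
  then show "flip (int (length u) * (int (length w) - 1)) (f (u @ [merged (\<lambda>zs. g zs - flip k (g' zs)) w] @ t))
      = flip (int (length u) * (int (length w) - 1)) (f (u @ [merged g w] @ t))
        - flip k (flip (int (length u) * (int (length w) - 1)) (f (u @ [merged g' w] @ t)))"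
    by (simp add: flip_def)
qed

lemma pre_lie_assoc_swap:
  assumes f: "slot_additive f" and g: "concentrated (Suc m) g" and h: "concentrated (Suc n) h"
  shows "pre_lie (pre_lie f g) h zs = pre_lie f (pre_lie g h) zs
    + flip (int m * int n) (pre_lie (pre_lie f h) g zs - pre_lie f (pre_lie h g) zs)"
  unfolding pre_lie_assoc[OF f] insert_two_swap[OF f g h] insert_two_swap[OF f h g]
  by (simp add: flip_add mult.commute) (simp add: flip_def)

lemma gerst_jacobi:
  assumes f: "slot_additive f" "concentrated (Suc m) f"
    and g: "slot_additive g" "concentrated (Suc n) g"
    and h: "slot_additive h" "concentrated (Suc p) h"
  shows "gerst (m + n) p (gerst m n f g) h zs = gerst m (n + p) f (gerst n p g h) zs
    + flip (int n * int p) (gerst (m + p) n (gerst m p f h) g zs)"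
  unfolding gerst_def pre_lie_diff_flip_left pre_lie_diff_flip_right[OF f(1)]
    pre_lie_diff_flip_right[OF g(1)] pre_lie_diff_flip_right[OF h(1)]
    pre_lie_assoc_swap[OF f(1) g(2) h(2), of zs] pre_lie_assoc_swap[OF g(1) f(2) h(2), of zs]
    pre_lie_assoc_swap[OF h(1) f(2) g(2), of zs]
  by (cases "even m"; cases "even n"; cases "even p"; simp add: flip_def algebra_simps)

section \<open>The graded Lie algebra of labelled maps\<close>

lemma (in vector_space) scale_minus_one_power: "scale ((-1) ^ k) x = flip (int k) x"
  by (cases "even k") (simp_all add: flip_def)

definition ev :: "('w list \<Rightarrow> 'v list \<Rightarrow> 'v) \<Rightarrow> ('w \<times> 'v) list \<Rightarrow> 'v"
  where "ev f zs = f (map fst zs) (map snd zs)"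

lemma ev_ext:
  assumes "\<And>\<alpha> vs. length \<alpha> \<noteq> length vs \<Longrightarrow> f \<alpha> vs = g \<alpha> vs" and "\<And>zs. ev f zs = ev g zs"
  shows "f = g"
proof (intro ext)
  fix \<alpha> vs
  show "f \<alpha> vs = g \<alpha> vs"
    using assms(1) assms(2)[of "zip \<alpha> vs"] by (cases "length \<alpha> = length vs") (auto simp: ev_def)
qed

lemma block_sum_eq_sum:
  "block_sum f zs = (\<Sum>(i, k) | 1 \<le> k \<and> i + k \<le> length zs.
    f (take i zs) (take k (drop i zs)) (drop k (drop i zs)))"
proof -
  let ?N = "length zs"
  let ?f = "\<lambda>i k. f (take i zs) (take k (drop i zs)) (drop k (drop i zs))"
  have "block_sum f zs = (\<Sum>i\<le>?N. \<Sum>k\<le>?N - i. if take k (drop i zs) = [] then 0 else ?f i k)"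
    by (simp add: block_sum_def split_sum_eq_sum)
  also have "\<dots> = (\<Sum>i\<le>?N. \<Sum>k\<in>{1..?N - i}. ?f i k)"
    by (intro sum.cong refl sum.mono_neutral_cong_right) auto
  also have "\<dots> = (\<Sum>(i, k)\<in>(SIGMA i:{..?N}. {1..?N - i}). ?f i k)"
    by (simp add: sum.Sigma)
  also have "(SIGMA i:{..?N}. {1..?N - i}) = {(i, k). 1 \<le> k \<and> i + k \<le> ?N}" by auto
  finally show ?thesis .
qed

lemma ev_comp_at:
  assumes "i + k \<le> length zs"
  shows "comp_at k (Suc i) f g (map fst zs) (map snd zs)
    = ev f (take i zs @ [merged (ev g) (take k (drop i zs))] @ drop k (drop i zs))"
  using assms by (simp add: comp_at_def ev_def merged_def take_map drop_map Let_def add.commute)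

locale labelled_maps = vector_space scale for scale :: "'k::field \<Rightarrow> 'v::ab_group_add \<Rightarrow> 'v"
begin

lemma bracket_length_neq: "length \<alpha> \<noteq> length vs \<Longrightarrow> bracket scale f g \<alpha> vs = 0"
  by (auto simp: bracket_def bracket_arity_def intro!: sum.neutral)

lemma ev_bracket:
  "ev (bracket scale f g) zs = block_sum (\<lambda>u w t.
    flip (int (length u) * (int (length w) - 1)) (ev f (u @ [merged (ev g) w] @ t))
    - flip ((int (length w) - 1) * int (length t)) (ev g (u @ [merged (ev f) w] @ t))) zs"
proof -
  let ?N = "length zs" and ?\<alpha> = "map fst zs" and ?vs = "map snd zs"
  let ?I = "{(m, n). m \<ge> 1 \<and> n \<ge> 1 \<and> m + n = ?N + 1}"
  let ?J = "{(i, k). 1 \<le> k \<and> i + k \<le> ?N}"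
  let ?a = "\<lambda>i k. flip (int i * (int k - 1))
      (ev f (take i zs @ [merged (ev g) (take k (drop i zs))] @ drop k (drop i zs)))"
    and ?b = "\<lambda>i k. flip ((int k - 1) * (int ?N - int i - int k))
      (ev g (take i zs @ [merged (ev f) (take k (drop i zs))] @ drop k (drop i zs)))"
  have fin: "finite ?I" by (rule finite_subset[of _ "{..?N + 1} \<times> {..?N + 1}"]) auto
  have a: "(\<Sum>(m, n)\<in>?I. \<Sum>i=1..m. scale ((-1) ^ ((i - 1) * (n - 1))) (comp_at n i f g ?\<alpha> ?vs))
      = (\<Sum>(i, k)\<in>?J. ?a i k)"
  proof -
    have "(\<Sum>(m, n)\<in>?I. \<Sum>i=1..m. scale ((-1) ^ ((i - 1) * (n - 1))) (comp_at n i f g ?\<alpha> ?vs))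
      = (\<Sum>((m, n), i)\<in>(SIGMA (m, n):?I. {1..m}). scale ((-1) ^ ((i - 1) * (n - 1))) (comp_at n i f g ?\<alpha> ?vs))"
      using fin by (subst sum.Sigma[symmetric]) (auto simp: case_prod_beta)
    also have "\<dots> = (\<Sum>(i, k)\<in>?J. ?a i k)"
    proof (rule sum.reindex_bij_witness[where i = "\<lambda>(i, k). ((?N + 1 - k, k), i + 1)"
          and j = "\<lambda>((m, n), i). (i - 1, n)"], goal_cases)
      case (5 x)
      then obtain m n i where x: "x = ((m, n), Suc i)" and "1 \<le> n" "m + n = ?N + 1" "Suc i \<le> m"
        by (cases x; cases "snd x") auto
      then have le: "i + n \<le> ?N" "1 \<le> n" by auto
      show ?case unfolding x using ev_comp_at[OF le(1), of f g] le(2)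
        by (simp add: scale_minus_one_power of_nat_diff)
    qed auto
    finally show ?thesis .
  qed
  have b: "(\<Sum>(m, n)\<in>?I. scale ((-1) ^ ((m - 1) * (n - 1)))
        (\<Sum>i=1..n. scale ((-1) ^ ((i - 1) * (m - 1))) (comp_at m i g f ?\<alpha> ?vs)))
      = (\<Sum>(i, k)\<in>?J. ?b i k)"
  proof -
    have "(\<Sum>(m, n)\<in>?I. scale ((-1) ^ ((m - 1) * (n - 1)))
        (\<Sum>i=1..n. scale ((-1) ^ ((i - 1) * (m - 1))) (comp_at m i g f ?\<alpha> ?vs)))
      = (\<Sum>((m, n), i)\<in>(SIGMA (m, n):?I. {1..n}). scale ((-1) ^ ((m - 1) * (n - 1)))
          (scale ((-1) ^ ((i - 1) * (m - 1))) (comp_at m i g f ?\<alpha> ?vs)))"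
      using fin by (subst sum.Sigma[symmetric]) (auto simp: case_prod_beta scale_sum_right)
    also have "\<dots> = (\<Sum>(i, k)\<in>?J. ?b i k)"
    proof (rule sum.reindex_bij_witness[where i = "\<lambda>(i, k). ((k, ?N + 1 - k), i + 1)"
          and j = "\<lambda>((m, n), i). (i - 1, m)"], goal_cases)
      case (5 x)
      then obtain m n i where x: "x = ((m, n), Suc i)" and *: "1 \<le> m" "m + n = ?N + 1" "Suc i \<le> n"
        by (cases x; cases "snd x") auto
      then have le: "i + m \<le> ?N" "1 \<le> m" "int n = int ?N + 1 - int m" "1 \<le> n" by auto
      have "flip ((int m - 1) * (int ?N - int i - int m)) y
          = flip ((int m - 1) * (int n - 1) + int i * (int m - 1)) y" for y :: 'v
        by (intro flip_cong) (simp add: le(3) algebra_simps)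
      then show ?case unfolding x using ev_comp_at[OF le(1), of g f] le
        by (simp only: prod.case scale_minus_one_power flip_flip)
          (simp add: of_nat_diff)
    qed auto
    finally show ?thesis .
  qed
  have "ev (bracket scale f g) zs = (\<Sum>(m, n)\<in>?I.
      (\<Sum>i=1..m. scale ((-1) ^ ((i - 1) * (n - 1))) (comp_at n i f g ?\<alpha> ?vs))
      - scale ((-1) ^ ((m - 1) * (n - 1)))
        (\<Sum>i=1..n. scale ((-1) ^ ((i - 1) * (m - 1))) (comp_at m i g f ?\<alpha> ?vs)))"
    unfolding ev_def bracket_def length_map by (intro sum.cong) (auto simp: bracket_arity_def)
  also have "\<dots> = (\<Sum>(i, k)\<in>?J. ?a i k) - (\<Sum>(i, k)\<in>?J. ?b i k)"
    unfolding a[symmetric] b[symmetric] by (simp add: case_prod_beta sum_subtractf)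
  also have "\<dots> = block_sum (\<lambda>u w t.
    flip (int (length u) * (int (length w) - 1)) (ev f (u @ [merged (ev g) w] @ t))
    - flip ((int (length w) - 1) * int (length t)) (ev g (u @ [merged (ev f) w] @ t))) zs"
    unfolding block_sum_eq_sum sum_subtractf[symmetric]
  proof (intro sum.cong refl, clarify)
    fix i k assume "1 \<le> k" "i + k \<le> ?N"
    then have "length (take i zs) = i" "length (take k (drop i zs)) = k"
      "int (length (drop k (drop i zs))) = int ?N - int i - int k" by auto
    then show "?a i k - ?b i k =
      flip (int (length (take i zs)) * (int (length (take k (drop i zs))) - 1))
        (ev f (take i zs @ [merged (ev g) (take k (drop i zs))] @ drop k (drop i zs)))
      - flip ((int (length (take k (drop i zs))) - 1) * int (length (drop k (drop i zs))))
        (ev g (take i zs @ [merged (ev f) (take k (drop i zs))] @ drop k (drop i zs)))"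
      by (simp only:)
  qed
  finally show ?thesis .
qed

definition lin :: "('v \<Rightarrow> 'v) \<Rightarrow> bool"
  where "lin \<phi> \<longleftrightarrow> (\<forall>x y. \<phi> (x + y) = \<phi> x + \<phi> y) \<and> (\<forall>c x. \<phi> (scale c x) = scale c (\<phi> x))"

lemma lin_add: "lin \<phi> \<Longrightarrow> lin \<psi> \<Longrightarrow> lin (\<lambda>x. \<phi> x + \<psi> x)"
  by (simp add: lin_def scale_right_distrib algebra_simps)

lemma lin_diff: "lin \<phi> \<Longrightarrow> lin \<psi> \<Longrightarrow> lin (\<lambda>x. \<phi> x - \<psi> x)"
  by (simp add: lin_def scale_right_diff_distrib algebra_simps)

lemma lin_0: "lin (\<lambda>x. 0)"
  by (simp add: lin_def)

lemma lin_flip: "lin \<phi> \<Longrightarrow> lin (\<lambda>x. flip k (\<phi> x))"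
  by (simp add: lin_def flip_def)

lemma lin_compose: "lin \<phi> \<Longrightarrow> lin \<psi> \<Longrightarrow> lin (\<lambda>x. \<phi> (\<psi> x))"
  by (simp add: lin_def)

lemma lin_split_sum:
  "(\<And>u t. lin (\<phi> u t)) \<Longrightarrow> lin (\<lambda>x. split_sum (\<lambda>u t. \<phi> u t x) zs)"
  by (induction zs arbitrary: \<phi>) (auto intro: lin_add)

lemma lin_block_sum:
  assumes "\<And>u w t. lin (\<phi> u w t)"
  shows "lin (\<lambda>x. block_sum (\<lambda>u w t. \<phi> u w t x) zs)"
  unfolding block_sum_def
proof (intro lin_split_sum)
  fix u w t show "lin (\<lambda>x. if w = [] then 0 else \<phi> u w t x)" by (cases "w = []") (auto simp: lin_0 assms)
qed

definition slot_linear :: "('w list \<Rightarrow> 'v list \<Rightarrow> 'v) \<Rightarrow> bool"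
  where "slot_linear f \<longleftrightarrow> (\<forall>us a ts. lin (\<lambda>x. ev f (us @ [(a, x)] @ ts)))"

lemma slot_linearD: "slot_linear f \<Longrightarrow> lin (\<lambda>x. ev f (us @ [(a, x)] @ ts))"
  by (simp add: slot_linear_def)

lemma slot_linear_imp_additive: "slot_linear f \<Longrightarrow> slot_additive (ev f)"
  by (simp add: slot_linear_def slot_additive_def lin_def)

lemma slot_linear_bracket:
  fixes f g :: "'w::semigroup_mult list \<Rightarrow> 'v list \<Rightarrow> 'v"
  assumes f: "slot_linear f" and g: "slot_linear g"
  shows "slot_linear (bracket scale f g)"
  unfolding slot_linear_def
proof (intro allI)
  fix us a and ts :: "('w \<times> 'v) list"
  have *: "lin (\<lambda>x. ev f (u @ [m] @ c @ [(a, x)] @ ts))" "lin (\<lambda>x. ev f ((us @ [(a, x)] @ u) @ [m] @ c))"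
    if "slot_linear f" for f :: "'w list \<Rightarrow> 'v list \<Rightarrow> 'v" and u m c
    using slot_linearD[OF that, of "u @ [m] @ c" a ts] slot_linearD[OF that, of us a "u @ [m] @ c"] by simp_all
  have **: "lin (\<lambda>x. ev f (u @ [merged (ev g) (b @ [(a, x)] @ c)] @ d))"
    if "slot_linear f" "slot_linear g" for f g :: "'w list \<Rightarrow> 'v list \<Rightarrow> 'v" and u b c d
    using lin_compose[OF slot_linearD[OF that(1), of u "label_prod (map fst b @ [a] @ map fst c)" d]
        slot_linearD[OF that(2), of b a c]] by (simp add: merged_def)
  show "lin (\<lambda>x. ev (bracket scale f g) (us @ [(a, x)] @ ts))"
    unfolding ev_bracket block_sum_middle length_append list.size fst_conv
    by (intro lin_add lin_block_sum lin_split_sum lin_diff lin_flip) (rule * ** f g)+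
qed

lemma ev_plus: "ev (f + g) zs = ev f zs + ev g zs"
  by (simp add: ev_def)

lemma ev_scale: "ev (scale_fun (scale_fun scale) c f) zs = scale c (ev f zs)"
  by (simp add: ev_def scale_fun_def)

lemma scale_fun_fun_apply: "scale_fun (scale_fun scale) c f \<alpha> vs = scale c (f \<alpha> vs)"
  by (simp add: scale_fun_def)

lemma ev_merged_add:
  "slot_linear f \<Longrightarrow> ev f (u @ [merged (ev (g + g')) w] @ t)
    = ev f (u @ [merged (ev g) w] @ t) + ev f (u @ [merged (ev g') w] @ t)"
  using slot_additiveD[OF slot_linear_imp_additive, of f u "label_prod (map fst w)" "ev g w" "ev g' w" t]
  by (simp add: merged_def ev_plus)

lemma ev_merged_scale:
  "slot_linear f \<Longrightarrow> ev f (u @ [merged (ev (scale_fun (scale_fun scale) c g)) w] @ t)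
    = scale c (ev f (u @ [merged (ev g) w] @ t))"
  using slot_linearD[of f u "label_prod (map fst w)" t] by (simp add: merged_def ev_scale lin_def)

lemma flip_scale: "flip k (scale c x) = scale c (flip k x)"
  by (simp add: flip_def)

lemma bracket_add_left:
  assumes "slot_linear g"
  shows "bracket scale (f + f') g = bracket scale f g + bracket scale f' g"
proof (rule ev_ext)
  fix zs :: "('a \<times> 'v) list"
  show "ev (bracket scale (f + f') g) zs = ev (bracket scale f g + bracket scale f' g) zs"
    unfolding ev_plus[of "bracket scale f g"] ev_bracket block_sum_add[symmetric]
    by (intro block_sum_cong) (simp add: ev_plus ev_merged_add assms flip_add del: append_Cons append_Nil)
qed (simp add: bracket_length_neq)

lemma bracket_add_right:
  assumes "slot_linear f"
  shows "bracket scale f (g + g') = bracket scale f g + bracket scale f g'"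
proof (rule ev_ext)
  fix zs :: "('a \<times> 'v) list"
  show "ev (bracket scale f (g + g')) zs = ev (bracket scale f g + bracket scale f g') zs"
    unfolding ev_plus[of "bracket scale f g"] ev_bracket block_sum_add[symmetric]
    by (intro block_sum_cong) (simp add: ev_plus ev_merged_add assms flip_add del: append_Cons append_Nil)
qed (simp add: bracket_length_neq)

lemma bracket_scale_left:
  assumes "slot_linear g"
  shows "bracket scale (scale_fun (scale_fun scale) c f) g = scale_fun (scale_fun scale) c (bracket scale f g)"
proof (rule ev_ext)
  fix zs :: "('a \<times> 'v) list"
  show "ev (bracket scale (scale_fun (scale_fun scale) c f) g) zs = ev (scale_fun (scale_fun scale) c (bracket scale f g)) zs"
    unfolding ev_scale[of c "bracket scale f g"] ev_bracket
      block_sum_hom[of "scale c", OF scale_right_distrib]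
    by (intro block_sum_cong)
      (simp add: ev_scale ev_merged_scale assms flip_scale scale_right_diff_distrib del: append_Cons append_Nil)
qed (simp add: bracket_length_neq scale_fun_def)

lemma bracket_scale_right:
  assumes "slot_linear f"
  shows "bracket scale f (scale_fun (scale_fun scale) c g) = scale_fun (scale_fun scale) c (bracket scale f g)"
proof (rule ev_ext)
  fix zs :: "('a \<times> 'v) list"
  show "ev (bracket scale f (scale_fun (scale_fun scale) c g)) zs = ev (scale_fun (scale_fun scale) c (bracket scale f g)) zs"
    unfolding ev_scale[of c "bracket scale f g"] ev_bracket
      block_sum_hom[of "scale c", OF scale_right_distrib]
    by (intro block_sum_cong)
      (simp add: ev_scale ev_merged_scale assms flip_scale scale_right_diff_distrib del: append_Cons append_Nil)
qed (simp add: bracket_length_neq scale_fun_def)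

definition Hom_total :: "('w list \<Rightarrow> 'v list \<Rightarrow> 'v) set"
  where "Hom_total = {f. slot_linear f \<and> (\<forall>\<alpha> vs. length \<alpha> \<noteq> length vs \<or> \<alpha> = [] \<longrightarrow> f \<alpha> vs = 0)}"

definition Hom_degree :: "int \<Rightarrow> ('w list \<Rightarrow> 'v list \<Rightarrow> 'v) set"
  where "Hom_degree n = {f \<in> Hom_total. \<forall>\<alpha> vs. int (length \<alpha>) \<noteq> n + 1 \<longrightarrow> f \<alpha> vs = 0}"

lemma Hom_degree_total: "f \<in> Hom_degree n \<Longrightarrow> f \<in> Hom_total"
  by (simp add: Hom_degree_def)

lemma Hom_total_slot_linear: "f \<in> Hom_total \<Longrightarrow> slot_linear f"
  by (simp add: Hom_total_def)

lemma Hom_degree_slot_linear: "f \<in> Hom_degree n \<Longrightarrow> slot_linear f"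
  by (simp add: Hom_degree_def Hom_total_def)

lemma Hom_total_add: "f \<in> Hom_total \<Longrightarrow> g \<in> Hom_total \<Longrightarrow> f + g \<in> Hom_total"
  by (auto simp: Hom_total_def slot_linear_def ev_plus intro: lin_add)

lemma Hom_total_scale: "f \<in> Hom_total \<Longrightarrow> scale_fun (scale_fun scale) c f \<in> Hom_total"
  by (auto simp: Hom_total_def slot_linear_def ev_scale scale_fun_fun_apply lin_def scale_right_distrib scale_left_commute)

lemma Hom_total_0: "0 \<in> Hom_total"
  by (auto simp: Hom_total_def slot_linear_def ev_def lin_0)

lemma Hom_degree_add: "f \<in> Hom_degree n \<Longrightarrow> g \<in> Hom_degree n \<Longrightarrow> f + g \<in> Hom_degree n"
  by (auto simp: Hom_degree_def Hom_total_add)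

lemma Hom_degree_scale: "f \<in> Hom_degree n \<Longrightarrow> scale_fun (scale_fun scale) c f \<in> Hom_degree n"
  by (simp add: Hom_degree_def Hom_total_scale scale_fun_fun_apply)

lemma Hom_degree_0: "0 \<in> Hom_degree n"
  by (simp add: Hom_degree_def Hom_total_0)

lemma Hom_degree_minus: "f \<in> Hom_degree n \<Longrightarrow> - f \<in> Hom_degree n"
proof -
  have "scale_fun (scale_fun scale) (-1) f = - f" by (simp add: scale_fun_def fun_eq_iff)
  then show "f \<in> Hom_degree n \<Longrightarrow> - f \<in> Hom_degree n" using Hom_degree_scale[of f n "-1"] by simp
qed

lemma Hom_degree_negative: "n < 0 \<Longrightarrow> f \<in> Hom_degree n \<Longrightarrow> f = 0"
proof (intro ext)
  fix \<alpha> vs assume "n < 0" "f \<in> Hom_degree n"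
  then show "f \<alpha> vs = 0 \<alpha> vs"
    by (cases "\<alpha> = []") (auto simp: Hom_degree_def Hom_total_def neq_Nil_conv)
qed

lemma Hom_degree_nonneg_or_0: "f \<in> Hom_degree n \<Longrightarrow> (\<exists>k. n = int k) \<or> f = 0"
  using Hom_degree_negative by (metis nonneg_int_cases not_less)

lemma concentrated_ev: "f \<in> Hom_degree (int n) \<Longrightarrow> concentrated (Suc n) (ev f)"
  by (auto simp: Hom_degree_def concentrated_def ev_def)

lemma bracket_in_Hom_total:
  assumes "f \<in> Hom_total" "g \<in> Hom_total"
  shows "bracket scale f g \<in> Hom_total"
proof -
  have "bracket scale f g [] vs = 0" for vs
    using ev_bracket[of f g "[]"] bracket_length_neq[of "[]" vs f g]
    by (cases "vs = []") (auto simp: ev_def)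
  then show ?thesis
    using assms by (auto simp: Hom_total_def slot_linear_bracket bracket_length_neq)
qed

lemma bracket_0_left: "g \<in> Hom_total \<Longrightarrow> bracket scale 0 g = 0"
  using bracket_add_left[of g 0 0] by (simp add: Hom_total_slot_linear)

lemma bracket_0_right: "g \<in> Hom_total \<Longrightarrow> bracket scale g 0 = 0"
  using bracket_add_right[of g 0 0] by (simp add: Hom_total_slot_linear)

lemma bracket_in_Hom_degree:
  assumes f: "f \<in> Hom_degree m" and g: "g \<in> Hom_degree n"
  shows "bracket scale f g \<in> Hom_degree (m + n)"
proof -
  have zero: "ev f (u @ [merged (ev g) w] @ t) = 0"
    if "f \<in> Hom_degree m" "g \<in> Hom_degree n" "int (length (u @ w @ t)) \<noteq> m + n + 1" for f g m n u w t
  proof (cases "int (length w) = n + 1")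
    case True
    then show ?thesis using that by (auto simp: Hom_degree_def ev_def)
  next
    case False
    then have "merged (ev g) w = (label_prod (map fst w), 0)"
      using that by (auto simp: Hom_degree_def ev_def merged_def)
    then show ?thesis
      using slot_additive_0[OF slot_linear_imp_additive[OF Hom_degree_slot_linear[OF that(1)]]] by simp
  qed
  have "bracket scale f g \<alpha> vs = 0" if "int (length \<alpha>) \<noteq> m + n + 1" for \<alpha> vs
  proof (cases "length \<alpha> = length vs")
    case True
    have "ev (bracket scale f g) (zip \<alpha> vs) = block_sum (\<lambda>u w t. 0) (zip \<alpha> vs)"
      unfolding ev_bracket
    proof (intro block_sum_cong)
      fix u w t assume "u @ w @ t = zip \<alpha> vs"
      then have "int (length (u @ w @ t)) \<noteq> m + n + 1" using that True by simp
      then show "flip (int (length u) * (int (length w) - 1)) (ev f (u @ [merged (ev g) w] @ t))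
          - flip ((int (length w) - 1) * int (length t)) (ev g (u @ [merged (ev f) w] @ t)) = 0"
        using zero[OF f g, of u w t] zero[OF g f, of u w t] by (simp add: add_ac)
    qed
    then show ?thesis using True by (simp add: ev_def)
  qed (simp add: bracket_length_neq)
  then show ?thesis
    using bracket_in_Hom_total f g by (auto simp: Hom_degree_def)
qed

lemma ev_bracket_degree:
  assumes f: "f \<in> Hom_degree (int m)" and g: "g \<in> Hom_degree (int n)"
  shows "ev (bracket scale f g) = gerst m n (ev f) (ev g)"
proof
  fix zs :: "('a \<times> 'v) list"
  show "ev (bracket scale f g) zs = gerst m n (ev f) (ev g) zs"
    unfolding ev_bracket gerst_def pre_lie_def block_sum_flip[symmetric] block_sum_diff[symmetric]
  proof (intro block_sum_cong arg_cong2[where f = minus] refl)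
    fix u w t :: "('a \<times> 'v) list"
    consider "length w = Suc m" "Suc (length u + length t) = Suc n" | "length w \<noteq> Suc m"
      | "Suc (length u + length t) \<noteq> Suc n" by blast
    then show "flip ((int (length w) - 1) * int (length t)) (ev g (u @ [merged (ev f) w] @ t))
        = flip (int m * int n) (flip (int (length u) * (int (length w) - 1)) (ev g (u @ [merged (ev f) w] @ t)))"
    proof cases
      case 1
      then have "int n = int (length u) + int (length t)" by simp
      then show ?thesis using 1(1) by (simp only: flip_flip, intro flip_cong) (simp add: algebra_simps)
    next
      case 2
      then have "merged (ev f) w = (label_prod (map fst w), 0)"
        using concentrated_ev[OF f] by (simp add: merged_def concentrated_def)
      then show ?thesis
        using slot_additive_0[OF slot_linear_imp_additive[OF Hom_degree_slot_linear[OF g]]] by simp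
    next
      case 3
      then have "ev g (u @ [merged (ev f) w] @ t) = 0"
        using concentrated_ev[OF g] by (simp add: concentrated_def)
      then show ?thesis by simp
    qed
  qed
qed

lemma flip_fun_apply: "flip k f x = flip k (f x)"
  by (simp add: flip_def)

lemma ev_flip: "ev (flip k f) zs = flip k (ev f zs)"
  by (simp add: ev_def flip_fun_apply)

lemma bracket_commute:
  assumes f: "f \<in> Hom_degree m" and g: "g \<in> Hom_degree n"
  shows "bracket scale f g = flip (m * n + 1) (bracket scale g f)"
proof -
  consider "f = 0" | "g = 0" | m' n' where "m = int m'" "n = int n'"
    using Hom_degree_nonneg_or_0[OF f] Hom_degree_nonneg_or_0[OF g] by blast
  then show ?thesis
  proof cases
    case 1
    then show ?thesis using Hom_degree_total[OF g] by (simp add: bracket_0_left bracket_0_right)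
  next
    case 2
    then show ?thesis using Hom_degree_total[OF f] by (simp add: bracket_0_left bracket_0_right)
  next
    case 3
    show ?thesis
    proof (rule ev_ext)
      fix zs :: "('a \<times> 'v) list"
      show "ev (bracket scale f g) zs = ev (flip (m * n + 1) (bracket scale g f)) zs"
        using f g ev_bracket_degree[of f m' g n'] ev_bracket_degree[of g n' f m'] 3
        by (simp only: ev_flip gerst_def mult.commute[of "int n'"]) (simp add: flip_def)
    qed (simp add: bracket_length_neq flip_fun_apply)
  qed
qed

lemma bracket_jacobi:
  assumes f: "f \<in> Hom_degree m" and g: "g \<in> Hom_degree n" and h: "h \<in> Hom_degree k"
  shows "bracket scale (bracket scale f g) h = bracket scale f (bracket scale g h)
    + flip (n * k) (bracket scale (bracket scale f h) g)"
proof -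
  note total = Hom_degree_total[OF f] Hom_degree_total[OF g] Hom_degree_total[OF h]
  consider "f = 0" | "g = 0" | "h = 0" | m' n' k' where "m = int m'" "n = int n'" "k = int k'"
    using Hom_degree_nonneg_or_0[OF f] Hom_degree_nonneg_or_0[OF g] Hom_degree_nonneg_or_0[OF h] by blast
  then show ?thesis
  proof cases
    case 4
    have *: "f \<in> Hom_degree (int m')" "g \<in> Hom_degree (int n')" "h \<in> Hom_degree (int k')"
      using f g h 4 by auto
    have **: "bracket scale f g \<in> Hom_degree (int (m' + n'))" "bracket scale f h \<in> Hom_degree (int (m' + k'))"
      "bracket scale g h \<in> Hom_degree (int (n' + k'))"
      using bracket_in_Hom_degree[OF *(1,2)] bracket_in_Hom_degree[OF *(1,3)] bracket_in_Hom_degree[OF *(2,3)]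
      by simp_all
    show ?thesis
    proof (rule ev_ext)
      fix zs :: "('a \<times> 'v) list"
      show "ev (bracket scale (bracket scale f g) h) zs = ev (bracket scale f (bracket scale g h)
          + flip (n * k) (bracket scale (bracket scale f h) g)) zs"
        unfolding ev_plus ev_flip ev_bracket_degree[OF **(1) *(3)] ev_bracket_degree[OF *(1) **(3)]
          ev_bracket_degree[OF **(2) *(2)] ev_bracket_degree[OF *(1,2)] ev_bracket_degree[OF *(1,3)]
          ev_bracket_degree[OF *(2,3)] 4
        using * by (intro gerst_jacobi slot_linear_imp_additive Hom_degree_slot_linear concentrated_ev)
    qed (simp add: bracket_length_neq flip_fun_apply)
  qed (use total in \<open>simp_all add: bracket_0_left bracket_0_right bracket_in_Hom_total\<close>)
qed

end

section \<open>Multilinear maps from moving an argument to the front\<close>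

definition linear_on :: "('k \<Rightarrow> 'u \<Rightarrow> 'u) \<Rightarrow> ('k \<Rightarrow> 'v \<Rightarrow> 'v) \<Rightarrow> 'u set \<Rightarrow>
    ('u::ab_group_add \<Rightarrow> 'v::ab_group_add) \<Rightarrow> bool"
  where "linear_on s1 s2 W \<phi> \<longleftrightarrow> (\<forall>x\<in>W. \<forall>y\<in>W. \<phi> (x + y) = \<phi> x + \<phi> y) \<and>
    (\<forall>c. \<forall>x\<in>W. \<phi> (s1 c x) = s2 c (\<phi> x))"

lemma multilinear_on_iff:
  "multilinear_on s1 s2 W n f \<longleftrightarrow>
    (\<forall>xs i. length xs = n \<and> set xs \<subseteq> W \<and> i < n \<longrightarrow> linear_on s1 s2 W (\<lambda>x. f (xs[i := x])))"
  unfolding multilinear_on_def linear_on_def by blast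

lemma multilinear_on_mono:
  assumes "multilinear_on s1 s2 W n f" "V \<subseteq> W"
  shows "multilinear_on s1 s2 V n f"
  unfolding multilinear_on_iff
proof (intro allI impI)
  fix xs i assume "length xs = n \<and> set xs \<subseteq> V \<and> i < n"
  then have "linear_on s1 s2 W (\<lambda>x. f (xs[i := x]))"
    using assms unfolding multilinear_on_iff by blast
  then show "linear_on s1 s2 V (\<lambda>x. f (xs[i := x]))"
    using assms(2) unfolding linear_on_def by blast
qed

lemma linear_on_add:
  assumes "module s2" "linear_on s1 s2 W \<phi>" "linear_on s1 s2 W \<psi>"
  shows "linear_on s1 s2 W (\<lambda>x. \<phi> x + \<psi> x)"
proof -
  interpret module s2 by fact
  show ?thesis using assms(2,3) by (simp add: linear_on_def scale_right_distrib algebra_simps)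
qed

text \<open>
  The sum over all elements of a list of \<open>K\<close> applied to the list with that element moved to the front,
  where \<open>T\<close> is applied to the elements that it is moved past.
\<close>

fun move_sum :: "('x \<Rightarrow> 'x) \<Rightarrow> ('x list \<Rightarrow> 'v) \<Rightarrow> 'x list \<Rightarrow> 'v::ab_group_add" where
  "move_sum T K [] = 0"
| "move_sum T K (z # zs) = K (z # zs) + move_sum T (\<lambda>ys. K (hd ys # T z # tl ys)) zs"

lemma move_sum_eq_0:
  assumes "\<And>x. x \<in> W \<Longrightarrow> T x \<in> W" "set xs \<subseteq> W"
    and "\<And>y ys. y \<in> set xs \<Longrightarrow> set ys \<subseteq> W \<Longrightarrow> K (y # ys) = 0"
  shows "move_sum T K xs = 0"
  using assms(2,3)
proof (induction xs arbitrary: K)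
  case (Cons z zs)
  have "move_sum T (\<lambda>ys. K (hd ys # T z # tl ys)) zs = 0"
    by (rule Cons.IH) (use Cons.prems assms(1) in auto)
  then show ?case using Cons.prems by simp
qed simp

lemma linear_on_move_sum:
  assumes T: "\<And>x. x \<in> W \<Longrightarrow> T x \<in> W" and zs: "set zs \<subseteq> W"
    and "module s2" and "\<And>ys. length ys = length zs \<Longrightarrow> set ys \<subseteq> W \<Longrightarrow> linear_on s1 s2 W (\<lambda>x. \<kappa> x ys)"
  shows "linear_on s1 s2 W (\<lambda>x. move_sum T (\<kappa> x) zs)"
  using assms(4) zs
proof (induction zs arbitrary: \<kappa>)
  case Nil
  interpret module s2 by fact
  show ?case by (simp add: linear_on_def)
next
  case (Cons z zs)
  interpret module s2 by fact
  have 1: "linear_on s1 s2 W (\<lambda>x. \<kappa> x (z # zs))" using Cons.prems by auto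
  have 2: "linear_on s1 s2 W (\<lambda>x. move_sum T (\<lambda>ys. \<kappa> x (hd ys # T z # tl ys)) zs)"
  proof (cases "zs = []")
    case True
    then show ?thesis by (simp add: linear_on_def)
  next
    case False
    show ?thesis
    proof (rule Cons.IH)
      fix ys assume ys: "length ys = length zs" "set ys \<subseteq> W"
      then have "set (hd ys # T z # tl ys) \<subseteq> W" "length (hd ys # T z # tl ys) = Suc (length zs)"
        using Cons.prems(2) T False by (cases ys; auto)+
      then show "linear_on s1 s2 W (\<lambda>x. \<kappa> x (hd ys # T z # tl ys))" using Cons.prems(1) by simp
    qed (use Cons.prems in auto)
  qed
  show ?case using linear_on_add[OF \<open>module s2\<close> 1 2] by simp
qed

lemma multilinear_on_move_sum:
  assumes T: "\<And>x. x \<in> W \<Longrightarrow> T x \<in> W" "linear_on s1 s1 W T" and s2: "module s2"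
    and "multilinear_on s1 s2 W n K"
  shows "multilinear_on s1 s2 W n (move_sum T K)"
  using assms(4)
proof (induction n arbitrary: K)
  case 0
  then show ?case by (simp add: multilinear_on_def)
next
  case (Suc n)
  interpret module s2 by fact
  have K: "linear_on s1 s2 W (\<lambda>x. K (xs[i := x]))" if "length xs = Suc n" "set xs \<subseteq> W" "i < Suc n" for xs i
    using Suc.prems that unfolding multilinear_on_iff by blast
  show ?case unfolding multilinear_on_iff
  proof (intro allI impI)
    fix xs i assume "length xs = Suc n \<and> set xs \<subseteq> W \<and> i < Suc n"
    then obtain z zs where xs: "xs = z # zs" "length zs = n" "set zs \<subseteq> W" "z \<in> W" "i < Suc n"
      by (cases xs) auto
    show "linear_on s1 s2 W (\<lambda>x. move_sum T K (xs[i := x]))"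
    proof (cases i)
      case 0
      have 1: "linear_on s1 s2 W (\<lambda>x. K (x # zs))" using K[of xs 0] xs by simp
      have 2: "linear_on s1 s2 W (\<lambda>x. move_sum T (\<lambda>ys. K (hd ys # T x # tl ys)) zs)"
      proof (cases "zs = []")
        case True
        then show ?thesis by (simp add: linear_on_def)
      next
        case False
        show ?thesis
        proof (rule linear_on_move_sum[OF T(1) xs(3) s2])
          fix ys assume "length ys = length zs" "set ys \<subseteq> W"
          then obtain y ts where ys: "ys = y # ts" "length ts = n - 1" "y \<in> W" "set ts \<subseteq> W" "n > 0"
            using False xs(2) by (cases ys) auto
          have "linear_on s1 s2 W (\<lambda>x. K ((y # y # ts)[1 := x]))" by (rule K) (use ys in auto)
          then show "linear_on s1 s2 W (\<lambda>x. K (hd ys # T x # tl ys))"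
            using T ys by (simp add: linear_on_def)
        qed
      qed
      show ?thesis using linear_on_add[OF s2 1 2] 0 xs by simp
    next
      case (Suc j)
      have "multilinear_on s1 s2 W n (\<lambda>ys. K (hd ys # T z # tl ys))"
        unfolding multilinear_on_iff
      proof (intro allI impI)
        fix ys i assume *: "length ys = n \<and> set ys \<subseteq> W \<and> i < n"
        then obtain y ts where ys: "ys = y # ts" by (cases ys) auto
        have "linear_on s1 s2 W (\<lambda>x. K ((y # T z # ts)[(if i = 0 then 0 else Suc i) := x]))"
          by (rule K) (use * ys xs T in auto)
        then show "linear_on s1 s2 W (\<lambda>x. K (hd (ys[i := x]) # T z # tl (ys[i := x])))"
          by (cases i) (simp_all add: ys)
      qed
      from Suc.IH[OF this] have 1: "linear_on s1 s2 W (\<lambda>x. move_sum T (\<lambda>ys. K (hd ys # T z # tl ys)) (zs[j := x]))"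
        using xs Suc unfolding multilinear_on_iff by auto
      have 2: "linear_on s1 s2 W (\<lambda>x. K (z # zs[j := x]))" using K[of xs i] xs Suc by simp
      show ?thesis using linear_on_add[OF s2 2 1] Suc xs by simp
    qed
  qed
qed

lemma unshuffle_sum_single_Cons:
  "unshuffle_sum (z # zs) (\<lambda>S T. if length S = 1 then \<phi> (hd S) T else 0) = \<phi> z zs
    + unshuffle_sum zs (\<lambda>S T. if length S = 1 then flip (fst z * fst (hd S)) (\<phi> (hd S) (z # T)) else 0)"
proof -
  have "unshuffle_sum zs (\<lambda>S T. if length (z # S) = 1 then \<phi> (hd (z # S)) T else 0)
      = unshuffle_sum zs (\<lambda>S T. if S = [] then \<phi> z T else 0)"
    by (rule unshuffle_sum_cong) auto
  moreover have "unshuffle_sum zs (\<lambda>S T. flip (fst z * deg S) (if length S = 1 then \<phi> (hd S) (z # T) else 0))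
      = unshuffle_sum zs (\<lambda>S T. if length S = 1 then flip (fst z * fst (hd S)) (\<phi> (hd S) (z # T)) else 0)"
    by (rule unshuffle_sum_cong) (auto simp: length_Suc_conv)
  ultimately show ?thesis by (simp add: unshuffle_sum_left_empty)
qed

text \<open>For letters whose parity is known, the Koszul sign of moving one to the front becomes a linear map \<open>T\<close>.\<close>

lemma move_sum_eq_unshuffle_sum:
  assumes T: "\<And>d x. (d, x) \<in> X \<Longrightarrow> (d, T x) \<in> X"
    and "set zs \<subseteq> X"
    and "\<And>y us. set (y # us) \<subseteq> X \<Longrightarrow> K (map snd (y # us)) = \<phi> y us"
    and "\<And>y us d x ts. set (y # us @ (d, x) # ts) \<subseteq> X \<Longrightarrow>
      \<phi> y (us @ (d, T x) # ts) = flip (d * fst y) (\<phi> y (us @ (d, x) # ts))"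
  shows "move_sum T K (map snd zs) = unshuffle_sum zs (\<lambda>S T. if length S = 1 then \<phi> (hd S) T else 0)"
  using assms(2-4)
proof (induction zs arbitrary: K \<phi>)
  case Nil
  then show ?case by simp
next
  case (Cons z zs)
  obtain d x where z: "z = (d, x)" by force
  have Tz: "(d, T x) \<in> X" using T Cons.prems z by simp
  have "move_sum T (\<lambda>ys. K (hd ys # T (snd z) # tl ys)) (map snd zs)
      = unshuffle_sum zs (\<lambda>S T. if length S = 1 then flip (fst z * fst (hd S)) (\<phi> (hd S) (z # T)) else 0)"
  proof (rule Cons.IH)
    show "set zs \<subseteq> X" using Cons.prems by simp
  next
    fix y us assume "set (y # us) \<subseteq> X"
    then show "K (hd (map snd (y # us)) # T (snd z) # tl (map snd (y # us))) = flip (fst z * fst y) (\<phi> y (z # us))"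
      using Cons.prems(2)[of y "(d, T x) # us"] Cons.prems(3)[of y "[]" d x us] Cons.prems(1) Tz by (simp add: z)
  next
    fix y us e t ts assume "set (y # us @ (e, t) # ts) \<subseteq> X"
    then show "flip (fst z * fst y) (\<phi> y (z # us @ (e, T t) # ts))
        = flip (e * fst y) (flip (fst z * fst y) (\<phi> y (z # us @ (e, t) # ts)))"
      using Cons.prems(3)[of y "z # us" e t ts] Cons.prems(1) by (simp add: add.commute)
  qed
  then show ?case using Cons.prems(2)[of z zs] Cons.prems(1) by (simp only: unshuffle_sum_single_Cons list.map move_sum.simps)
qed

section \<open>The subspaces \<open>\<aa>\<close> and \<open>\<hh>'\<close>\<close>

lemma vector_space_scale_fun:
  assumes "vector_space s"
  shows "vector_space (scale_fun s)"
proof -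
  interpret vector_space s by fact
  show ?thesis
    by unfold_locales (simp_all add: scale_fun_def fun_eq_iff scale_right_distrib scale_left_distrib)
qed

lemma sum_disjoint_support:
  assumes "finite I" "(\<Sum>i\<in>I. x i) = (0 :: 'z \<Rightarrow> 'v::ab_group_add)" "i \<in> I"
    and "\<And>i z. i \<in> I \<Longrightarrow> x i z \<noteq> 0 \<Longrightarrow> i = \<kappa> z"
  shows "x i = 0"
proof
  fix z
  have "x i z = (\<Sum>j\<in>I. x j z)" if "i = \<kappa> z"
    using that assms(1,3,4) by (subst sum.remove[of I i]) (auto intro!: sum.neutral)
  also have "(\<Sum>j\<in>J. x j z) = (\<Sum>j\<in>J. x j) z" for J by (induction J rule: infinite_finite_induct) simp_all
  then have "(\<Sum>j\<in>I. x j z) = 0" using assms(2) by simp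
  finally show "x i z = 0 z" using assms(3) assms(4)[of i z] by auto
qed

locale labelled_maps_prod = labelled_maps scale
  for scale :: "'k::field \<Rightarrow> 'a::ab_group_add \<times> 'm::ab_group_add \<Rightarrow> 'a \<times> 'm" +
  fixes scA :: "'k \<Rightarrow> 'a \<Rightarrow> 'a" and scM :: "'k \<Rightarrow> 'm \<Rightarrow> 'm"
  assumes scale_Pair: "scale c (a, x) = (scA c a, scM c x)"
begin

definition pr_A :: "'a \<times> 'm \<Rightarrow> 'a \<times> 'm"
  where "pr_A v = (fst v, 0)"

definition pr_M :: "'a \<times> 'm \<Rightarrow> 'a \<times> 'm"
  where "pr_M v = (0, snd v)"

lemma pr_simps [simp]:
  "pr_A (pr_A v) = pr_A v" "pr_M (pr_M v) = pr_M v" "pr_M (pr_A v) = 0" "pr_A (pr_M v) = 0"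
  "pr_A 0 = 0" "pr_M 0 = 0"
  by (simp_all add: pr_A_def pr_M_def zero_prod_def)

lemma pr_A_plus_pr_M: "pr_A v + pr_M v = v"
  by (simp add: pr_A_def pr_M_def)

lemma lin_pr: "lin pr_A" "lin pr_M"
proof -
  have "scA c 0 = 0" "scM c 0 = 0" for c
    using scale_zero_right[of c] scale_Pair[of c 0 0] by (simp_all add: zero_prod_def)
  moreover have "fst (scale c v) = scA c (fst v)" "snd (scale c v) = scM c (snd v)" for c v
    using scale_Pair[of c "fst v" "snd v"] by simp_all
  ultimately show "lin pr_A" "lin pr_M"
    by (simp_all add: lin_def pr_A_def pr_M_def scale_Pair)
qed

lemma pr_A_add: "pr_A (v + w) = pr_A v + pr_A w"
  using lin_pr(1) unfolding lin_def by blast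

lemma pr_A_flip: "pr_A (flip k v) = flip k (pr_A v)"
  by (simp add: pr_A_def flip_def)

lemma pr_A_diff: "pr_A (v - w) = pr_A v - pr_A w"
  by (simp add: pr_A_def)

abbreviation on_M :: "('w \<times> 'a \<times> 'm) list \<Rightarrow> ('w \<times> 'a \<times> 'm) list"
  where "on_M \<equiv> map (map_prod id pr_M)"

lemma map_prod_pr_M_idem [simp]:
  "map_prod id pr_M (map_prod id pr_M z) = map_prod id pr_M z"
  "map_prod id pr_M \<circ> map_prod id pr_M = map_prod id pr_M"
  by (auto simp: map_prod_def split_beta)

lemma ev_proj_a: "ev (proj_a f) zs = pr_A (ev f (on_M zs))"
  by (simp add: ev_def proj_a_def pr_A_def pr_M_def comp_def map_prod_def split_beta)

lemma proj_a_add: "proj_a (f + g) = proj_a f + (proj_a g :: 'w list \<Rightarrow> ('a \<times> 'm) list \<Rightarrow> 'a \<times> 'm)"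
  by (simp add: proj_a_def fun_eq_iff)

lemma proj_a_scale: "proj_a (scale_fun (scale_fun scale) c f) = scale_fun (scale_fun scale) c (proj_a f)"
proof (intro ext)
  fix \<alpha> vs
  have "pr_A (scale c v) = scale c (pr_A v)" for v using lin_pr(1) unfolding lin_def by blast
  then show "proj_a (scale_fun (scale_fun scale) c f) \<alpha> vs = scale_fun (scale_fun scale) c (proj_a f) \<alpha> vs"
    by (simp add: proj_a_def scale_fun_def pr_A_def)
qed

lemma proj_a_proj_a: "proj_a (proj_a f) = (proj_a f :: 'w list \<Rightarrow> ('a \<times> 'm) list \<Rightarrow> 'a \<times> 'm)"
  by (simp add: proj_a_def fun_eq_iff comp_def)

lemma slot_linear_proj_a:
  assumes "slot_linear f"
  shows "slot_linear (proj_a f)"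
  unfolding slot_linear_def
proof (intro allI)
  fix us a and ts :: "('b \<times> 'a \<times> 'm) list"
  have "lin (\<lambda>x. pr_A (ev f (on_M us @ [(a, pr_M x)] @ on_M ts)))"
    by (rule lin_compose[OF lin_pr(1) lin_compose[OF slot_linearD[OF assms] lin_pr(2)]])
  then show "lin (\<lambda>x. ev (proj_a f) (us @ [(a, x)] @ ts))" by (simp add: ev_proj_a)
qed

lemma proj_a_in_Hom_degree: "f \<in> Hom_degree n \<Longrightarrow> proj_a f \<in> Hom_degree n"
  by (auto simp: Hom_degree_def Hom_total_def slot_linear_proj_a) (auto simp: proj_a_def zero_prod_def)

lemma proj_a_bracket:
  assumes f: "slot_linear f" and g: "slot_linear g"
  shows "proj_a (bracket scale f g) = proj_a (bracket scale (proj_a f) g) + proj_a (bracket scale f (proj_a g))"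
proof (rule ev_ext)
  fix zs :: "('b \<times> 'a \<times> 'm) list"
  let ?m = on_M
  have *: "pr_A (ev f (?m u @ [merged (ev g) (?m w)] @ ?m t)) =
      pr_A (ev (proj_a f) (?m u @ [merged (ev g) (?m w)] @ ?m t)) + pr_A (ev f (?m u @ [merged (ev (proj_a g)) (?m w)] @ ?m t))"
    if f: "slot_linear f" for f g :: "'b list \<Rightarrow> ('a \<times> 'm) list \<Rightarrow> 'a \<times> 'm" and u w t
  proof -
    let ?l = "label_prod (map fst (?m w))" and ?y = "ev g (?m w)"
    have "ev f (?m u @ [(?l, ?y)] @ ?m t) = ev f (?m u @ [(?l, pr_A ?y)] @ ?m t) + ev f (?m u @ [(?l, pr_M ?y)] @ ?m t)"
      using slot_additiveD[OF slot_linear_imp_additive[OF f], of "?m u" ?l "pr_A ?y" "pr_M ?y" "?m t"]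
      by (simp only: pr_A_plus_pr_M)
    then have "pr_A (ev f (?m u @ [(?l, ?y)] @ ?m t)) =
        pr_A (ev f (?m u @ [(?l, pr_A ?y)] @ ?m t)) + pr_A (ev f (?m u @ [(?l, pr_M ?y)] @ ?m t))"
      by (simp only: pr_A_add)
    then show ?thesis by (simp add: merged_def ev_proj_a add.commute)
  qed
  show "ev (proj_a (bracket scale f g)) zs =
      ev (proj_a (bracket scale (proj_a f) g) + proj_a (bracket scale f (proj_a g))) zs"
    unfolding ev_plus ev_proj_a ev_bracket block_sum_map block_sum_hom[of pr_A, OF pr_A_add]
      block_sum_add[symmetric]
    by (intro block_sum_cong)
      (simp only: pr_A_diff pr_A_flip *[OF f, of _ g] *[OF g, of _ f] flip_add ev_proj_a[symmetric], simp add: flip_def)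
qed (simp add: proj_a_def bracket_length_neq zero_prod_def)

lemma bracket_proj_a_0:
  assumes f: "slot_linear f" "proj_a f = f" and g: "slot_linear g" "proj_a g = g"
  shows "bracket scale f g = 0"
proof (rule ev_ext)
  fix zs :: "('b \<times> 'a \<times> 'm) list"
  have *: "ev f (u @ [merged (ev g) w] @ t) = 0"
    if f: "slot_linear f" "proj_a f = f" and g: "proj_a g = g"
    for f g :: "'b list \<Rightarrow> ('a \<times> 'm) list \<Rightarrow> 'a \<times> 'm" and u w t
  proof -
    have "pr_M (ev g w) = 0" by (subst g[symmetric]) (simp add: ev_proj_a)
    then have "ev (proj_a f) (u @ [merged (ev g) w] @ t) = 0"
      using slot_additive_0[OF slot_linear_imp_additive[OF f(1)]] by (simp add: ev_proj_a merged_def)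
    then show ?thesis using f(2) by simp
  qed
  show "ev (bracket scale f g) zs = ev 0 zs"
    unfolding ev_bracket using *[OF f g(2)] *[OF g f(2)] by (simp add: ev_def)
qed (simp add: bracket_length_neq)

lemma labelled_Hom_pow: "labelled (Suc n) (Hom_pow scale (Suc n)) = Hom_degree (int n)"
proof (intro set_eqI iffI)
  fix f :: "'w list \<Rightarrow> ('a \<times> 'm) list \<Rightarrow> 'a \<times> 'm"
  assume f: "f \<in> labelled (Suc n) (Hom_pow scale (Suc n))"
  have pow: "f \<alpha> \<in> Hom_pow scale (Suc n)" if "length \<alpha> = Suc n" for \<alpha>
    using f that unfolding labelled_def mem_Collect_eq by metis
  have zero: "f \<alpha> vs = 0" if "length \<alpha> \<noteq> Suc n \<or> length vs \<noteq> Suc n" for \<alpha> vs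
    using f pow[of \<alpha>] that unfolding labelled_def Hom_pow_def mem_Collect_eq by (metis zero_fun_apply)
  have "lin (\<lambda>x. ev f (us @ [(a, x)] @ ts))" for us a ts
  proof (cases "length us + length ts = n")
    case True
    let ?\<alpha> = "map fst us @ [a] @ map fst ts" and ?xs = "map snd us @ [0] @ map snd ts"
    have upd: "ev f (us @ [(a, x)] @ ts) = f ?\<alpha> (?xs[length us := x])" for x
      by (simp add: ev_def list_update_append)
    have "multilinear_on scale scale UNIV (Suc n) (f ?\<alpha>)"
      using pow[of ?\<alpha>] True by (simp add: Hom_pow_def)
    moreover have "length ?xs = Suc n" "length us < Suc n" using True by auto
    ultimately show ?thesis
      unfolding lin_def upd multilinear_on_def by blast
  next
    case False
    then have "ev f (us @ [(a, x)] @ ts) = 0" for x unfolding ev_def by (intro zero) auto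
    then show ?thesis by (simp add: lin_0)
  qed
  then have "slot_linear f" by (simp add: slot_linear_def)
  then show "f \<in> Hom_degree (int n)"
    by (auto simp: Hom_degree_def Hom_total_def intro!: zero)
next
  fix f :: "'w list \<Rightarrow> ('a \<times> 'm) list \<Rightarrow> 'a \<times> 'm"
  assume f: "f \<in> Hom_degree (int n)"
  show "f \<in> labelled (Suc n) (Hom_pow scale (Suc n))"
    unfolding labelled_def mem_Collect_eq
  proof (intro allI)
    fix \<alpha>
    show "if length \<alpha> = Suc n then f \<alpha> \<in> Hom_pow scale (Suc n) else f \<alpha> = 0"
    proof (cases "length \<alpha> = Suc n")
      case True
      have lin: "lin (\<lambda>x. f \<alpha> (xs[i := x]))" if "length xs = Suc n" "i < Suc n" for xs i
      proof -
        let ?us = "zip (take i \<alpha>) (take i xs)" and ?ts = "zip (drop (Suc i) \<alpha>) (drop (Suc i) xs)"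
        have "f \<alpha> (xs[i := x]) = ev f (?us @ [(\<alpha> ! i, x)] @ ?ts)" for x
          using that True id_take_nth_drop[of i \<alpha>] by (simp add: ev_def upd_conv_take_nth_drop)
        then show ?thesis using slot_linearD[OF Hom_degree_slot_linear[OF f]] by simp
      qed
      have "multilinear_on scale scale UNIV (Suc n) (f \<alpha>)"
        unfolding multilinear_on_def using lin unfolding lin_def by blast
      moreover have "f \<alpha> vs = 0" if "length vs \<noteq> Suc n" for vs
        using f that True by (simp add: Hom_degree_def Hom_total_def)
      ultimately show ?thesis using True by (simp add: Hom_pow_def)
    next
      case False
      then show ?thesis using f by (auto simp: Hom_degree_def)
    qed
  qed
qed

definition Hom_a :: "int \<Rightarrow> ('w list \<Rightarrow> ('a \<times> 'm) list \<Rightarrow> 'a \<times> 'm) set"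
  where "Hom_a n = {f \<in> Hom_degree n. proj_a f = f}"

lemma space_a_eq: "space_a scale n = Hom_a (int n)"
proof (intro set_eqI iffI)
  fix f :: "'w list \<Rightarrow> ('a \<times> 'm) list \<Rightarrow> 'a \<times> 'm"
  assume f: "f \<in> space_a scale n"
  then have "f \<in> labelled (Suc n) (Hom_pow scale (Suc n))"
    unfolding space_a_def labelled_def Hom_summand_def by (auto split: if_splits)
  then show "f \<in> Hom_a (int n)" using proj_a_id[OF f] by (simp add: Hom_a_def labelled_Hom_pow)
next
  fix f :: "'w list \<Rightarrow> ('a \<times> 'm) list \<Rightarrow> 'a \<times> 'm"
  assume "f \<in> Hom_a (int n)"
  then have f: "f \<in> Hom_degree (int n)" "proj_a f = f" by (auto simp: Hom_a_def)
  have lab: "f \<in> labelled (Suc n) (Hom_pow scale (Suc n))" using f by (simp add: labelled_Hom_pow)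
  show "f \<in> space_a scale n"
    unfolding space_a_def labelled_def mem_Collect_eq
  proof (intro allI)
    fix \<alpha>
    show "if length \<alpha> = n + 1 then f \<alpha> \<in> Hom_summand scale 0 (n + 1) summand_A else f \<alpha> = 0"
    proof (cases "length \<alpha> = Suc n")
      case True
      then have pow: "f \<alpha> \<in> Hom_pow scale (Suc n)"
        using lab unfolding labelled_def mem_Collect_eq by metis
      have proj: "f \<alpha> vs = (fst (f \<alpha> (map (\<lambda>v. (0, snd v)) vs)), 0)" for vs
        using f(2) by (metis proj_a_def)
      have "f \<alpha> vs = 0" if vs: "(k', l') \<noteq> (0, Suc n)" "vs \<in> pure k' l'" for k' l' vs
      proof (cases "length vs = Suc n")
        case len: True
        obtain zs where zs: "vs = map embed zs" "length (filter isl zs) = k'"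
          "length (filter (\<lambda>z. \<not> isl z) zs) = l'" using vs(2) by (auto simp: pure_def)
        then have "k' + l' = Suc n" using sum_length_filter_compl[of isl zs] len by simp
        then have "filter isl zs \<noteq> []" using zs vs(1) by auto
        then obtain z where "z \<in> set zs" "isl z" by (auto simp: filter_empty_conv)
        then obtain i where i: "i < length zs" "isl (zs ! i)" by (metis in_set_conv_nth)
        let ?us = "map (\<lambda>v. (0, snd v)) vs"
        have "?us ! i = 0" using i zs(1) by (auto simp: embed_def zero_prod_def isl_def)
        moreover have less: "i < length ?us" "i < length \<alpha>" using i zs(1) True len by auto
        ultimately have "zip \<alpha> ?us = zip (take i \<alpha> @ [\<alpha> ! i] @ drop (Suc i) \<alpha>) (take i ?us @ [0] @ drop (Suc i) ?us)"
          using id_take_nth_drop[OF less(1)] id_take_nth_drop[OF less(2)] by (metis append_Cons append_Nil)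
        also have "\<dots> = zip (take i \<alpha>) (take i ?us) @ [(\<alpha> ! i, 0)] @ zip (drop (Suc i) \<alpha>) (drop (Suc i) ?us)"
          using less by simp
        finally have zip: "zip \<alpha> ?us = zip (take i \<alpha>) (take i ?us) @ [(\<alpha> ! i, 0)] @ zip (drop (Suc i) \<alpha>) (drop (Suc i) ?us)" .
        have "ev f (zip \<alpha> ?us) = 0"
          unfolding zip by (rule slot_additive_0[OF slot_linear_imp_additive[OF Hom_degree_slot_linear[OF f(1)]]])
        then have "f \<alpha> ?us = 0" using True len by (simp add: ev_def)
        then show ?thesis by (subst proj) (simp add: zero_prod_def)
      next
        case False
        then show ?thesis using pow by (simp add: Hom_pow_def)
      qed
      moreover have "f \<alpha> vs \<in> summand_A" for vs by (subst proj) (simp add: summand_A_def)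
      ultimately have "f \<alpha> \<in> Hom_summand scale 0 (n + 1) summand_A"
        using pow by (auto simp: Hom_summand_def)
      then show ?thesis using True by simp
    next
      case False
      then show ?thesis using lab unfolding labelled_def by (metis (mono_tags, lifting) Suc_eq_plus1 mem_Collect_eq)
    qed
  qed
qed

lemma ev_const_coll: "ev (const_coll q) zs = q (map snd zs)"
  by (simp add: ev_def const_coll_def)

lemma const_coll_replicate: "const_coll q (replicate (length vs) a) vs = q vs"
  by (simp add: const_coll_def)

lemma const_coll_inject: "const_coll q = (const_coll r :: 'w list \<Rightarrow> _) \<longleftrightarrow> q = r"
  using const_coll_replicate[of q _ "undefined :: 'w"] const_coll_replicate[of r _ "undefined :: 'w"]
  by (metis ext)

lemma const_coll_in_Hom_degree:
  "(const_coll q :: 'w list \<Rightarrow> _) \<in> Hom_degree (int n) \<longleftrightarrow> q \<in> Hom_pow scale (Suc n)"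
proof
  assume q: "q \<in> Hom_pow scale (Suc n)"
  have "(const_coll q :: 'w list \<Rightarrow> _) \<in> labelled (Suc n) (Hom_pow scale (Suc n))"
    unfolding labelled_def mem_Collect_eq
  proof (intro allI)
    fix \<alpha> :: "'w list"
    show "if length \<alpha> = Suc n then const_coll q \<alpha> \<in> Hom_pow scale (Suc n) else const_coll q \<alpha> = 0"
    proof (cases "length \<alpha> = Suc n")
      case True
      have "const_coll q \<alpha> = q" using q True by (auto simp: const_coll_def Hom_pow_def fun_eq_iff)
      then show ?thesis using q True by simp
    next
      case False
      then show ?thesis using q by (auto simp: const_coll_def Hom_pow_def fun_eq_iff)
    qed
  qed
  then show "(const_coll q :: 'w list \<Rightarrow> _) \<in> Hom_degree (int n)" by (simp add: labelled_Hom_pow)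
next
  assume q: "(const_coll q :: 'w list \<Rightarrow> _) \<in> Hom_degree (int n)"
  then have zero: "q vs = 0" if "length vs \<noteq> Suc n" for vs
    using that const_coll_replicate[of q vs "undefined :: 'w"] by (auto simp: Hom_degree_def)
  let ?\<alpha> = "replicate (Suc n) undefined :: 'w list"
  have "(const_coll q :: 'w list \<Rightarrow> _) \<in> labelled (Suc n) (Hom_pow scale (Suc n))"
    using q by (simp add: labelled_Hom_pow)
  then have "const_coll q ?\<alpha> \<in> Hom_pow scale (Suc n)"
    unfolding labelled_def mem_Collect_eq by (metis length_replicate)
  moreover have "const_coll q ?\<alpha> = q" using zero by (auto simp: const_coll_def fun_eq_iff)
  ultimately show "q \<in> Hom_pow scale (Suc n)" by simp
qed

definition count_M :: "('a + 'm) list \<Rightarrow> nat"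
  where "count_M zs = length (filter (\<lambda>z. \<not> isl z) zs)"

lemma count_M_simps [simp]:
  "count_M [] = 0" "count_M (z # zs) = (if isl z then 0 else 1) + count_M zs"
  "count_M (ys @ zs) = count_M ys + count_M zs"
  by (simp_all add: count_M_def)

text \<open>
  Giving \<open>A\<close> weight \<open>0\<close> and \<open>M\<close> weight \<open>1\<close>, the elements of \<open>\<hh>'\<close> are the maps that preserve weight.
\<close>

definition weighted :: "(('a \<times> 'm) list \<Rightarrow> 'a \<times> 'm) \<Rightarrow> bool"
  where "weighted q \<longleftrightarrow> (\<forall>zs. (count_M zs \<noteq> 0 \<longrightarrow> fst (q (map embed zs)) = 0) \<and>
    (count_M zs \<noteq> 1 \<longrightarrow> snd (q (map embed zs)) = 0))"

lemma Hom_pow_compose: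
  assumes "q \<in> Hom_pow scale n" "lin \<phi>"
  shows "(\<lambda>vs. \<phi> (q vs)) \<in> Hom_pow scale n"
proof -
  have "\<phi> 0 = 0" using assms(2) unfolding lin_def by (metis scale_zero_left)
  then show ?thesis using assms unfolding Hom_pow_def multilinear_on_def lin_def
    by (simp del: split_paired_All)
qed

lemma pure_iff:
  fixes vs :: "('a \<times> 'm) list"
  shows "vs \<in> pure k l \<longleftrightarrow> (\<exists>zs :: ('a + 'm) list. vs = map embed zs \<and> length zs = k + l \<and> count_M zs = l)"
proof -
  have "length (filter isl zs) = k \<and> count_M zs = l \<longleftrightarrow> length zs = k + l \<and> count_M zs = l" for zs :: "('a + 'm) list"
    using sum_length_filter_compl[of isl zs] by (auto simp: count_M_def)
  then show ?thesis unfolding pure_def count_M_def by blast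
qed

lemma space_h'_eq: "space_h' scale n = {q \<in> Hom_pow scale (Suc n). weighted q}"
proof (intro set_eqI iffI)
  fix q :: "('a \<times> 'm) list \<Rightarrow> 'a \<times> 'm" assume "q \<in> space_h' scale n"
  then obtain f g where q: "q = f + g" and f: "f \<in> Hom_summand scale (n + 1) 0 summand_A"
    and g: "g \<in> Hom_summand scale n 1 summand_M"
    by (auto simp: space_h'_def)
  have pow: "f \<in> Hom_pow scale (Suc n)" "g \<in> Hom_pow scale (Suc n)" using f g by (auto simp: Hom_summand_def)
  have "q \<in> Hom_pow scale (Suc n)"
    using pow unfolding q Hom_pow_def multilinear_on_def by (auto simp: algebra_simps scale_right_distrib)
  moreover have "weighted q"
    unfolding weighted_def
  proof (intro allI)
    fix zs :: "('a + 'm) list"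
    have pure: "map embed zs \<in> pure (length zs - count_M zs) (count_M zs)"
      unfolding pure_iff by (auto simp: count_M_def)
    have "snd (f vs) = 0" "fst (g vs) = 0" for vs
      using f g by (auto simp: Hom_summand_def summand_A_def summand_M_def image_subset_iff) (metis (no_types, lifting) fst_conv snd_conv)+
    moreover have "f (map embed zs) = 0" if "count_M zs \<noteq> 0"
      using f pure that by (auto simp: Hom_summand_def)
    moreover have "g (map embed zs) = 0" if "count_M zs \<noteq> 1"
      using g pure that by (auto simp: Hom_summand_def)
    ultimately show "(count_M zs \<noteq> 0 \<longrightarrow> fst (q (map embed zs)) = 0) \<and>
      (count_M zs \<noteq> 1 \<longrightarrow> snd (q (map embed zs)) = 0)" by (simp add: q)
  qed
  ultimately show "q \<in> {q \<in> Hom_pow scale (Suc n). weighted q}" by simp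
next
  fix q :: "('a \<times> 'm) list \<Rightarrow> 'a \<times> 'm" assume "q \<in> {q \<in> Hom_pow scale (Suc n). weighted q}"
  then have q: "q \<in> Hom_pow scale (Suc n)" "weighted q" by auto
  have "(\<lambda>vs. pr_A (q vs)) \<in> Hom_summand scale (n + 1) 0 summand_A"
    unfolding Hom_summand_def mem_Collect_eq
  proof (intro conjI allI impI)
    show "(\<lambda>vs. pr_A (q vs)) \<in> Hom_pow scale (n + 1 + 0)"
      using Hom_pow_compose[OF q(1) lin_pr(1)] by simp
    show "range (\<lambda>vs. pr_A (q vs)) \<subseteq> summand_A" by (auto simp: pr_A_def summand_A_def)
    fix k l and vs :: "('a \<times> 'm) list" assume "(k, l) \<noteq> (n + 1, 0) \<and> vs \<in> pure k l"
    then obtain zs where zs: "vs = map embed zs" "length zs = k + l" "count_M zs = l" "(k, l) \<noteq> (n + 1, 0)"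
      by (auto simp: pure_iff)
    then consider "length zs \<noteq> Suc n" | "count_M zs \<noteq> 0" by fastforce
    then show "pr_A (q vs) = 0"
      using q zs(1) by cases (auto simp: pr_A_def weighted_def Hom_pow_def zero_prod_def)
  qed
  moreover have "(\<lambda>vs. pr_M (q vs)) \<in> Hom_summand scale n 1 summand_M"
    unfolding Hom_summand_def mem_Collect_eq
  proof (intro conjI allI impI)
    show "(\<lambda>vs. pr_M (q vs)) \<in> Hom_pow scale (n + 1)"
      using Hom_pow_compose[OF q(1) lin_pr(2)] by simp
    show "range (\<lambda>vs. pr_M (q vs)) \<subseteq> summand_M" by (auto simp: pr_M_def summand_M_def)
    fix k l and vs :: "('a \<times> 'm) list" assume "(k, l) \<noteq> (n, 1) \<and> vs \<in> pure k l"
    then obtain zs where zs: "vs = map embed zs" "length zs = k + l" "count_M zs = l" "(k, l) \<noteq> (n, 1)"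
      by (auto simp: pure_iff)
    then consider "length zs \<noteq> Suc n" | "count_M zs \<noteq> 1" by fastforce
    then show "pr_M (q vs) = 0"
      using q zs(1) by cases (auto simp: pr_M_def weighted_def Hom_pow_def zero_prod_def)
  qed
  moreover have "q = (\<lambda>vs. pr_A (q vs)) + (\<lambda>vs. pr_M (q vs))"
    by (simp add: fun_eq_iff pr_A_plus_pr_M)
  ultimately show "q \<in> space_h' scale n" unfolding space_h'_def by blast
qed

definition bracket_h :: "(('a \<times> 'm) list \<Rightarrow> 'a \<times> 'm) \<Rightarrow> (('a \<times> 'm) list \<Rightarrow> 'a \<times> 'm) \<Rightarrow> ('a \<times> 'm) list \<Rightarrow> 'a \<times> 'm"
  where "bracket_h q r = block_sum (\<lambda>u w t.
    flip (int (length u) * (int (length w) - 1)) (q (u @ [r w] @ t))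
    - flip ((int (length w) - 1) * int (length t)) (r (u @ [q w] @ t)))"

lemma const_coll_bracket_h:
  "const_coll (bracket_h q r) = bracket scale (const_coll q) (const_coll r :: 'w::semigroup_mult list \<Rightarrow> _)"
proof (rule ev_ext)
  fix zs :: "('w \<times> 'a \<times> 'm) list"
  show "ev (const_coll (bracket_h q r)) zs = ev (bracket scale (const_coll q) (const_coll r)) zs"
    by (simp add: ev_bracket ev_const_coll bracket_h_def block_sum_map merged_def)
qed (simp add: bracket_length_neq const_coll_def)

lemma weighted_bracket_h:
  assumes q: "weighted q" "q \<in> Hom_pow scale (Suc m)" and r: "weighted r" "r \<in> Hom_pow scale (Suc n)"
  shows "weighted (bracket_h q r)"
proof -
  have *: "(count_M u + count_M w + count_M t \<noteq> 0 \<longrightarrow> pr_A (q (map embed u @ [r (map embed w)] @ map embed t)) = 0) \<and>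
    (count_M u + count_M w + count_M t \<noteq> 1 \<longrightarrow> pr_M (q (map embed u @ [r (map embed w)] @ map embed t)) = 0)"
    if q: "weighted q" "q \<in> Hom_pow scale (Suc m)" and r: "weighted r" for q r m and u w t :: "('a + 'm) list"
  proof -
    have weight: "(count_M zs \<noteq> 0 \<longrightarrow> pr_A (q (map embed zs)) = 0) \<and>
        (count_M zs \<noteq> 1 \<longrightarrow> pr_M (q (map embed zs)) = 0)" for zs
      using q(1) unfolding weighted_def pr_A_def pr_M_def by (simp add: zero_prod_def)
    let ?v = "r (map embed w)"
    consider "count_M w = 0" | "count_M w = 1" | "count_M w \<noteq> 0" "count_M w \<noteq> 1" by blast
    then show ?thesis
    proof cases
      case 1
      then have "?v = embed (Inl (fst ?v) :: 'a + 'm)"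
        using r unfolding weighted_def by (simp add: embed_def prod_eq_iff)
      then have "map embed u @ [?v] @ map embed t = map embed (u @ [Inl (fst ?v)] @ t)" by simp
      then show ?thesis using weight[of "u @ [Inl (fst ?v)] @ t"] 1 by (simp only:) simp
    next
      case 2
      then have "?v = embed (Inr (snd ?v) :: 'a + 'm)"
        using r unfolding weighted_def by (simp add: embed_def prod_eq_iff)
      then have "map embed u @ [?v] @ map embed t = map embed (u @ [Inr (snd ?v)] @ t)" by simp
      then show ?thesis using weight[of "u @ [Inr (snd ?v)] @ t"] 2 by (simp only:) simp
    next
      case 3
      then have "?v = 0" using r unfolding weighted_def by (simp add: prod_eq_iff)
      moreover have "slot_linear (const_coll q :: nat list \<Rightarrow> _)"
        using const_coll_in_Hom_degree[THEN iffD2, OF q(2)] Hom_degree_slot_linear by blast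
      then have "q (us @ [0] @ ts) = 0" for us ts
        using slot_additive_0[OF slot_linear_imp_additive, of "const_coll q" "map (Pair 0) us" 0 "map (Pair 0) ts"]
        by (simp add: ev_const_coll comp_def)
      ultimately show ?thesis by simp
    qed
  qed
  have "pr_A (bracket_h q r (map embed zs)) = 0" if "count_M zs \<noteq> 0" for zs
  proof -
    have "pr_A (bracket_h q r (map embed zs)) = block_sum (\<lambda>u w t. 0) zs"
      unfolding bracket_h_def block_sum_map block_sum_hom[of pr_A, OF pr_A_add]
    proof (intro block_sum_cong)
      fix u w t assume "u @ w @ t = zs"
      then have "count_M u + count_M w + count_M t \<noteq> 0" using that by auto
      then show "pr_A (flip (int (length (map embed u)) * (int (length (map embed w)) - 1)) (q (map embed u @ [r (map embed w)] @ map embed t))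
        - flip ((int (length (map embed w)) - 1) * int (length (map embed t))) (r (map embed u @ [q (map embed w)] @ map embed t))) = 0"
        using *[OF q r(1), of u w t] *[OF r q(1), of u w t] by (simp only: pr_A_diff pr_A_flip) simp
    qed
    then show ?thesis by simp
  qed
  moreover have "pr_M (bracket_h q r (map embed zs)) = 0" if "count_M zs \<noteq> 1" for zs
  proof -
    have pr_M: "pr_M (v + v') = pr_M v + pr_M v'" "pr_M (v - v') = pr_M v - pr_M v'" "pr_M (flip k v) = flip k (pr_M v)" for v v' k
      by (simp_all add: pr_M_def flip_def)
    have "pr_M (bracket_h q r (map embed zs)) = block_sum (\<lambda>u w t. 0) zs"
      unfolding bracket_h_def block_sum_map block_sum_hom[of pr_M, OF pr_M(1)]
    proof (intro block_sum_cong)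
      fix u w t assume "u @ w @ t = zs"
      then have "count_M u + count_M w + count_M t \<noteq> 1" using that by auto
      then show "pr_M (flip (int (length (map embed u)) * (int (length (map embed w)) - 1)) (q (map embed u @ [r (map embed w)] @ map embed t))
        - flip ((int (length (map embed w)) - 1) * int (length (map embed t))) (r (map embed u @ [q (map embed w)] @ map embed t))) = 0"
        using *[OF q r(1), of u w t] *[OF r q(1), of u w t] by (simp only: pr_M) simp
    qed
    then show ?thesis by simp
  qed
  ultimately show ?thesis unfolding weighted_def pr_A_def pr_M_def by (simp add: zero_prod_def)
qed

lemma bracket_h_in_space_h':
  assumes q: "q \<in> space_h' scale m" and r: "r \<in> space_h' scale n"
  shows "bracket_h q r \<in> space_h' scale (m + n)"
proof -
  have q': "weighted q" "q \<in> Hom_pow scale (Suc m)" and r': "weighted r" "r \<in> Hom_pow scale (Suc n)"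
    using q r by (auto simp: space_h'_eq)
  have "bracket scale (const_coll q) (const_coll r :: nat list \<Rightarrow> _) \<in> Hom_degree (int m + int n)"
    using q' r' by (intro bracket_in_Hom_degree) (simp_all add: const_coll_in_Hom_degree)
  then have "(const_coll (bracket_h q r) :: nat list \<Rightarrow> _) \<in> Hom_degree (int (m + n))"
    by (simp add: const_coll_bracket_h)
  then show ?thesis
    using weighted_bracket_h[OF q' r'] by (simp only: space_h'_eq const_coll_in_Hom_degree mem_Collect_eq)
qed

definition Hom_h :: "int \<Rightarrow> (('a \<times> 'm) list \<Rightarrow> 'a \<times> 'm) set"
  where "Hom_h n = (if n \<ge> 0 then space_h' scale (nat n) else {0})"

lemma Hom_h_cases:
  assumes "q \<in> Hom_h n"
  obtains k where "n = int k" "q \<in> space_h' scale k" | "q = 0"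
  using assms unfolding Hom_h_def by (cases "n \<ge> 0") (auto elim: nonneg_int_cases)

lemma Hom_h_int [simp]: "Hom_h (int n) = space_h' scale n"
  by (simp add: Hom_h_def)

lemma space_h'_0: "0 \<in> space_h' scale n"
  by (auto simp: space_h'_eq Hom_pow_def multilinear_on_def weighted_def)

lemma space_h'_add: "q \<in> space_h' scale n \<Longrightarrow> r \<in> space_h' scale n \<Longrightarrow> q + r \<in> space_h' scale n"
  unfolding space_h'_eq Hom_pow_def multilinear_on_def weighted_def
  by (simp add: scale_right_distrib algebra_simps del: split_paired_All)

lemma space_h'_scale: "q \<in> space_h' scale n \<Longrightarrow> scale_fun scale c q \<in> space_h' scale n"
proof -
  have lin: "lin (scale c)" by (simp add: lin_def scale_right_distrib scale_left_commute)
  have "fst v = 0 \<Longrightarrow> fst (scale c v) = 0" "snd v = 0 \<Longrightarrow> snd (scale c v) = 0" for v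
    using lin_pr[unfolded lin_def] by (metis pr_A_def pr_M_def fst_conv snd_conv scale_zero_right zero_prod_def)+
  then show "q \<in> space_h' scale n \<Longrightarrow> scale_fun scale c q \<in> space_h' scale n"
    using Hom_pow_compose[OF _ lin, of q] by (simp add: space_h'_eq scale_fun_def weighted_def)
qed

lemma Hom_h_0: "0 \<in> Hom_h n"
  by (simp add: Hom_h_def space_h'_0)

lemma Hom_h_add: "q \<in> Hom_h n \<Longrightarrow> r \<in> Hom_h n \<Longrightarrow> q + r \<in> Hom_h n"
  by (auto simp: Hom_h_def space_h'_add split: if_splits)

lemma scale_fun_0: "scale_fun scale c 0 = 0" "scale_fun (scale_fun scale) c 0 = 0"
  by (simp_all add: scale_fun_def fun_eq_iff)

lemma Hom_h_scale: "q \<in> Hom_h n \<Longrightarrow> scale_fun scale c q \<in> Hom_h n"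
  by (auto simp: Hom_h_def space_h'_scale scale_fun_0 split: if_splits)

lemma Hom_h_minus: "q \<in> Hom_h n \<Longrightarrow> - q \<in> Hom_h n"
proof -
  have "scale_fun scale (-1) q = - q" by (simp add: scale_fun_def fun_eq_iff)
  then show "q \<in> Hom_h n \<Longrightarrow> - q \<in> Hom_h n" using Hom_h_scale[of q n "-1"] by simp
qed

lemma const_coll_0 [simp]: "const_coll 0 = 0"
  by (auto simp: const_coll_def fun_eq_iff)

lemma const_coll_add:
  fixes q r :: "('a \<times> 'm) list \<Rightarrow> 'a \<times> 'm"
  shows "const_coll (q + r) = const_coll q + const_coll r"
  by (auto simp: const_coll_def fun_eq_iff)

lemma const_coll_scale: "const_coll (scale_fun scale c q) = scale_fun (scale_fun scale) c (const_coll q)"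
  by (auto simp: const_coll_def fun_eq_iff scale_fun_def)

lemma const_coll_Hom_h: "q \<in> Hom_h n \<Longrightarrow> const_coll q \<in> Hom_degree n"
  by (erule Hom_h_cases) (auto simp: const_coll_in_Hom_degree space_h'_eq Hom_degree_0)

lemma proj_a_0 [simp]: "proj_a 0 = (0 :: 'w list \<Rightarrow> ('a \<times> 'm) list \<Rightarrow> 'a \<times> 'm)"
  by (simp add: proj_a_def fun_eq_iff zero_prod_def)

lemma proj_a_const_coll: "q \<in> Hom_h n \<Longrightarrow> proj_a (const_coll q) = 0"
proof (erule Hom_h_cases)
  fix k assume "q \<in> space_h' scale k"
  then have q: "q \<in> Hom_pow scale (Suc k)" "weighted q" by (auto simp: space_h'_eq)
  have "fst (q (map (\<lambda>v. (0, snd v)) vs)) = 0" for vs :: "('a \<times> 'm) list"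
  proof (cases "vs = []")
    case True
    then show ?thesis using q(1) by (simp add: Hom_pow_def)
  next
    case False
    let ?zs = "map (\<lambda>v. Inr (snd v)) vs :: ('a + 'm) list"
    have "count_M ?zs = length vs" by (simp add: count_M_def filter_map comp_def)
    moreover have "map embed ?zs = map (\<lambda>v. (0, snd v)) vs" by (simp add: embed_def)
    ultimately show ?thesis using q(2) False unfolding weighted_def by (metis length_0_conv)
  qed
  then show "proj_a (const_coll q) = 0"
    by (auto simp: proj_a_def const_coll_def fun_eq_iff zero_prod_def)
qed simp

lemma Hom_a_0: "0 \<in> Hom_a n"
  by (simp add: Hom_a_def Hom_degree_0)

lemma Hom_a_add: "f \<in> Hom_a n \<Longrightarrow> g \<in> Hom_a n \<Longrightarrow> f + g \<in> Hom_a n"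
  by (simp add: Hom_a_def Hom_degree_add proj_a_add)

lemma Hom_a_scale: "f \<in> Hom_a n \<Longrightarrow> scale_fun (scale_fun scale) c f \<in> Hom_a n"
  by (simp add: Hom_a_def Hom_degree_scale proj_a_scale)

lemma Hom_a_minus: "f \<in> Hom_a n \<Longrightarrow> - f \<in> Hom_a n"
proof -
  have "scale_fun (scale_fun scale) (-1) f = - f" by (simp add: scale_fun_def fun_eq_iff)
  then show "f \<in> Hom_a n \<Longrightarrow> - f \<in> Hom_a n" using Hom_a_scale[of f n "-1"] by simp
qed

lemma Hom_a_negative: "n < 0 \<Longrightarrow> Hom_a n = {0}"
  using Hom_degree_negative Hom_a_0 by (auto simp: Hom_a_def)

lemma bracket_h_in_Hom_h:
  assumes "q \<in> Hom_h m" "r \<in> Hom_h n"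
  shows "bracket_h q r \<in> Hom_h (m + n)"
proof -
  have "bracket_h q r = 0" if "q = 0 \<or> r = 0"
  proof -
    have "(const_coll q :: nat list \<Rightarrow> _) \<in> Hom_total" "(const_coll r :: nat list \<Rightarrow> _) \<in> Hom_total"
      using assms const_coll_Hom_h Hom_degree_total by blast+
    then have "(const_coll (bracket_h q r) :: nat list \<Rightarrow> _) = const_coll 0"
      using that by (auto simp: const_coll_bracket_h bracket_0_left bracket_0_right)
    then show ?thesis by (simp only: const_coll_inject)
  qed
  then show ?thesis
    using bracket_h_in_space_h' assms
    by (elim Hom_h_cases) (auto simp: Hom_h_0 of_nat_add[symmetric] simp del: of_nat_add)
qed

lemma Hom_a_Hom_degree: "f \<in> Hom_a n \<Longrightarrow> f \<in> Hom_degree n"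
  by (simp add: Hom_a_def)

lemma proj_a_in_Hom_a: "f \<in> Hom_degree n \<Longrightarrow> proj_a f \<in> Hom_a n"
  by (simp add: Hom_a_def proj_a_in_Hom_degree proj_a_proj_a)

lemma bracket_Hom_a: "f \<in> Hom_a m \<Longrightarrow> g \<in> Hom_a n \<Longrightarrow> bracket scale f g = 0"
  by (auto simp: Hom_a_def intro: bracket_proj_a_0 Hom_degree_slot_linear)

lemma derived_brackets:
  "derived_brackets (Hom_degree :: int \<Rightarrow> ('w::semigroup_mult list \<Rightarrow> ('a \<times> 'm) list \<Rightarrow> 'a \<times> 'm) set)
    (bracket scale) Hom_a proj_a Hom_h const_coll bracket_h"
proof
  fix q assume "const_coll q = (0 :: 'w list \<Rightarrow> ('a \<times> 'm) list \<Rightarrow> 'a \<times> 'm)"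
  then show "q = 0" using const_coll_inject[of q 0, where 'w = 'w] by simp
qed (rule Hom_degree_0 Hom_degree_add Hom_degree_minus bracket_in_Hom_degree
    bracket_add_left[OF Hom_degree_slot_linear] bracket_commute bracket_jacobi Hom_a_0 Hom_a_add Hom_a_minus
    Hom_a_Hom_degree bracket_Hom_a proj_a_in_Hom_a proj_a_add
    proj_a_bracket[OF Hom_degree_slot_linear Hom_degree_slot_linear] Hom_h_0 Hom_h_add Hom_h_minus
    bracket_h_in_Hom_h const_coll_Hom_h const_coll_add const_coll_bracket_h proj_a_const_coll; assumption)+

lemma sha_space_eq: "sha_space scale i = Hom_h (i + 1) \<times> Hom_a i"
  by (auto simp: sha_space_def Hom_h_def space_a_eq Hom_a_negative)

lemma vector_space_prod_sha:
  "vector_space_prod (scale_fun scale) (scale_fun (scale_fun scale))"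
proof -
  have "vector_space scale" by unfold_locales
  then have "vector_space (scale_fun scale)" "vector_space (scale_fun (scale_fun scale))"
    by (auto intro: vector_space_scale_fun)
  then show ?thesis by (simp add: vector_space_prod_def vector_space_pair_def)
qed

lemma sha_scale_Pair: "sha_scale scale c (q, p) = (scale_fun scale c q, scale_fun (scale_fun scale) c p)"
proof -
  interpret vector_space_prod "scale_fun scale" "scale_fun (scale_fun scale)" by (rule vector_space_prod_sha)
  show ?thesis by (simp add: sha_scale_def scale_prod)
qed

lemma vector_space_sha: "vector_space (sha_scale scale)"
proof -
  interpret vector_space_prod "scale_fun scale" "scale_fun (scale_fun scale)" by (rule vector_space_prod_sha)
  show ?thesis unfolding sha_scale_def by unfold_locales
qed

lemma graded_vector_space_sha:
  "graded_vector_space (sha_scale scale) (sha_space scale :: int \<Rightarrow> ('w, 'a, 'm) sha set)"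
proof -
  interpret S: vector_space "sha_scale scale :: _ \<Rightarrow> ('w, 'a, 'm) sha \<Rightarrow> _" by (rule vector_space_sha)
  show ?thesis
  proof
    fix i
    show "S.subspace (sha_space scale i :: ('w, 'a, 'm) sha set)"
      by (rule S.subspaceI)
        (auto simp: sha_space_eq zero_prod_def sha_scale_Pair Hom_h_0 Hom_a_0 Hom_h_add Hom_a_add Hom_h_scale Hom_a_scale)
  next
    fix I and x :: "int \<Rightarrow> ('w, 'a, 'm) sha" and i
    assume I: "finite I" and x: "\<And>i. i \<in> I \<Longrightarrow> x i \<in> sha_space scale i" and 0: "sum x I = 0" and i: "i \<in> I"
    have "fst (x i) = 0"
    proof (rule sum_disjoint_support[OF I _ i, of "\<lambda>i. fst (x i)" "\<lambda>vs. int (length vs) - 2"])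
      show "(\<Sum>i\<in>I. fst (x i)) = 0" using 0 by (simp add: fst_sum[symmetric])
      fix j vs assume j: "j \<in> I" "fst (x j) vs \<noteq> 0"
      then have "fst (x j) \<in> Hom_h (j + 1)" using x[OF j(1)] by (auto simp: sha_space_eq)
      then show "j = int (length vs) - 2"
      proof (rule Hom_h_cases)
        fix k assume k: "j + 1 = int k" "fst (x j) \<in> space_h' scale k"
        then have "length vs = Suc k" using j(2) by (auto simp: space_h'_eq Hom_pow_def)
        then show ?thesis using k(1) by simp
      qed (use j(2) in simp)
    qed
    moreover have "snd (x i) = 0"
    proof (rule sum_disjoint_support[OF I _ i, of "\<lambda>i. snd (x i)" "\<lambda>\<alpha>. int (length \<alpha>) - 1"])
      show "(\<Sum>i\<in>I. snd (x i)) = 0" using 0 by (simp add: snd_sum[symmetric])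
      fix j \<alpha> assume j: "j \<in> I" "snd (x j) \<alpha> \<noteq> 0"
      then have "snd (x j) \<in> Hom_degree j" using x[OF j(1)] by (auto simp: sha_space_eq Hom_a_def)
      then have "int (length \<alpha>) = j + 1" using j(2) by (auto simp: Hom_degree_def fun_eq_iff)
      then show "j = int (length \<alpha>) - 1" by simp
    qed
    ultimately show "x i = 0" by (simp add: prod_eq_iff)
  qed
qed

definition sha_total :: "('w::semigroup_mult, 'a, 'm) sha set"
  where "sha_total = {(q, p). (const_coll q :: 'w list \<Rightarrow> _) \<in> Hom_total \<and>
    proj_a (const_coll q :: 'w list \<Rightarrow> _) = 0 \<and> p \<in> Hom_total}"

lemma sha_space_total: "sha_space scale i \<subseteq> sha_total"
  by (auto simp: sha_space_eq sha_total_def Hom_a_def intro: Hom_degree_total const_coll_Hom_h proj_a_const_coll)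

lemma sha_total_closed:
  "0 \<in> sha_total" "x \<in> sha_total \<Longrightarrow> y \<in> sha_total \<Longrightarrow> x + y \<in> sha_total"
  "x \<in> sha_total \<Longrightarrow> sha_scale scale c x \<in> sha_total"
proof -
  show "0 \<in> sha_total" unfolding zero_prod_def sha_total_def by (simp add: Hom_total_0)
qed (auto simp: sha_total_def const_coll_add Hom_total_add proj_a_add
    sha_scale_Pair const_coll_scale Hom_total_scale proj_a_scale scale_fun_0)

lemma total_subset: "graded_vector_space.total (sha_scale scale) (sha_space scale) \<subseteq> sha_total"
proof -
  interpret S: graded_vector_space "sha_scale scale" "sha_space scale" by (rule graded_vector_space_sha)
  show ?thesis unfolding S.total_def
    by (rule S.span_minimal) (use sha_space_total in \<open>auto intro!: S.subspaceI sha_total_closed\<close>)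
qed

section \<open>The operations on \<open>s\<^sup>-\<^sup>1\<hh>' \<oplus> \<aa>\<close>\<close>

definition parity_part :: "bool \<Rightarrow> (('a \<times> 'm) list \<Rightarrow> 'a \<times> 'm) \<Rightarrow> ('a \<times> 'm) list \<Rightarrow> 'a \<times> 'm"
  where "parity_part \<epsilon> q = (\<lambda>vs. if even (length vs) = \<epsilon> then q vs else 0)"

definition signed :: "(('a \<times> 'm) list \<Rightarrow> 'a \<times> 'm) \<Rightarrow> ('a \<times> 'm) list \<Rightarrow> 'a \<times> 'm"
  where "signed q = (\<lambda>vs. flip (int (length vs) + 1) (q vs))"

definition twist :: "bool \<Rightarrow> ('w::semigroup_mult, 'a, 'm) sha \<Rightarrow> ('w, 'a, 'm) sha"
  where "twist \<epsilon> x = (fst x, \<lambda>\<alpha> vs. if \<epsilon> then snd x \<alpha> vs else flip (int (length \<alpha>) + 1) (snd x \<alpha> vs))"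

definition derived :: "bool \<Rightarrow> ('w::semigroup_mult, 'a, 'm) sha list \<Rightarrow> 'w list \<Rightarrow> ('a \<times> 'm) list \<Rightarrow> 'a \<times> 'm"
  where "derived \<epsilon> xs =
    proj_a (foldl (bracket scale) (const_coll (parity_part \<epsilon> (fst (hd xs)))) (map snd (tl xs)))"

text \<open>
  On homogeneous elements, moving \<open>s\<^sup>-\<^sup>1q\<close> to the front costs signs that depend only on the parities
  of the arities; splitting \<open>q\<close> by parity makes the result linear on the whole space.
\<close>

definition sha_l :: "nat \<Rightarrow> ('w::semigroup_mult, 'a, 'm) sha list \<Rightarrow> ('w, 'a, 'm) sha"
  where "sha_l k xs =
    (if k = 2 then bracket_h (signed (fst (xs ! 0))) (fst (xs ! 1)) else 0,
     move_sum (twist True) (derived True) xs + move_sum (twist False) (derived False) xs)"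

lemma Hom_total_if_parity:
  fixes f :: "'w list \<Rightarrow> ('a \<times> 'm) list \<Rightarrow> 'a \<times> 'm"
  assumes "f \<in> Hom_total" "\<And>\<alpha> vs. length \<alpha> = length vs \<Longrightarrow> g \<alpha> vs = \<phi> (length \<alpha>) (f \<alpha> vs)"
    and "\<And>\<alpha> vs. length \<alpha> \<noteq> length vs \<Longrightarrow> g \<alpha> vs = 0" and "\<And>n. lin (\<phi> n)"
  shows "g \<in> Hom_total"
proof -
  have 0: "\<phi> n 0 = 0" for n using assms(4)[of n] unfolding lin_def by (metis scale_zero_left)
  have ev: "ev g zs = \<phi> (length zs) (ev f zs)" for zs by (simp add: ev_def assms(2))
  have "lin (\<lambda>x. ev g (us @ [(a, x)] @ ts))" for us a ts
    unfolding ev using lin_compose[OF assms(4) slot_linearD[OF Hom_total_slot_linear[OF assms(1)]]]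
    by simp
  moreover have "g [] vs = 0" for vs
    using assms(1) assms(2,3)[of "[]" vs] 0 by (cases "vs = []") (auto simp: Hom_total_def)
  ultimately show ?thesis using assms(3) by (auto simp: Hom_total_def slot_linear_def)
qed

lemma lin_if: "lin (\<lambda>x. if b then x else 0)" "lin (\<lambda>x. if b then x else flip k x)"
  by (cases b; simp add: lin_def flip_def del: split_paired_All)+

lemma const_coll_parity_part_total:
  "(const_coll q :: 'w list \<Rightarrow> _) \<in> Hom_total \<Longrightarrow> (const_coll (parity_part \<epsilon> q) :: 'w list \<Rightarrow> _) \<in> Hom_total"
  by (erule Hom_total_if_parity[where \<phi> = "\<lambda>n x. if even n = \<epsilon> then x else 0"])
    (auto simp: const_coll_def parity_part_def lin_if)

lemma const_coll_signed_total:
  "(const_coll q :: 'w list \<Rightarrow> _) \<in> Hom_total \<Longrightarrow> (const_coll (signed q) :: 'w list \<Rightarrow> _) \<in> Hom_total"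
  by (erule Hom_total_if_parity[where \<phi> = "\<lambda>n x. if False then x else flip (int n + 1) x"])
    (auto simp: const_coll_def signed_def lin_if simp del: if_False)

lemma twist_total: "x \<in> sha_total \<Longrightarrow> twist \<epsilon> x \<in> sha_total"
proof -
  have "(\<lambda>\<alpha> vs. if \<epsilon> then p \<alpha> vs else flip (int (length \<alpha>) + 1) (p \<alpha> vs)) \<in> Hom_total"
    if "p \<in> Hom_total" for p :: "'w list \<Rightarrow> ('a \<times> 'm) list \<Rightarrow> 'a \<times> 'm"
    using that by (rule Hom_total_if_parity[where \<phi> = "\<lambda>n x. if \<epsilon> then x else flip (int n + 1) x"])
      (use that in \<open>auto simp: Hom_total_def lin_if\<close>)
  then show "x \<in> sha_total \<Longrightarrow> twist \<epsilon> x \<in> sha_total" 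
    by (auto simp: sha_total_def twist_def cong: if_cong)
qed

lemma sha_scale_eq: "sha_scale scale c x = (scale_fun scale c (fst x), scale_fun (scale_fun scale) c (snd x))"
  by (cases x) (simp add: sha_scale_Pair)

lemma twist_linear: "linear_on (sha_scale scale) (sha_scale scale) W (twist \<epsilon>)"
  by (auto simp: linear_on_def twist_def sha_scale_eq scale_fun_def fun_eq_iff flip_add flip_scale)

lemma foldl_bracket_total:
  "f \<in> Hom_total \<Longrightarrow> set ps \<subseteq> Hom_total \<Longrightarrow> foldl (bracket scale) f ps \<in> Hom_total"
  by (induction ps arbitrary: f) (auto simp: bracket_in_Hom_total)

lemma foldl_bracket_add:
  "set ps \<subseteq> Hom_total \<Longrightarrow> foldl (bracket scale) (f + g) ps = foldl (bracket scale) f ps + foldl (bracket scale) g ps"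
  by (induction ps arbitrary: f g) (auto simp: bracket_add_left Hom_total_slot_linear)

lemma foldl_bracket_scale:
  "set ps \<subseteq> Hom_total \<Longrightarrow> foldl (bracket scale) (scale_fun (scale_fun scale) c f) ps
    = scale_fun (scale_fun scale) c (foldl (bracket scale) f ps)"
  by (induction ps arbitrary: f) (auto simp: bracket_scale_left Hom_total_slot_linear)

lemma foldl_bracket_0:
  "set ps \<subseteq> Hom_total \<Longrightarrow> foldl (bracket scale) 0 ps = 0"
  using foldl_bracket_add[of ps 0 0] by simp

lemma sha_total_iff:
  "x \<in> sha_total \<longleftrightarrow> (const_coll (fst x) :: 'w::semigroup_mult list \<Rightarrow> _) \<in> Hom_total \<and>
    proj_a (const_coll (fst x) :: 'w list \<Rightarrow> _) = 0 \<and> (snd x :: 'w list \<Rightarrow> _) \<in> Hom_total"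
  by (cases x) (simp add: sha_total_def)

lemma derived_multilinear:
  "multilinear_on (sha_scale scale) (scale_fun (scale_fun scale)) sha_total n
    (derived \<epsilon> :: ('w::semigroup_mult, 'a, 'm) sha list \<Rightarrow> _)"
  unfolding multilinear_on_iff
proof (intro allI impI)
  fix xs :: "('w, 'a, 'm) sha list" and i
  assume "length xs = n \<and> set xs \<subseteq> sha_total \<and> i < n"
  then obtain z zs where xs: "xs = z # zs" "z \<in> sha_total" "set zs \<subseteq> sha_total" "i < Suc (length zs)"
    by (cases xs) auto
  let ?ps = "map snd zs"
  have ps: "set ?ps \<subseteq> Hom_total" using xs(3) by (auto simp: sha_total_def)
  show "linear_on (sha_scale scale) (scale_fun (scale_fun scale)) sha_total (\<lambda>x. derived \<epsilon> (xs[i := x]))"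
  proof (cases i)
    case 0
    have part: "parity_part \<epsilon> (q + r) = parity_part \<epsilon> q + parity_part \<epsilon> r"
      "parity_part \<epsilon> (scale_fun scale c q) = scale_fun scale c (parity_part \<epsilon> q)" for q r c
      by (auto simp: parity_part_def scale_fun_def)
    show ?thesis
      using 0 xs ps by (simp add: linear_on_def derived_def part const_coll_add const_coll_scale
          sha_scale_eq foldl_bracket_add foldl_bracket_scale proj_a_add proj_a_scale)
  next
    case (Suc j)
    let ?X = "foldl (bracket scale) (const_coll (parity_part \<epsilon> (fst z))) (take j ?ps)"
    have "(const_coll (fst z) :: 'w list \<Rightarrow> _) \<in> Hom_total" using xs(2) by (simp add: sha_total_iff)
    then have X: "slot_linear ?X"
      using ps set_take_subset[of j ?ps]
      by (intro Hom_total_slot_linear foldl_bracket_total const_coll_parity_part_total) auto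
    have drop: "set (drop (Suc j) ?ps) \<subseteq> Hom_total" using ps set_drop_subset[of "Suc j" ?ps] by blast
    have "derived \<epsilon> (xs[i := x]) = proj_a (foldl (bracket scale) (bracket scale ?X (snd x)) (drop (Suc j) ?ps))" for x
      using xs Suc by (simp add: derived_def map_update upd_conv_take_nth_drop take_map drop_map)
    then show ?thesis
      using drop by (simp add: linear_on_def sha_scale_eq bracket_add_right[OF X] bracket_scale_right[OF X]
          foldl_bracket_add foldl_bracket_scale proj_a_add proj_a_scale)
  qed
qed

lemma bracket_h_linear:
  assumes "(const_coll q :: nat list \<Rightarrow> _) \<in> Hom_total"
  shows "bracket_h (f + g) q = bracket_h f q + bracket_h g q" "bracket_h q (f + g) = bracket_h q f + bracket_h q g"
    "bracket_h (scale_fun scale c f) q = scale_fun scale c (bracket_h f q)"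
    "bracket_h q (scale_fun scale c f) = scale_fun scale c (bracket_h q f)"
proof -
  have inj: "const_coll f = (const_coll g :: nat list \<Rightarrow> _) \<Longrightarrow> f = g" for f g
    by (simp only: const_coll_inject)
  note q = Hom_total_slot_linear[OF assms]
  show "bracket_h (f + g) q = bracket_h f q + bracket_h g q" "bracket_h q (f + g) = bracket_h q f + bracket_h q g"
    "bracket_h (scale_fun scale c f) q = scale_fun scale c (bracket_h f q)"
    "bracket_h q (scale_fun scale c f) = scale_fun scale c (bracket_h q f)"
    by (rule inj, simp only: const_coll_bracket_h const_coll_add const_coll_scale bracket_add_left[OF q]
        bracket_add_right[OF q] bracket_scale_left[OF q] bracket_scale_right[OF q])+
qed

lemma const_coll_total_any:
  "(const_coll q :: 'w list \<Rightarrow> _) \<in> Hom_total \<Longrightarrow> (const_coll q :: 'x list \<Rightarrow> _) \<in> Hom_total"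
proof -
  assume q: "(const_coll q :: 'w list \<Rightarrow> _) \<in> Hom_total"
  have "lin (\<lambda>x. ev (const_coll q) (us @ [(a, x)] @ ts))" for us ts and a :: 'x
    using slot_linearD[OF Hom_total_slot_linear[OF q], of "map (map_prod (\<lambda>_. undefined) id) us" undefined
        "map (map_prod (\<lambda>_. undefined) id) ts"]
    by (simp add: ev_const_coll comp_def)
  moreover have "q [] = 0" using q by (auto simp: Hom_total_def const_coll_def split: if_splits)
  ultimately show "(const_coll q :: 'x list \<Rightarrow> _) \<in> Hom_total"
    by (auto simp: Hom_total_def slot_linear_def const_coll_def)
qed

lemma linear_on_Pair:
  "linear_on s (scale_fun scale) W \<phi> \<Longrightarrow> linear_on s (scale_fun (scale_fun scale)) W \<psi> \<Longrightarrow>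
    linear_on s (sha_scale scale) W (\<lambda>x. (\<phi> x, \<psi> x))"
  unfolding linear_on_def plus_prod_def fst_conv snd_conv sha_scale_Pair prod.inject by blast

lemma linear_on_0: "linear_on s (scale_fun scale) W (\<lambda>x. 0)"
  by (simp add: linear_on_def scale_fun_0)

lemma sha_l_multilinear:
  "multilinear_on (sha_scale scale) (sha_scale scale) sha_total k
    (sha_l k :: ('w::semigroup_mult, 'a, 'm) sha list \<Rightarrow> _)"
proof -
  have mod: "module (scale_fun (scale_fun scale))"
    using vector_space_scale_fun[OF vector_space_scale_fun, of scale] vector_space_axioms
    by (simp add: module_iff_vector_space)
  have a: "multilinear_on (sha_scale scale) (scale_fun (scale_fun scale)) sha_total k
      (move_sum (twist \<epsilon>) (derived \<epsilon>) :: ('w, 'a, 'm) sha list \<Rightarrow> _)" for \<epsilon>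
    by (rule multilinear_on_move_sum[OF twist_total twist_linear mod derived_multilinear])
  have h: "linear_on (sha_scale scale) (scale_fun scale) sha_total
      (\<lambda>x. bracket_h (signed (fst (xs[i := x] ! 0))) (fst (xs[i := x] ! 1)))"
    if len: "length xs = 2" and xs_total: "set xs \<subseteq> sha_total" and i: "i < 2" for xs :: "('w, 'a, 'm) sha list" and i
  proof -
    obtain x y where xs: "xs = [x, y]" using len by (cases xs; cases "tl xs") auto
    have total: "(const_coll (signed (fst x)) :: nat list \<Rightarrow> _) \<in> Hom_total" "(const_coll (fst y) :: nat list \<Rightarrow> _) \<in> Hom_total"
      using xs_total xs const_coll_total_any const_coll_signed_total by (auto simp: sha_total_iff)
    have signed: "signed (f + g) = signed f + signed g" "signed (scale_fun scale c f) = scale_fun scale c (signed f)" for f g c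
      by (simp_all add: signed_def fun_eq_iff scale_fun_def flip_add flip_scale)
    have "i = 0 \<or> i = 1" using i by auto
    then show ?thesis
      using bracket_h_linear[OF total(1)] bracket_h_linear[OF total(2)]
      by (elim disjE) (simp_all add: linear_on_def xs signed sha_scale_eq)
  qed
  show ?thesis unfolding multilinear_on_iff
  proof (intro allI impI)
    fix xs :: "('w, 'a, 'm) sha list" and i
    assume *: "length xs = k \<and> set xs \<subseteq> sha_total \<and> i < k"
    have "linear_on (sha_scale scale) (scale_fun (scale_fun scale)) sha_total
        (\<lambda>x. move_sum (twist \<epsilon>) (derived \<epsilon>) (xs[i := x]))" for \<epsilon>
      using a[of \<epsilon>] * unfolding multilinear_on_iff by blast
    moreover have "linear_on (sha_scale scale) (scale_fun scale) sha_total
        (\<lambda>x. if k = 2 then bracket_h (signed (fst (xs[i := x] ! 0))) (fst (xs[i := x] ! 1)) else 0)"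
      using h[of xs i] * by (cases "k = 2") (simp_all add: linear_on_0)
    ultimately show "linear_on (sha_scale scale) (sha_scale scale) sha_total (\<lambda>x. sha_l k (xs[i := x]))"
      unfolding sha_l_def by (intro linear_on_Pair linear_on_add[OF mod])
  qed
qed

lemma twist_Hom_a:
  assumes "p \<in> Hom_a d"
  shows "twist \<epsilon> (q, p) = (q, flip (if \<epsilon> then 0 else d) p)"
proof -
  have eq: "(if \<epsilon> then p \<alpha> vs else flip (int (length \<alpha>) + 1) (p \<alpha> vs)) = flip (if \<epsilon> then 0 else d) p \<alpha> vs" for \<alpha> vs
  proof (cases "int (length \<alpha>) = d + 1")
    case True
    then show ?thesis by (auto simp: flip_fun_apply intro: flip_cong)
  next
    case False
    then show ?thesis using assms by (simp add: flip_fun_apply Hom_a_def Hom_degree_def)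
  qed
  show ?thesis by (simp only: twist_def fst_conv snd_conv eq)
qed

lemma Hom_h_support: "q \<in> Hom_h n \<Longrightarrow> int (length vs) \<noteq> n + 1 \<Longrightarrow> q vs = 0"
  by (erule Hom_h_cases) (auto simp: space_h'_eq Hom_pow_def)

lemma parity_part_Hom_h:
  assumes "q \<in> Hom_h (d + 1)"
  shows "parity_part \<epsilon> q = (if even d = \<epsilon> then q else 0)"
proof
  fix vs
  show "parity_part \<epsilon> q vs = (if even d = \<epsilon> then q else 0) vs"
  proof (cases "int (length vs) = d + 2")
    case True
    then have "even (length vs) = even d" by presburger
    then show ?thesis by (simp add: parity_part_def)
  next
    case False
    then show ?thesis using Hom_h_support[OF assms, of vs] by (simp add: parity_part_def)
  qed
qed

lemma signed_Hom_h:
  assumes "q \<in> Hom_h (d + 1)"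
  shows "signed q = flip (d + 1) q"
proof
  fix vs
  show "signed q vs = flip (d + 1) q vs"
  proof (cases "int (length vs) = d + 2")
    case True
    then show ?thesis by (simp add: signed_def flip_fun_apply) (rule flip_cong, simp)
  next
    case False
    then show ?thesis using Hom_h_support[OF assms, of vs] by (simp add: signed_def flip_fun_apply)
  qed
qed

lemma sha_l_eq_lie_l:
  fixes zs :: "(int \<times> ('w::semigroup_mult, 'a, 'm) sha) list"
  assumes "set zs \<subseteq> derived_brackets.good Hom_a Hom_h"
  shows "sha_l (length zs) (map snd zs)
    = derived_brackets.lie_l (bracket scale) proj_a const_coll bracket_h zs"
proof -
  interpret D: derived_brackets "Hom_degree :: int \<Rightarrow> ('w list \<Rightarrow> ('a \<times> 'm) list \<Rightarrow> 'a \<times> 'm) set"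
    "bracket scale" Hom_a proj_a Hom_h const_coll bracket_h
    by (rule derived_brackets)
  let ?\<phi> = "\<lambda>\<epsilon> y us. if even (fst y) = \<epsilon> then proj_a (D.iter (const_coll (fst (snd y))) us) else 0"
  have twist_good: "(d, twist \<epsilon> x) \<in> D.good" if "(d, x) \<in> D.good" for d x \<epsilon>
    using that by (cases x) (auto simp: twist_Hom_a intro: D.A_flip)
  have move: "move_sum (twist \<epsilon>) (derived \<epsilon>) (map snd zs) = unshuffle_sum zs (\<lambda>S T. if length S = 1 then ?\<phi> \<epsilon> (hd S) T else 0)" for \<epsilon>
  proof (rule move_sum_eq_unshuffle_sum[OF twist_good assms])
    fix y us assume good: "set (y # us) \<subseteq> D.good"
    obtain d q p where y: "y = (d, q, p)" by (metis prod.exhaust)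
    have "q \<in> Hom_h (d + 1)" using good y by simp
    moreover have "foldl (bracket scale) f (map (snd \<circ> snd) us) = D.iter f us" for f by (simp add: D.iter_def)
    ultimately show "derived \<epsilon> (map snd (y # us)) = ?\<phi> \<epsilon> y us"
      using D.iter_0[of us] good by (simp add: derived_def y parity_part_Hom_h)
  next
    fix y us d x ts assume good: "set (y # us @ (d, x) # ts) \<subseteq> D.good"
    obtain e q p where y: "y = (e, q, p)" by (metis prod.exhaust)
    obtain r s where x: "x = (r, s)" by force
    have c: "const_coll q \<in> Hom_degree (e + 1)" and s: "s \<in> Hom_a d" and us: "set (us @ ts) \<subseteq> D.good"
      using good by (auto simp: x y intro: const_coll_Hom_h)
    have "D.iter (const_coll q) (us @ (d, r, s) # ts) \<in> Hom_degree (e + 1 + deg (us @ (d, r, s) # ts))"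
      using good by (intro D.iter_closed c) (auto simp: x)
    then have "proj_a (D.iter (const_coll q) (us @ (d, r, flip k s) # ts)) =
        flip k (proj_a (D.iter (const_coll q) (us @ (d, r, s) # ts)))" for k
      unfolding D.iter_flip_slot[OF c us s] by (rule D.P_flip)
    moreover have "flip (if even e then 0 else d) z = flip (d * e) z" for z :: "'w list \<Rightarrow> ('a \<times> 'm) list \<Rightarrow> 'a \<times> 'm"
      by (cases "even e") (auto simp: flip_def)
    ultimately show "?\<phi> \<epsilon> y (us @ (d, twist \<epsilon> x) # ts) = flip (d * fst y) (?\<phi> \<epsilon> y (us @ (d, x) # ts))"
      by (cases "even e = \<epsilon>") (simp_all add: x y twist_Hom_a[OF s])
  qed
  have "move_sum (twist True) (derived True) (map snd zs) + move_sum (twist False) (derived False) (map snd zs) = D.l_a zs"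
    unfolding move unshuffle_sum_add[symmetric] D.l_a_def
    by (intro unshuffle_sum_cong) (auto simp: D.summand_def)
  moreover have "bracket_h (signed (fst (map snd zs ! 0))) (fst (map snd zs ! 1)) = D.l_h zs" if len: "length zs = 2"
  proof -
    obtain d q p e r s where zs: "zs = [(d, q, p), (e, r, s)]"
      using len by (cases zs; cases "tl zs") auto
    have q: "q \<in> Hom_h (d + 1)" "r \<in> Hom_h (e + 1)" using assms zs by auto
    show ?thesis using D.hb_flip_left[OF q] by (simp add: zs signed_Hom_h[OF q(1)] D.l_h_def)
  qed
  moreover have "D.l_h zs = 0" if "length zs \<noteq> 2" using that by (simp add: D.l_h_def)
  ultimately show ?thesis by (auto simp: sha_l_def D.lie_l_def)
qed

lemma scale_koszul_sign:
  assumes "length ds = n"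
  shows "sha_scale scale (koszul_sign \<sigma> ds) x = flip (koszul_exp ((!) ds) (map \<sigma> [0..<n])) x"
proof -
  interpret S: vector_space "sha_scale scale" by (rule vector_space_sha)
  show ?thesis by (simp add: koszul_sign_eq[OF assms] flip_def)
qed

lemma L_infinity_algebra_sha:
  "L_infinity_algebra (sha_scale scale) (sha_space scale) (sha_l :: nat \<Rightarrow> ('w::semigroup_mult, 'a, 'm) sha list \<Rightarrow> _)"
proof -
  interpret D: derived_brackets "Hom_degree :: int \<Rightarrow> ('w list \<Rightarrow> ('a \<times> 'm) list \<Rightarrow> 'a \<times> 'm) set"
    "bracket scale" Hom_a proj_a Hom_h const_coll bracket_h
    by (rule derived_brackets)
  interpret S: graded_vector_space "sha_scale scale" "sha_space scale :: int \<Rightarrow> ('w, 'a, 'm) sha set"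
    by (rule graded_vector_space_sha)
  have good_iff: "(d, x) \<in> D.good \<longleftrightarrow> x \<in> sha_space scale d" for d x
    by (cases x) (simp add: sha_space_eq)
  have zip: "set (zip ds xs) \<subseteq> D.good \<and> map snd (zip ds xs) = xs \<and> map fst (zip ds xs) = ds
      \<and> length (zip ds xs) = length xs"
    if "S.homogeneous ds xs" for ds xs
    using that unfolding S.homogeneous_def
    by (auto simp: list_all2_iff good_iff split_beta)
  have l: "sha_l k (map snd zs) = D.lie_l zs" if "set zs \<subseteq> D.good" "length zs = k" for zs k
    using sha_l_eq_lie_l[OF that(1)] that(2) by simp
  show ?thesis
  proof (intro L_infinity_algebra.intro S.graded_vector_space_axioms L_infinity_algebra_axioms.intro)
    fix k :: nat
    show "multilinear_on (sha_scale scale) (sha_scale scale) S.total k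
        (sha_l k :: ('w, 'a, 'm) sha list \<Rightarrow> _)"
      using sha_l_multilinear total_subset by (rule multilinear_on_mono)
    fix ds and xs :: "('w, 'a, 'm) sha list" assume len: "length xs = k" and hom: "S.homogeneous ds xs"
    obtain zs where zs: "set zs \<subseteq> D.good" "map snd zs = xs" "map fst zs = ds" "length zs = k"
      using zip[OF hom] unfolding len by blast
    have lds: "length ds = k" using zs(3,4) by (metis length_map)
    have lxs: "sha_l k xs = D.lie_l zs" using l[OF zs(1,4)] zs(2) by simp
    show "sha_l k xs \<in> sha_space scale (sum_list ds + 1)"
      using D.lie_l_closed[OF zs(1)] zs(3) lxs by (simp add: sha_space_eq deg_def add.assoc)
    show "sha_l k (permute_range \<sigma> xs 0 k) = sha_scale scale (koszul_sign \<sigma> ds) (sha_l k xs)"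
      if \<sigma>: "\<sigma> permutes {..<k}" for \<sigma>
    proof -
      have "permute_range \<sigma> xs 0 k = map snd (permute_range \<sigma> zs 0 k)"
        using permute_range_map(1)[of \<sigma> zs k snd 0] zs \<sigma> by simp
      moreover have "sha_l k (map snd (permute_range \<sigma> zs 0 k)) = D.lie_l (permute_range \<sigma> zs 0 k)"
        using permute_range_map(2)[of \<sigma> zs k 0] zs \<sigma> by (intro l) (auto simp: permute_range_def)
      moreover have "D.lie_l (permute_range \<sigma> zs 0 k) = flip (koszul_exp ((!) ds) (map \<sigma> [0..<k])) (D.lie_l zs)"
        using permute_signed[of D.good D.lie_l, OF D.lie_l_swap zs(1,4) \<sigma>] zs(3) by simp
      ultimately show ?thesis by (simp add: lxs scale_koszul_sign[OF lds])
    qed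
    assume "1 \<le> k"
    have jacobi: "sha_scale scale (koszul_sign \<sigma> ds) (sha_l j (sha_l i (permute_range \<sigma> xs 0 i) # permute_range \<sigma> xs i k))
        = flip (koszul_exp ((!) ds) (map \<sigma> [0..<k])) (D.jacobi_term (permute_range \<sigma> zs 0 i) (permute_range \<sigma> zs i k))"
      if ij: "1 \<le> i" "1 \<le> j" "i + j = k + 1" and \<sigma>: "\<sigma> \<in> shuffle_perms i (k - i)" for i j \<sigma>
    proof -
      have i: "i \<le> k" "j = k + 1 - i" using ij by auto
      have perm: "\<sigma> permutes {..<length zs}" using \<sigma> i zs(4) by (simp add: shuffle_perms_def)
      let ?S = "permute_range \<sigma> zs 0 i" and ?T = "permute_range \<sigma> zs i k"
      have snd: "permute_range \<sigma> xs 0 i = map snd ?S" "permute_range \<sigma> xs i k = map snd ?T"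
        using permute_range_map(1)[OF perm, of i snd 0] permute_range_map(1)[OF perm, of k snd i] zs i by simp_all
      have good: "set ?S \<subseteq> D.good" "set ?T \<subseteq> D.good"
        using permute_range_map(2)[OF perm, of i 0] permute_range_map(2)[OF perm, of k i] zs i by auto
      have len: "length ?S = i" "length ?T = k - i" by (simp_all add: permute_range_def)
      have "sha_l i (map snd ?S) = D.lie_l ?S" by (rule l[OF good(1) len(1)])
      moreover have "sha_l j (map snd ((deg ?S + 1, D.lie_l ?S) # ?T)) = D.lie_l ((deg ?S + 1, D.lie_l ?S) # ?T)"
        using good D.good_lie_l[OF good(1)] len i by (intro l) auto
      moreover have "?S \<noteq> []" using len ij by auto
      ultimately show ?thesis unfolding scale_koszul_sign[OF lds] snd by (simp add: D.jacobi_term_def)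
    qed
    let ?f = "\<lambda>i \<sigma>. flip (koszul_exp ((!) ds) (map \<sigma> [0..<k])) (D.jacobi_term (permute_range \<sigma> zs 0 i) (permute_range \<sigma> zs i k))"
    have "(\<Sum>(i, j) \<in> {(i, j). i \<ge> 1 \<and> j \<ge> 1 \<and> i + j = k + 1}. \<Sum>\<sigma> \<in> shuffle_perms i (k - i).
         sha_scale scale (koszul_sign \<sigma> ds) (sha_l j (sha_l i (permute_range \<sigma> xs 0 i) # permute_range \<sigma> xs i k)))
      = (\<Sum>i\<in>{1..k}. \<Sum>\<sigma>\<in>shuffle_perms i (k - i). ?f i \<sigma>)"
      by (rule sum.reindex_bij_witness[where i = "\<lambda>i. (i, k + 1 - i)" and j = fst]) (auto intro!: sum.cong simp: jacobi)
    also have "\<dots> = (\<Sum>i\<le>k. \<Sum>\<sigma>\<in>shuffle_perms i (k - i). ?f i \<sigma>)"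
      by (rule sum.mono_neutral_left) (auto simp: permute_range_def D.jacobi_term_def intro!: sum.neutral)
    also have "\<dots> = D.jacobiator zs"
      unfolding D.jacobiator_def using sum_shuffles_eq_unshuffle_sum[OF zs(4), of D.jacobi_term] zs(3) by simp
    also have "\<dots> = 0" by (rule D.jacobiator_eq_0[OF zs(1)])
    finally show "(\<Sum>(i, j) \<in> {(i, j). i \<ge> 1 \<and> j \<ge> 1 \<and> i + j = k + 1}. \<Sum>\<sigma> \<in> shuffle_perms i (k - i).
         sha_scale scale (koszul_sign \<sigma> ds) (sha_l j (sha_l i (permute_range \<sigma> xs 0 i) # permute_range \<sigma> xs i k))) = 0" .
  qed
qed

lemma sha_l_h_h:
  assumes q: "q \<in> space_h' scale m" and r: "r \<in> space_h' scale n"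
  shows "sha_l 2 [in_h q, in_h r] = sha_scale scale ((-1) ^ m)
    (in_h (bracket_h q r) :: ('w::semigroup_mult, 'a, 'm) sha)"
proof -
  interpret D: derived_brackets "Hom_degree :: int \<Rightarrow> ('w list \<Rightarrow> ('a \<times> 'm) list \<Rightarrow> 'a \<times> 'm) set"
    "bracket scale" Hom_a proj_a Hom_h const_coll bracket_h
    by (rule derived_brackets)
  interpret S: vector_space "sha_scale scale :: _ \<Rightarrow> ('w, 'a, 'm) sha \<Rightarrow> _" by (rule vector_space_sha)
  have qr: "q \<in> Hom_h (int m - 1 + 1)" "r \<in> Hom_h (int n - 1 + 1)" using q r by simp_all
  have "set [(int m - 1, q, 0), (int n - 1, r, 0)] \<subseteq> D.good" using qr by (simp add: Hom_a_0)
  from sha_l_eq_lie_l[OF this]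
  have "sha_l 2 [in_h q, in_h r] = D.lie_l [(int m - 1, q, 0), (int n - 1, r, 0)]"
    by (simp add: in_h_def numeral_2_eq_2)
  also have "\<dots> = flip (int m) (in_h (bracket_h q r))"
    using D.lie_l_hh[OF qr] by (simp add: in_h_def flip_Pair)
  finally show ?thesis by (simp only: S.scale_minus_one_power)
qed

lemma sha_l_h_a:
  fixes ps :: "('w::semigroup_mult list \<Rightarrow> ('a \<times> 'm) list \<Rightarrow> 'a \<times> 'm) list"
  assumes q: "q \<in> space_h' scale m" and ps: "set ps \<subseteq> (\<Union>n. space_a scale n)"
  shows "sha_l (length ps + 1) (in_h q # map in_a ps) = in_a (proj_a (foldl (bracket scale) (const_coll q) ps))"
proof -
  interpret D: derived_brackets "Hom_degree :: int \<Rightarrow> ('w list \<Rightarrow> ('a \<times> 'm) list \<Rightarrow> 'a \<times> 'm) set"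
    "bracket scale" Hom_a proj_a Hom_h const_coll bracket_h
    by (rule derived_brackets)
  have "\<forall>p\<in>set ps. \<exists>n. p \<in> Hom_a n" using ps by (auto simp: space_a_eq)
  then obtain d where d: "\<forall>p\<in>set ps. p \<in> Hom_a (d p)" by metis
  let ?zs = "map (\<lambda>p. (d p, 0, p)) ps"
  have good: "set ((int m - 1, q, 0) # ?zs) \<subseteq> D.good" "\<forall>z\<in>set ?zs. D.is_a z"
    using q d by (auto simp: Hom_h_0 Hom_a_0 D.is_a_def)
  have eq: "map snd ((int m - 1, q, 0) # ?zs) = in_h q # map in_a ps"
    by (simp add: in_h_def in_a_def[abs_def] comp_def)
  have "sha_l (length ps + 1) (in_h q # map in_a ps) = D.lie_l ((int m - 1, q, 0) # ?zs)"
    using sha_l_eq_lie_l[OF good(1), unfolded eq] by simp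
  also have "\<dots> = (0, proj_a (D.iter (const_coll q) ?zs))" by (rule D.lie_l_h_Cons[OF good])
  finally show ?thesis by (simp add: in_a_def D.iter_def comp_def)
qed

lemma sha_l_single: "x \<in> sha_total \<Longrightarrow> sha_l 1 [x] = 0"
proof -
  assume x: "x \<in> sha_total"
  have "fst (fst x (map (\<lambda>v. (0, snd v)) vs)) = 0" for vs :: "('a \<times> 'm) list"
  proof -
    have "proj_a (const_coll (fst x)) (replicate (length vs) (undefined :: 'b)) vs = 0"
      using x unfolding sha_total_iff by simp
    then show ?thesis by (simp add: proj_a_def const_coll_def zero_prod_def)
  qed
  then have "derived \<epsilon> [x] = 0" for \<epsilon>
    by (auto simp: derived_def proj_a_def const_coll_def parity_part_def fun_eq_iff zero_prod_def split: if_splits)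
  then show "sha_l 1 [x] = 0" by (simp add: sha_l_def zero_prod_def)
qed

lemma sha_l_in_a:
  fixes xs :: "('w::semigroup_mult, 'a, 'm) sha list"
  assumes "length xs = k" "set xs \<subseteq> sha_total" "\<forall>x\<in>set xs. x \<in> range in_a"
  shows "sha_l k xs = 0"
proof -
  have fst: "fst x = 0" if "x \<in> set xs" for x using assms(3) that by (auto simp: in_a_def)
  have "derived \<epsilon> (y # ys) = 0" if "y \<in> set xs" "set ys \<subseteq> sha_total" for \<epsilon> y ys
  proof -
    have "set (map snd ys) \<subseteq> Hom_total" using that(2) by (auto simp: sha_total_def)
    moreover have "parity_part \<epsilon> 0 = 0" by (auto simp: parity_part_def)
    ultimately show ?thesis using fst[OF that(1)] by (simp add: derived_def foldl_bracket_0)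
  qed
  then have "move_sum (twist \<epsilon>) (derived \<epsilon>) xs = 0" for \<epsilon>
    by (intro move_sum_eq_0[OF twist_total assms(2)])
  moreover have "bracket_h (signed (fst (xs ! 0))) (fst (xs ! 1)) = 0" if "k = 2"
  proof -
    have "fst (xs ! 0) = 0" "fst (xs ! 1) = 0" using fst that assms(1) by auto
    moreover have "signed 0 = 0" by (simp add: signed_def fun_eq_iff)
    moreover have "bracket_h 0 0 = 0"
      using bracket_h_linear(1)[of 0 0 0] by (simp add: Hom_total_0)
    ultimately show ?thesis by simp
  qed
  ultimately show ?thesis by (simp add: sha_l_def zero_prod_def)
qed

lemma derived_eq_0:
  fixes y :: "('w::semigroup_mult, 'a, 'm) sha"
  assumes "y \<in> sha_total" "set ys \<subseteq> sha_total" "z \<in> set ys" "snd z = 0"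
  shows "derived \<epsilon> (y # ys) = 0"
proof -
  obtain us ts where ys: "ys = us @ z # ts" using assms(3) by (meson split_list)
  have "set (map snd us) \<subseteq> Hom_total" "set (map snd ts) \<subseteq> Hom_total"
    using assms(2) ys by (auto simp: sha_total_def)
  moreover have "foldl (bracket scale) (const_coll (parity_part \<epsilon> (fst y))) (map snd us) \<in> Hom_total"
    using assms(1) calculation(1)
    by (intro foldl_bracket_total const_coll_parity_part_total) (auto simp: sha_total_iff)
  ultimately show ?thesis
    using assms(4) by (simp add: derived_def ys bracket_0_right foldl_bracket_0)
qed

lemma move_sum_derived_eq_0:
  fixes xs :: "('w::semigroup_mult, 'a, 'm) sha list" and K :: "('w, 'a, 'm) sha list \<Rightarrow> 'v::ab_group_add"
  assumes "\<And>y ys z. y \<in> sha_total \<Longrightarrow> set ys \<subseteq> sha_total \<Longrightarrow> z \<in> set ys \<Longrightarrow> snd z = 0 \<Longrightarrow> K (y # ys) = 0"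
    and "set xs \<subseteq> sha_total" "length (filter (\<lambda>x. snd x = 0) xs) \<ge> 2"
  shows "move_sum (twist \<epsilon>) K xs = 0"
  using assms
proof (induction xs arbitrary: K)
  case (Cons x xs)
  have twist: "snd (twist \<epsilon> x) = 0" if "snd x = 0"
    using that by (simp add: twist_def fun_eq_iff)
  have "\<exists>z\<in>set xs. p z" if "2 \<le> length (filter p (x # xs))" for p
    using that by (cases "filter p xs") (auto simp: filter_eq_Cons_iff split: if_splits)
  from this[OF Cons.prems(3)]
  obtain z where "z \<in> set xs" "snd z = 0" ..
  then have K: "K (x # xs) = 0" using Cons.prems(1)[of x xs z] Cons.prems(2) by simp
  have twist_x: "twist \<epsilon> x \<in> sha_total" using Cons.prems(2) by (simp add: twist_total)
  have "move_sum (twist \<epsilon>) (\<lambda>ys. K (hd ys # twist \<epsilon> x # tl ys)) xs = 0"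
  proof (cases "snd x = 0")
    case True
    show ?thesis
    proof (rule move_sum_eq_0[OF twist_total])
      fix y and ys :: "('w, 'a, 'm) sha list" assume "y \<in> set xs" "set ys \<subseteq> sha_total"
      then show "K (hd (y # ys) # twist \<epsilon> x # tl (y # ys)) = 0"
        using Cons.prems(1)[of y "twist \<epsilon> x # ys" "twist \<epsilon> x"] Cons.prems(2) twist_x twist[OF True] by auto
    qed (use Cons.prems(2) in auto)
  next
    case False
    show ?thesis
    proof (rule Cons.IH)
      fix y z :: "('w, 'a, 'm) sha" and ys assume "y \<in> sha_total" "set ys \<subseteq> sha_total" "z \<in> set ys" "snd z = 0"
      then show "K (hd (y # ys) # twist \<epsilon> x # tl (y # ys)) = 0"
        using Cons.prems(1)[of y "twist \<epsilon> x # ys" z] twist_x by auto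
    next
      have "2 \<le> length (filter p xs)" if "2 \<le> length (filter p (x # xs))" "\<not> p x" for p
        using that by simp
      from this[OF Cons.prems(3) False] show "2 \<le> length (filter (\<lambda>x. snd x = 0) xs)" .
    qed (use Cons.prems(2) in auto)
  qed
  then show ?case using K by simp
qed simp

lemma sha_l_two_h:
  fixes xs :: "('w::semigroup_mult, 'a, 'm) sha list"
  assumes "k \<ge> 3" "length xs = k" "set xs \<subseteq> sha_total"
    and ij: "i < j" "j < k" "xs ! i \<in> range in_h" "xs ! j \<in> range in_h"
  shows "sha_l k xs = 0"
proof -
  have "{i, j} \<subseteq> {r. r < length xs \<and> snd (xs ! r) = 0}" using ij assms(2) by (auto simp: in_h_def)
  then have "card {i, j} \<le> length (filter (\<lambda>x. snd x = 0) xs)"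
    unfolding length_filter_conv_card by (intro card_mono) auto
  then have "2 \<le> length (filter (\<lambda>x. snd x = 0) xs)" using ij(1) by simp
  then have "move_sum (twist \<epsilon>) (derived \<epsilon>) xs = 0" for \<epsilon>
    using derived_eq_0 assms(3) by (intro move_sum_derived_eq_0)
  then show ?thesis using assms(1) by (simp add: sha_l_def zero_prod_def)
qed

end

theorem theorem3p3:
  fixes scA :: "'k::field_char_0 \<Rightarrow> 'a::ab_group_add \<Rightarrow> 'a"
    and scM :: "'k \<Rightarrow> 'm::ab_group_add \<Rightarrow> 'm"
    and sc :: "'k \<Rightarrow> 'a \<times> 'm \<Rightarrow> 'a \<times> 'm"
    and scale :: "'k \<Rightarrow> ('w::semigroup_mult, 'a, 'm) sha \<Rightarrow> ('w, 'a, 'm) sha"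
    and L :: "int \<Rightarrow> ('w, 'a, 'm) sha set"
  assumes "vector_space scA" and "vector_space scM"
  defines "sc \<equiv> module_prod.scale scA scM"
    and "scale \<equiv> sha_scale sc"
    and "L \<equiv> sha_space sc"
  shows "\<exists>l. L_infinity_algebra scale L l \<and>
    (\<forall>m n q q'. q \<in> space_h' sc m \<and> q' \<in> space_h' sc n \<longrightarrow>
       (\<exists>r \<in> space_h' sc (m + n).
          (const_coll r :: 'w list \<Rightarrow> _) = bracket sc (const_coll q) (const_coll q') \<and>
          l 2 [in_h q, in_h q'] = scale ((-1) ^ m) (in_h r))) \<and>
    (\<forall>k m q ps. k \<ge> 2 \<and> q \<in> space_h' sc m \<and> length ps = k - 1 \<and> set ps \<subseteq> (\<Union>n. space_a sc n) \<longrightarrow>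
       l k (in_h q # map in_a ps) = in_a (proj_a (foldl (bracket sc) (const_coll q) ps))) \<and>
    (\<forall>x \<in> graded_vector_space.total scale L. l 1 [x] = 0) \<and>
    (\<forall>k xs. k \<ge> 1 \<and> length xs = k \<and> set xs \<subseteq> graded_vector_space.total scale L \<and>
       (\<forall>x \<in> set xs. x \<in> range in_a) \<longrightarrow> l k xs = 0) \<and>
    (\<forall>k xs. k \<ge> 3 \<and> length xs = k \<and> set xs \<subseteq> graded_vector_space.total scale L \<and>
       (\<exists>i j. i < j \<and> j < k \<and> xs ! i \<in> range in_h \<and> xs ! j \<in> range in_h) \<longrightarrow> l k xs = 0)"
proof -
  interpret VP: vector_space_prod scA scM
    using assms(1,2) by (simp add: vector_space_prod_def vector_space_pair_def)
  interpret labelled_maps_prod sc scA scM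
    unfolding sc_def
    by (intro labelled_maps_prod.intro labelled_maps.intro labelled_maps_prod_axioms.intro VP.p.vector_space_axioms VP.scale_prod)
  have total: "graded_vector_space.total scale L \<subseteq> sha_total"
    unfolding scale_def L_def by (rule total_subset)
  show ?thesis
  proof (rule exI[of _ sha_l], intro conjI allI ballI impI)
    show "L_infinity_algebra scale L sha_l"
      unfolding scale_def L_def by (rule L_infinity_algebra_sha)
    fix m n q q' assume "q \<in> space_h' sc m \<and> q' \<in> space_h' sc n"
    then show "\<exists>r \<in> space_h' sc (m + n).
          (const_coll r :: 'w list \<Rightarrow> _) = bracket sc (const_coll q) (const_coll q') \<and>
          sha_l 2 [in_h q, in_h q'] = scale ((-1) ^ m) (in_h r)"
      unfolding scale_def using bracket_h_in_space_h' const_coll_bracket_h sha_l_h_h by blast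
  next
    fix k m q and ps :: "('w list \<Rightarrow> ('a \<times> 'm) list \<Rightarrow> 'a \<times> 'm) list"
    assume "k \<ge> 2 \<and> q \<in> space_h' sc m \<and> length ps = k - 1 \<and> set ps \<subseteq> (\<Union>n. space_a sc n)"
    then show "sha_l k (in_h q # map in_a ps) = in_a (proj_a (foldl (bracket sc) (const_coll q) ps))"
      using sha_l_h_a[of q m ps] by simp
  next
    fix x assume "x \<in> graded_vector_space.total scale L"
    then show "sha_l 1 [x] = 0" using total by (intro sha_l_single) auto
  next
    fix k and xs :: "('w, 'a, 'm) sha list"
    assume "k \<ge> 1 \<and> length xs = k \<and> set xs \<subseteq> graded_vector_space.total scale L \<and>
       (\<forall>x \<in> set xs. x \<in> range in_a)"
    then show "sha_l k xs = 0" using total by (intro sha_l_in_a) auto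
  next
    fix k and xs :: "('w, 'a, 'm) sha list"
    assume "k \<ge> 3 \<and> length xs = k \<and> set xs \<subseteq> graded_vector_space.total scale L \<and>
       (\<exists>i j. i < j \<and> j < k \<and> xs ! i \<in> range in_h \<and> xs ! j \<in> range in_h)"
    then show "sha_l k xs = 0" using total sha_l_two_h by blast
  qed
qed

end
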